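(* Let $E$ and $F$ be Banach spaces and let $V:E\times F\to F$, $(e,y)\mapsto V_e(y)$, be a continuous map that is linear in the first argument and smooth (in the Fréchet sense) in the second argument, regarded as a continuous linear map $e\mapsto V_e$ from $E$ into the space of smooth vector fields on $F$. Let $T>0$, $p\ge 1$, let $\omega$ be a control, let $\mathbf{x}:\Delta_T\to\widehat{\mathfrak{Tr}}^{(\lfloor p\rfloor)}(E)$ be a branched $p$-rough path controlled by $\omega$, and let $y:[0,T]\to F$ be a continuous path. Then the following are equivalent. (i) There exists a function $\theta:\mathbb{R}\to\mathbb{R}$ with $\theta(h)/h\to 0$ as $h\to 0$ such that $$\lVert y_t-\Psi_{V,\mathrm{id},y_s}(\mathbf{x}_{s,t})\rVert\le\theta(\omega(s,t))\quad\text{for all }(s,t)\in\Delta_T,$$ where $\mathrm{id}:F\to F$ is the identity map. (ii) For every Banach space $G$ and every smooth $f:F\to G$ there exists a function $\theta_f:\mathbb{R}\to\mathbb{R}$ with $\theta_f(h)/h\to 0$ as $h\to 0$ such that $$\lVert f(y_t)-\Psi_{V,f,y_s}(\mathbf{x}_{s,t})\rVert\le\theta_f(\omega(s,t))\quad\text{for all }(s,t)\in\Delta_T.$$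
   Context: **Trees.** A (non-planar rooted) tree $\mathfrak t$ is an isomorphism class of finite partially ordered sets having a unique minimal element (the root $\mathrm r(\mathfrak t)$) and such that for each $v$ the set $\{w:w\prec v\}$ is totally ordered. $\mathfrak{Tr}$ is the set of trees; $\mathrm v(\mathfrak t)$ is the set of non-root vertices; $|\mathfrak t|:=|\mathrm v(\mathfrak t)|$ is the degree; $\mathbf 1$ is the tree of degree $0$; $\mathrm c(v)$ is the set of children (immediate successors) of $v$. $\mathrm{SG}(\mathfrak t)$ is the group of order-preserving bijections of $\mathrm v(\mathfrak t)$. Every representative $S$ of a tree carries an enumeration $\rho_S:\mathrm v(S)\to\{1,\dots,|\mathfrak t|\}$ (a bijection), and for two representatives $S,\tilde S$ there is an order isomorphism $\varphi:S\to\tilde S$ with $\rho_S=\rho_{\tilde S}\circ\varphi$. Via $\pi\mapsto\rho_{\mathfrak t}\pi\rho_{\mathfrak t}^{-1}$ we view $\mathrm{SG}(\mathfrak t)\subseteq\mathfrak S_{|\mathfrak t|}$. **Labelled trees.** $\sigma\in\mathfrak S_k$ acts on $E^{\otimes k}$ by $\sigma(v_1\otimes\cdots\otimes v_k)=v_{\sigma(1)}\otimes\cdots\otimes v_{\sigma(k)}$, and for a subgroup $H\subseteq\mathfrak S_k$, $\mathrm{sym}_H:=\frac1{|H|}\sum_{\sigma\in H}\sigma$. The tensor powers of the Banach space $E$ are equipped with a fixed symmetric system of cross norms: norms on $E^{\otimes k}$ (extending that of $E$) with $\lVert a\otimes b\rVert=\lVert a\rVert\lVert b\rVert$ and $\lVert\sigma(a)\rVert=\lVert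 a\rVert$ for all permutations $\sigma$. $E^{\hat\otimes k}$ is the completion ($E^{\otimes 0}=\mathbb R$), and $E^{\hat\otimes\mathfrak t}:=E^{\hat\otimes|\mathfrak t|}/\ker(\mathrm{sym}_{\mathrm{SG}(\mathfrak t)})$ with the quotient norm. An elementary labelled tree is a class containing an elementary tensor; it is thought of as $\mathfrak t$ with the vertex $v\in \mathrm v(\mathfrak t)$ labelled by the $\rho_{\mathfrak t}(v)$-th tensor factor. $\widehat{\mathfrak{Tr}}(E)$ is the closure of $\bigoplus_{\mathfrak t}E^{\hat\otimes\mathfrak t}$ in the product topology, i.e. $\prod_{\mathfrak t\in\mathfrak{Tr}}E^{\hat\otimes\mathfrak t}$. $\pi^k$ is the projection onto the components with $|\mathfrak t|=k$. $\widehat{\mathfrak{Tr}}^{(k)}(E)$ is the quotient of $\widehat{\mathfrak{Tr}}(E)$ by the subspace of elements supported on trees with $|\mathfrak t|>k$; it is identified as a vector space with $\bigoplus_{|\mathfrak t|\le k}E^{\hat\otimes\mathfrak t}$, which is a Banach space. $\pi^{(k)}:\widehat{\mathfrak{Tr}}(E)\to\widehat{\mathfrak{Tr}}^{(k)}(E)$ is the canonical projection. **Product $\star$.** $\mathrm{Gr}(\mathfrak t,\mathfrak s)$ is the set of maps $d:\mathrm c(\mathrm r(\mathfrak t))\to\mathfrak s$. For such $d$, $\mathfrak t\stackrel d\rightharpoonup\mathfrak s$ is the tree on $\mathrm v(\mathfrak t)\sqcup\mathfrak s$ with the additional relations $v\succ d(v)$ for $v\in\mathrm c(\mathrm r(\mathfrak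 t))$ and those forced by transitivity. For elementary labelled trees $\mathbf t,\mathbf s$ on $\mathfrak t,\mathfrak s$, $\mathbf t\star\mathbf s$ is the sum over $d\in\mathrm{Gr}(\mathfrak t,\mathfrak s)$ of $\mathfrak t\stackrel d\rightharpoonup\mathfrak s$ with the vertices keeping their labels; it is extended bilinearly and continuously. The elements supported on degree $>k$ form an ideal for $\star$, so $\star$ is defined on $\widehat{\mathfrak{Tr}}^{(k)}(E)$. **Coproduct $\Delta_{\mathrm{GL}}$.** $\circ$ denotes grafting all children of the root of the first tree to the root of the second (identification of roots, labels kept). Every elementary labelled tree decomposes as $\mathbf t=\mathbf t_1\circ\cdots\circ\mathbf t_k$ where each $\mathbf t_i$ lives on a tree whose root has exactly one child, and $\Delta_{\mathrm{GL}}(\mathbf t):=\sum_{I\subset\{1,\dots,k\}}\big(\bigcirc_{i\in I}\mathbf t_i\big)\otimes\big(\bigcirc_{i\in I^c}\mathbf t_i\big)$ (empty $\circ$-product $=\mathbf 1$), extended linearly and continuously to $\widehat{\mathfrak{Tr}}(E)\to\widehat{\mathfrak{Tr}}(E)\hat\otimes\widehat{\mathfrak{Tr}}(E)$. Here $\widehat{\mathfrak{Tr}}(E)\hat\otimes\widehat{\mathfrak{Tr}}(E)$ is the closure of $\bigoplus_{\mathfrak t,\mathfrak s}E^{\hat\otimes\mathfrak t}\hat\otimes E^{\hat\otimes\mathfrak s}$ in the product topology, and $E^{\otimes\mathfrak t}\otimes E^{\otimes\mathfrak s}$ is topologised as a quotient of $E^{\otimes(|\mathfrak t|+|\mathfrak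 s|)}$. **Controls and branched rough paths.** $\Delta_T:=\{(s,t)\in[0,T]^2:s\le t\}$. A control is a continuous $\omega:\Delta_T\to[0,\infty)$ with $\omega(s,s)=0$ and $\omega(s,t)+\omega(t,u)\le\omega(s,u)$ for $s\le t\le u$. A continuous map $\mathbf x:\Delta_T\to\widehat{\mathfrak{Tr}}^{(\lfloor p\rfloor)}(E)$ is a branched $p$-rough path controlled by $\omega$ if for all $0\le s\le t\le u\le T$ and $k\in\{1,\dots,\lfloor p\rfloor\}$: (a) $\mathbf x_{s,u}=\mathbf x_{s,t}\star\mathbf x_{t,u}$; (b) $\mathbf x_{s,t}=\pi^{(\lfloor p\rfloor)}(\mathbf g)$ for some group-like $\mathbf g\in\widehat{\mathfrak{Tr}}(E)$, i.e. $\mathbf g\neq0$ and $\Delta_{\mathrm{GL}}(\mathbf g)=\mathbf g\otimes\mathbf g$; (c) $\lVert\pi^k(\mathbf x_{s,t})\rVert\le\omega(s,t)^{k/p}$. **The map $\Psi_{V,f,y}$.** For smooth $f:F\to G$ ($G$ a Banach space) and $y\in F$, $\Psi_{V,f,y}$ is the linear map to $G$ given on elementary labelled trees as follows, and extended linearly and continuously. To a vertex $v$ labelled $e$ with children $v_1,\dots,v_m$ assign recursively $D_v:=V_e^{(m)}(y)[D_{v_1},\dots,D_{v_m}]\in F$ ($m$-th Fréchet derivative; $D_v=V_e(y)$ if $m=0$). If the children of the root are $w_1,\dots,w_k$, then $\Psi_{V,f,y}(\mathbf t):=f^{(k)}(y)[D_{w_1},\dots,D_{w_k}]$; in particular $\Psi_{V,f,y}(\mathbf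 1)=f(y)$.
   Formalization: For general cross norms Ψ need not extend continuously; it is assumed that Ψ_{V,id,y_s} exists and is jointly continuous in s and the tensor, and (ii) ranges over smooth f for which Ψ_{V,f,y_s} exists (automatic for projective norms or finite-dimensional E). *)

theory Defs
  imports
    "HOL-Analysis.Analysis"
    "HOL-Combinatorics.Permutations"
    "HOL-Library.FuncSet"
begin

text \<open>The value of the derivative of order \<open>length hs\<close> at \<open>y\<close> in the directions \<open>hs\<close>. By itself
  this is an iterated directional value; it is the Frechet derivative for \<open>smooth\<close> functions.\<close>

primrec hderiv :: "('f::real_normed_vector \<Rightarrow> 'g::real_normed_vector) \<Rightarrow> 'f list \<Rightarrow> 'f \<Rightarrow> 'g" where
  "hderiv f [] = f"
| "hderiv f (h # hs) = (\<lambda>y. frechet_derivative (hderiv f hs) (at y) h)"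

text \<open>\<open>k\<close>-linear maps are functions on lists, only the lists of length \<open>k\<close> being relevant.\<close>

definition multilinear :: "nat \<Rightarrow> ('e::real_vector list \<Rightarrow> 'g::real_vector) \<Rightarrow> bool" where
  "multilinear k M \<longleftrightarrow>
     (\<forall>us ws. length us + 1 + length ws = k \<longrightarrow> linear (\<lambda>v. M (us @ v # ws)))"

definition bounded_multilinear ::
  "nat \<Rightarrow> ('e::real_normed_vector list \<Rightarrow> 'g::real_normed_vector) \<Rightarrow> bool" where
  "bounded_multilinear k M \<longleftrightarrow>
     multilinear k M \<and> (\<exists>C. \<forall>vs. length vs = k \<longrightarrow> norm (M vs) \<le> C * prod_list (map norm vs))"

text \<open>Smoothness in the Frechet sense: for every \<open>k\<close> the derivative of order \<open>k\<close> takes values in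
  the bounded \<open>k\<close>-linear maps and is Frechet differentiable for the operator norm, i.e. uniformly
  over its \<open>k\<close> arguments.\<close>

definition smooth :: "('f::real_normed_vector \<Rightarrow> 'g::real_normed_vector) \<Rightarrow> bool" where
  "smooth f \<longleftrightarrow>
     (\<forall>k y. bounded_multilinear k (\<lambda>hs. hderiv f hs y) \<and>
        (\<forall>\<epsilon>>0. \<forall>\<^sub>F h in at 0. \<forall>hs. length hs = k \<longrightarrow>
           norm (hderiv f hs (y + h) - hderiv f hs y - hderiv f (h # hs) y)
             \<le> \<epsilon> * norm h * prod_list (map norm hs)))"

text \<open>A partially ordered set is given by its reflexive order relation \<open>r\<close>; its carrier is
  \<open>Field r\<close>.\<close>

definition tree_order :: "'v rel \<Rightarrow> bool" where
  "tree_order r \<longleftrightarrow> finite (Field r) \<and> Partial_order r \<and>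
     (\<exists>!a. a \<in> Field r \<and> (\<forall>b. (b, a) \<in> r \<longrightarrow> b = a)) \<and>
     (\<forall>v\<in>Field r. total_on {w. (w, v) \<in> r \<and> w \<noteq> v} r)"

definition tree_root :: "'v rel \<Rightarrow> 'v" where
  "tree_root r = (THE a. a \<in> Field r \<and> (\<forall>b. (b, a) \<in> r \<longrightarrow> b = a))"

definition vertices :: "'v rel \<Rightarrow> 'v set" where
  "vertices r = Field r - {tree_root r}"

definition children :: "'v rel \<Rightarrow> 'v \<Rightarrow> 'v set" where
  "children r v = {w. (v, w) \<in> r \<and> w \<noteq> v \<and>
     \<not> (\<exists>u. (v, u) \<in> r \<and> u \<noteq> v \<and> (u, w) \<in> r \<and> u \<noteq> w)}"

definition order_iso :: "('v \<Rightarrow> 'w) \<Rightarrow> 'v rel \<Rightarrow> 'w rel \<Rightarrow> bool" where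
  "order_iso \<phi> r q \<longleftrightarrow> bij_betw \<phi> (Field r) (Field q) \<and>
     (\<forall>a\<in>Field r. \<forall>b\<in>Field r. (a, b) \<in> r \<longleftrightarrow> (\<phi> a, \<phi> b) \<in> q)"

lemma order_iso_id: "order_iso id r r"
  by (simp add: order_iso_def)

lemma order_iso_inv:
  assumes "order_iso \<phi> r q"
  shows "order_iso (inv_into (Field r) \<phi>) q r"
proof -
  have b: "bij_betw \<phi> (Field r) (Field q)"
    and e: "\<And>a b. a \<in> Field r \<Longrightarrow> b \<in> Field r \<Longrightarrow> (a, b) \<in> r \<longleftrightarrow> (\<phi> a, \<phi> b) \<in> q"
    using assms by (auto simp: order_iso_def)
  have "inv_into (Field r) \<phi> a \<in> Field r" "\<phi> (inv_into (Field r) \<phi> a) = a"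
    if "a \<in> Field q" for a
    using that b by (auto simp: bij_betw_def intro: inv_into_into f_inv_into_f)
  then show ?thesis
    unfolding order_iso_def using bij_betw_inv_into[OF b] e by simp
qed

lemma order_iso_comp:
  assumes "order_iso \<phi> r q" "order_iso \<psi> q s"
  shows "order_iso (\<psi> \<circ> \<phi>) r s"
  using assms unfolding order_iso_def
  by (auto intro: bij_betw_trans simp: bij_betw_apply)

definition same_tree :: "nat rel \<Rightarrow> nat rel \<Rightarrow> bool" where
  "same_tree r q \<longleftrightarrow> tree_order r \<and> tree_order q \<and> (\<exists>\<phi>. order_iso \<phi> r q)"

text \<open>Every finite partially ordered set is isomorphic to one on natural numbers, so the
  isomorphism classes of the latter are all trees.\<close>

quotient_type tree = "nat rel" / partial: same_tree
proof (rule part_equivpI)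
  have "tree_order {(0::nat, 0)}"
    by (auto simp: tree_order_def Field_def partial_order_on_def preorder_on_def refl_on_def
        trans_def antisym_def total_on_def)
  then show "\<exists>r. same_tree r r"
    unfolding same_tree_def using order_iso_id by blast
  show "symp same_tree"
    unfolding same_tree_def symp_def using order_iso_inv by blast
  show "transp same_tree"
    unfolding same_tree_def transp_def using order_iso_comp by blast
qed

definition tree_of :: "'v rel \<Rightarrow> tree" where
  "tree_of r = abs_tree (SOME q. tree_order q \<and> (\<exists>\<phi>. order_iso \<phi> r q))"

definition deg :: "tree \<Rightarrow> nat" where
  "deg t = card (vertices (rep_tree t))"

definition Gr :: "tree \<Rightarrow> tree \<Rightarrow> (nat \<Rightarrow> nat) set" where
  "Gr t s = children (rep_tree t) (tree_root (rep_tree t)) \<rightarrow>\<^sub>E Field (rep_tree s)"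

definition graft :: "tree \<Rightarrow> tree \<Rightarrow> (nat \<Rightarrow> nat) \<Rightarrow> (nat + nat) rel" where
  "graft t s d =
     ({(Inl v, Inl w) | v w. (v, w) \<in> rep_tree t \<and> v \<in> vertices (rep_tree t) \<and> w \<in> vertices (rep_tree t)} \<union>
      {(Inr v, Inr w) | v w. (v, w) \<in> rep_tree s} \<union>
      {(Inr (d c), Inl c) | c. c \<in> children (rep_tree t) (tree_root (rep_tree t))})\<^sup>+"

text \<open>The product, with respect to identification of roots, of the branches at the children \<open>I\<close>
  of the root.\<close>

definition branches :: "nat rel \<Rightarrow> nat set \<Rightarrow> nat rel" where
  "branches r I = Restr r ({tree_root r} \<union> {v. \<exists>c\<in>I. (c, v) \<in> r})"

text \<open>The completed tensor powers of \<open>'e\<close> are realised as closed subspaces of one unital Banach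
  algebra \<open>'a\<close> whose multiplication is the tensor product, starting from an embedding \<open>\<iota>\<close> of \<open>'e\<close>.
  This is no restriction: for an arbitrary symmetric system of cross norms, the \<open>l\<^sup>1\<close>-sum of the
  completed tensor powers is such an algebra.\<close>

definition tensor :: "('e \<Rightarrow> 'a::monoid_mult) \<Rightarrow> 'e list \<Rightarrow> 'a" where
  "tensor \<iota> vs = prod_list (map \<iota> vs)"

definition tensor_power :: "('e \<Rightarrow> 'a::real_algebra_1) \<Rightarrow> nat \<Rightarrow> 'a set" where
  "tensor_power \<iota> k = span {tensor \<iota> vs | vs. length vs = k}"

text \<open>In \<open>universal\<close> scalar valued multilinear maps suffice, as linear functionals separate the
  points of a vector space. In \<open>norm_perm\<close>, \<open>A\<close> is the action of \<open>\<sigma>\<close> on the algebraic tensor power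
  (extended linearly to \<open>'a\<close> in an arbitrary way). List positions, hence also permutations and
  enumerations, start at 0.\<close>

locale tensor_powers =
  fixes \<iota> :: "'e::banach \<Rightarrow> 'a::{real_normed_algebra_1, banach}"
  assumes linear_\<iota>: "linear \<iota>"
    and universal: "\<And>k (M :: 'e list \<Rightarrow> real). multilinear k M \<Longrightarrow>
          \<exists>L. linear L \<and> (\<forall>vs. length vs = k \<longrightarrow> L (tensor \<iota> vs) = M vs)"
    and norm_\<iota>: "\<And>v. norm (\<iota> v) = norm v"
    and norm_mult_cross: "\<And>k l a b. a \<in> tensor_power \<iota> k \<Longrightarrow> b \<in> tensor_power \<iota> l \<Longrightarrow>
          norm (a * b) = norm a * norm b"
    and norm_perm: "\<And>k \<sigma> (A :: 'a \<Rightarrow> 'a) a. \<sigma> permutes {..<k} \<Longrightarrow> linear A \<Longrightarrow>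
          (\<forall>vs. length vs = k \<longrightarrow> A (tensor \<iota> vs) = tensor \<iota> (permute_list \<sigma> vs)) \<Longrightarrow>
          a \<in> tensor_power \<iota> k \<Longrightarrow> norm (A a) = norm a"
begin

definition ctensor_power :: "nat \<Rightarrow> 'a set" where
  "ctensor_power k = closure (tensor_power \<iota> k)"

text \<open>Only the values on \<open>ctensor_power k\<close> are determined (and relevant).\<close>

definition act :: "nat \<Rightarrow> (nat \<Rightarrow> nat) \<Rightarrow> 'a \<Rightarrow> 'a" where
  "act k \<sigma> = (SOME A. linear A \<and> continuous_on (ctensor_power k) A \<and>
     (\<forall>vs. length vs = k \<longrightarrow> A (tensor \<iota> vs) = tensor \<iota> (permute_list \<sigma> vs)))"

definition symmetrizer :: "nat \<Rightarrow> (nat \<Rightarrow> nat) set \<Rightarrow> 'a \<Rightarrow> 'a" where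
  "symmetrizer k H a = (1 / real (card H)) *\<^sub>R (\<Sum>\<sigma>\<in>H. act k \<sigma> a)"

definition sym_ker :: "nat \<Rightarrow> (nat \<Rightarrow> nat) set \<Rightarrow> 'a set" where
  "sym_ker k H = {a \<in> ctensor_power k. symmetrizer k H a = 0}"

end

text \<open>Elements of a quotient space are the cosets of the subspace \<open>N\<close>.\<close>

definition coset :: "'a::real_normed_vector set \<Rightarrow> 'a \<Rightarrow> 'a set" where
  "coset N a = (\<lambda>n. a + n) ` N"

definition some_rep :: "'a set \<Rightarrow> 'a" where
  "some_rep C = (SOME a. a \<in> C)"

definition quot_norm :: "'a::real_normed_vector set \<Rightarrow> real" where
  "quot_norm C = (INF c\<in>C. norm c)"

text \<open>For two bijections \<open>f\<close>, \<open>g\<close> from \<open>B\<close> onto the slots below \<open>card B\<close>, the permutation \<open>g \<circ> f\<^sup>-\<^sup>1\<close>.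
  If \<open>w \<in> B\<close> is labelled with the tensor factor number \<open>g w\<close> of \<open>a\<close>, then
  \<open>act (card B) (slot_perm B f g) a\<close> has this label as tensor factor number \<open>f w\<close>.\<close>

definition slot_perm :: "'v set \<Rightarrow> ('v \<Rightarrow> nat) \<Rightarrow> ('v \<Rightarrow> nat) \<Rightarrow> nat \<Rightarrow> nat" where
  "slot_perm B f g i = (if i < card B then g (inv_into B f i) else i)"

locale labelled_trees = tensor_powers \<iota>
  for \<iota> :: "'e::banach \<Rightarrow> 'a::{real_normed_algebra_1, banach}" +
  fixes \<rho> :: "tree \<Rightarrow> nat \<Rightarrow> nat"
  assumes bij_\<rho>: "\<And>t. bij_betw (\<rho> t) (vertices (rep_tree t)) {..<deg t}"
begin

text \<open>The enumeration \<open>\<rho>\<close> of the chosen representatives induces one of every other representative.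
  It depends on an isomorphism, which does not matter modulo the action of \<open>SG\<close>.\<close>

definition enum :: "'v rel \<Rightarrow> 'v \<Rightarrow> nat" where
  "enum r = \<rho> (tree_of r) \<circ> (SOME \<phi>. order_iso \<phi> r (rep_tree (tree_of r)))"

definition SG :: "tree \<Rightarrow> (nat \<Rightarrow> nat) set" where
  "SG t = {slot_perm (vertices (rep_tree t)) (\<rho> t) (\<rho> t \<circ> \<pi>) | \<pi>.
     \<pi> permutes vertices (rep_tree t) \<and>
     (\<forall>v\<in>vertices (rep_tree t). \<forall>w\<in>vertices (rep_tree t).
        (v, w) \<in> rep_tree t \<longrightarrow> (\<pi> v, \<pi> w) \<in> rep_tree t)}"

text \<open>\<open>E_zero t\<close> is the zero vector (and the divisor) of the quotient space \<open>E_tree t\<close>.\<close>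

definition E_zero :: "tree \<Rightarrow> 'a set" where
  "E_zero t = sym_ker (deg t) (SG t)"

definition E_tree :: "tree \<Rightarrow> 'a set set" where
  "E_tree t = coset (E_zero t) ` ctensor_power (deg t)"

definition Tr :: "(tree \<Rightarrow> 'a set) set" where
  "Tr = {X. \<forall>t. X t \<in> E_tree t}"

text \<open>The truncated space is identified with the elements that vanish on trees of degree above
  \<open>k\<close>, so that the canonical projection becomes \<open>trunc k\<close>.\<close>

definition trunc :: "nat \<Rightarrow> (tree \<Rightarrow> 'a set) \<Rightarrow> tree \<Rightarrow> 'a set" where
  "trunc k X t = (if deg t \<le> k then X t else E_zero t)"

definition Tr_trunc :: "nat \<Rightarrow> (tree \<Rightarrow> 'a set) set" where
  "Tr_trunc k = {X \<in> Tr. \<forall>t. deg t > k \<longrightarrow> X t = E_zero t}"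

text \<open>The norm of the component of degree \<open>k\<close> (the finite direct sum carries the maximum norm).\<close>

definition degree_norm :: "nat \<Rightarrow> (tree \<Rightarrow> 'a set) \<Rightarrow> real" where
  "degree_norm k X = Max ((\<lambda>t. quot_norm (X t)) ` {t. deg t = k})"

text \<open>In \<open>graft t s d\<close> the vertices of \<open>t\<close> are labelled with the first \<open>deg t\<close> factors of the tensor
  product of the two label tensors, the vertices of \<open>s\<close> with the remaining ones.\<close>

definition graft_slot :: "tree \<Rightarrow> tree \<Rightarrow> nat + nat \<Rightarrow> nat" where
  "graft_slot t s z = (case z of Inl v \<Rightarrow> \<rho> t v | Inr w \<Rightarrow> deg t + \<rho> s w)"

definition star :: "(tree \<Rightarrow> 'a set) \<Rightarrow> (tree \<Rightarrow> 'a set) \<Rightarrow> tree \<Rightarrow> 'a set" where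
  "star X Y u = coset (E_zero u)
     (\<Sum>(t, s) \<in> {(t, s). deg t + deg s = deg u}.
        \<Sum>d \<in> {d \<in> Gr t s. tree_of (graft t s d) = u}.
          act (deg u) (slot_perm (vertices (graft t s d)) (enum (graft t s d)) (graft_slot t s))
            (some_rep (X t) * some_rep (Y s)))"

text \<open>The completed tensor product of \<open>E_tree u\<close> and \<open>E_tree w\<close> is the quotient of the completed
  tensor power of exponent \<open>deg u + deg w\<close> by \<open>E_zero2 u w\<close>.\<close>

definition SG2 :: "tree \<Rightarrow> tree \<Rightarrow> (nat \<Rightarrow> nat) set" where
  "SG2 u w = {\<lambda>i. if i < deg u then \<sigma> i else deg u + \<tau> (i - deg u) | \<sigma> \<tau>. \<sigma> \<in> SG u \<and> \<tau> \<in> SG w}"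

definition E_zero2 :: "tree \<Rightarrow> tree \<Rightarrow> 'a set" where
  "E_zero2 u w = sym_ker (deg u + deg w) (SG2 u w)"

definition otimes :: "(tree \<Rightarrow> 'a set) \<Rightarrow> (tree \<Rightarrow> 'a set) \<Rightarrow> tree \<Rightarrow> tree \<Rightarrow> 'a set" where
  "otimes X Y u w = coset (E_zero2 u w) (some_rep (X u) * some_rep (Y w))"

definition split_slot :: "nat rel \<Rightarrow> nat rel \<Rightarrow> nat \<Rightarrow> nat" where
  "split_slot q q' v =
     (if v \<in> vertices q then enum q v else card (vertices q) + enum q' v)"

definition Delta_GL :: "(tree \<Rightarrow> 'a set) \<Rightarrow> tree \<Rightarrow> tree \<Rightarrow> 'a set" where
  "Delta_GL X u w = coset (E_zero2 u w)
     (\<Sum>t \<in> {t. deg t = deg u + deg w}.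
        let r = rep_tree t; C = children r (tree_root r) in
        \<Sum>I \<in> {I \<in> Pow C. tree_of (branches r I) = u \<and> tree_of (branches r (C - I)) = w}.
          act (deg t)
            (slot_perm (vertices r) (split_slot (branches r I) (branches r (C - I))) (\<rho> t))
            (some_rep (X t)))"

definition group_like :: "(tree \<Rightarrow> 'a set) \<Rightarrow> bool" where
  "group_like g \<longleftrightarrow> g \<in> Tr \<and> g \<noteq> E_zero \<and> Delta_GL g = otimes g g"

end

definition time_simplex :: "real \<Rightarrow> (real \<times> real) set" where
  "time_simplex T = {(s, t). 0 \<le> s \<and> s \<le> t \<and> t \<le> T}"

definition control :: "real \<Rightarrow> (real \<times> real \<Rightarrow> real) \<Rightarrow> bool" where
  "control T \<omega> \<longleftrightarrow> continuous_on (time_simplex T) \<omega> \<and>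
     (\<forall>z\<in>time_simplex T. \<omega> z \<ge> 0) \<and> (\<forall>s\<in>{0..T}. \<omega> (s, s) = 0) \<and>
     (\<forall>s t u. 0 \<le> s \<and> s \<le> t \<and> t \<le> u \<and> u \<le> T \<longrightarrow> \<omega> (s, t) + \<omega> (t, u) \<le> \<omega> (s, u))"

context labelled_trees
begin

text \<open>The distance of two elements of \<open>E_tree \<tau>\<close> in the quotient norm is the \<open>setdist\<close> of the
  cosets.\<close>

definition branched_rough_path ::
  "real \<Rightarrow> real \<Rightarrow> (real \<times> real \<Rightarrow> real) \<Rightarrow> (real \<times> real \<Rightarrow> tree \<Rightarrow> 'a set) \<Rightarrow> bool" where
  "branched_rough_path T p \<omega> x \<longleftrightarrow>
     (\<forall>z\<in>time_simplex T. x z \<in> Tr_trunc (nat \<lfloor>p\<rfloor>)) \<and>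
     (\<forall>\<tau>. \<forall>z\<in>time_simplex T. ((\<lambda>z'. setdist (x z' \<tau>) (x z \<tau>)) \<longlongrightarrow> 0) (at z within time_simplex T)) \<and>
     (\<forall>s t u. 0 \<le> s \<and> s \<le> t \<and> t \<le> u \<and> u \<le> T \<longrightarrow>
        x (s, u) = trunc (nat \<lfloor>p\<rfloor>) (star (x (s, t)) (x (t, u)))) \<and>
     (\<forall>z\<in>time_simplex T. \<exists>g. group_like g \<and> x z = trunc (nat \<lfloor>p\<rfloor>) g) \<and>
     (\<forall>z\<in>time_simplex T. \<forall>k\<in>{1..nat \<lfloor>p\<rfloor>}. degree_norm k (x z) \<le> \<omega> z powr (real k / p))"

text \<open>The family \<open>D\<close> of vectors attached to the vertices of the tree \<open>t\<close> with labels \<open>vs\<close>. The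
  order in which children are listed is immaterial for smooth functions.\<close>

definition vertex_vectors :: "('e \<Rightarrow> 'f \<Rightarrow> 'f) \<Rightarrow> 'f \<Rightarrow> tree \<Rightarrow> 'e list \<Rightarrow> nat \<Rightarrow> 'f::banach" where
  "vertex_vectors V y t vs = (SOME D. \<forall>v\<in>vertices (rep_tree t).
     D v = hderiv (V (vs ! \<rho> t v)) (map D (sorted_list_of_set (children (rep_tree t) v))) y)"

definition Psi_elem ::
  "('e \<Rightarrow> 'f \<Rightarrow> 'f) \<Rightarrow> ('f \<Rightarrow> 'g) \<Rightarrow> 'f::banach \<Rightarrow> tree \<Rightarrow> 'e list \<Rightarrow> 'g::banach" where
  "Psi_elem V f y t vs = hderiv f (map (vertex_vectors V y t vs)
     (sorted_list_of_set (children (rep_tree t) (tree_root (rep_tree t))))) y"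

text \<open>\<open>Psi_extension V f y t \<Phi>\<close>: on the completed tensor power, \<open>\<Phi>\<close> is the linear and continuous
  extension of the values on elementary labelled trees with underlying tree \<open>t\<close> (it passes to the
  quotient \<open>E_tree t\<close>). It exists, e.g., for the projective norms or if \<open>'e\<close> is finite dimensional,
  but not for every \<open>V\<close> and \<open>f\<close> and every system of cross norms: for the Hilbert-Schmidt norms a bounded
  bilinear map need not extend. \<open>Psi_defined N\<close> says that the map is defined up to degree \<open>N\<close>.\<close>

definition Psi_extension ::
  "('e \<Rightarrow> 'f \<Rightarrow> 'f) \<Rightarrow> ('f \<Rightarrow> 'g) \<Rightarrow> 'f::banach \<Rightarrow> tree \<Rightarrow> ('a \<Rightarrow> 'g::banach) \<Rightarrow> bool" where
  "Psi_extension V f y t \<Phi> \<longleftrightarrow> linear \<Phi> \<and> continuous_on (ctensor_power (deg t)) \<Phi> \<and>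
     (\<forall>vs. length vs = deg t \<longrightarrow> \<Phi> (tensor \<iota> vs) = Psi_elem V f y t vs)"

definition Psi_defined ::
  "nat \<Rightarrow> ('e \<Rightarrow> 'f \<Rightarrow> 'f) \<Rightarrow> ('f \<Rightarrow> 'g::banach) \<Rightarrow> 'f::banach \<Rightarrow> bool" where
  "Psi_defined N V f y \<longleftrightarrow> (\<forall>t. deg t \<le> N \<longrightarrow> (\<exists>\<Phi>. Psi_extension V f y t \<Phi>))"

definition Psi_tree ::
  "('e \<Rightarrow> 'f \<Rightarrow> 'f) \<Rightarrow> ('f \<Rightarrow> 'g) \<Rightarrow> 'f::banach \<Rightarrow> tree \<Rightarrow> 'a \<Rightarrow> 'g::banach" where
  "Psi_tree V f y t = (SOME \<Phi>. Psi_extension V f y t \<Phi>)"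

definition Psi ::
  "nat \<Rightarrow> ('e \<Rightarrow> 'f \<Rightarrow> 'f) \<Rightarrow> ('f \<Rightarrow> 'g) \<Rightarrow> 'f::banach \<Rightarrow> (tree \<Rightarrow> 'a set) \<Rightarrow> 'g::banach" where
  "Psi N V f y X = (\<Sum>t \<in> {t. deg t \<le> N}. Psi_tree V f y t (some_rep (X t)))"

end

end

theory Submission
  imports Defs
begin

text \<open>Write \<open>y\<^sub>t - y\<^sub>s = P + R\<close> where \<open>P\<close> is the value of \<open>\<Psi>\<close> for the identity on the trees of positive degree and \<open>R\<close>
  is negligible against \<open>\<omega>\<close>, and expand \<open>f (y\<^sub>t)\<close> by Taylor's formula at \<open>y\<^sub>s\<close>. Only planted trees contribute
  to \<open>P\<close>, so \<open>D\<^sup>kf(y\<^sub>s)[P, \<dots>, P]\<close> is a sum over \<open>k\<close>-tuples of planted trees. As the values of \<open>x\<close> are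
  group-like, the part of total degree at most \<open>\<lfloor>p\<rfloor>\<close> of this sum is \<open>k!\<close> times the contribution to
  \<open>\<Psi>\<close> for \<open>f\<close> of the trees with \<open>k\<close> children of the root; the remaining part is of order
  \<open>\<omega> powr ((\<lfloor>p\<rfloor> + 1) / p)\<close>. The exact identity is proved by induction on \<open>k\<close> simultaneously for all \<open>f\<close>: one
  application of the coproduct splits off a planted tree with value \<open>v\<close> and replaces \<open>f\<close> by the
  derivative of \<open>f\<close> in the constant direction \<open>v\<close>.\<close>

section \<open>Higher derivatives of smooth functions\<close>

text \<open>For a general system of cross norms a bounded multilinear map need not extend to the
  completed tensor power, so neither the existence nor the size of the values of \<Psi> follows from
  bounds on derivatives. Existence: the induction needs \<Psi> for the derivative of
  \<open>f\<close> in a direction \<open>v\<close>, about which nothing is assumed. It is obtained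
  from the extension for \<open>f\<close> on a tree that joins a planted tree \<open>u\<close> to
  \<open>w\<close>: after a permutation of slots this is a map on the tensor power of exponent
  \<open>deg u + deg w\<close>, and freezing the first factor at \<open>g u\<close> leaves the
  required map on \<open>w\<close>. Size: only the values for the identity are estimated in the
  tensor norms, uniformly in time by their joint continuity. The values for \<open>f\<close> are
  estimated after the exact identity has turned them into derivatives of \<open>f\<close> at vectors
  of the Banach space, on the compact set of all segments between points of the path. The factor
  \<open>k!\<close> is a count: a tree with \<open>k + 1\<close> children of the root can lose any
  one of them. The induction starts at the tree of degree 0, where being group-like and nonzero
  forces the component 1.\<close>

declare hderiv.simps(2) [simp del]

abbreviation norms :: "'a::real_normed_vector list \<Rightarrow> real" where
  "norms hs \<equiv> prod_list (map norm hs)"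

text \<open>The head of the list is the direction differentiated in last. Arguments appended on the
  right therefore replace \<open>f\<close> by one of its derivatives, which is how the induction on
  the number of root children changes \<open>f\<close>.\<close>

lemma hderiv_append: "hderiv f (hs @ gs) = hderiv (hderiv f gs) hs"
  by (induction hs) (simp_all add: hderiv.simps)

lemma smooth_linear:
  assumes "smooth f"
  shows "linear (\<lambda>v. hderiv f (us @ v # ws) y)"
proof -
  have "bounded_multilinear (length us + 1 + length ws) (\<lambda>hs. hderiv f hs y)"
    using assms by (simp add: smooth_def)
  then show ?thesis
    by (simp add: bounded_multilinear_def multilinear_def)
qed

lemmas smooth_linear_hd = smooth_linear[where us = "[]", simplified]

lemma smooth_bound:
  assumes "smooth f"
  shows "\<exists>C\<ge>0. \<forall>hs. length hs = k \<longrightarrow> norm (hderiv f hs y) \<le> C * norms hs"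
proof -
  obtain C where C: "norm (hderiv f hs y) \<le> C * norms hs" if "length hs = k" for hs
    using assms unfolding smooth_def bounded_multilinear_def by blast
  have "0 \<le> norms hs" for hs :: "'a list"
    by (induction hs) simp_all
  then have "norm (hderiv f hs y) \<le> \<bar>C\<bar> * norms hs" if "length hs = k" for hs
    using C[OF that] by (meson abs_ge_self mult_right_mono order_trans)
  then show ?thesis
    by (intro exI[of _ "\<bar>C\<bar>"]) auto
qed

lemma prod_list_norm_nonneg: "0 \<le> norms hs"
  by (induction hs) simp_all

lemma smooth_remainder:
  assumes "smooth f" "e > 0"
  obtains d where "d > 0" "\<And>h hs. norm h < d \<Longrightarrow> length hs = k \<Longrightarrow>
    norm (hderiv f hs (y + h) - hderiv f hs y - hderiv f (h # hs) y) \<le> e * norm h * norms hs"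
proof -
  have "\<forall>\<^sub>F h in at 0. \<forall>hs. length hs = k \<longrightarrow>
    norm (hderiv f hs (y + h) - hderiv f hs y - hderiv f (h # hs) y) \<le> e * norm h * norms hs"
    using assms by (simp add: smooth_def)
  then obtain d where d: "d > 0" "\<And>h hs. h \<noteq> 0 \<Longrightarrow> norm h < d \<Longrightarrow> length hs = k \<Longrightarrow>
    norm (hderiv f hs (y + h) - hderiv f hs y - hderiv f (h # hs) y) \<le> e * norm h * norms hs"
    unfolding eventually_at by (auto simp: dist_norm)
  \<comment> \<open>The filter \<open>at 0\<close> leaves out \<open>h = 0\<close>, where the
    remainder vanishes by linearity.\<close>
  moreover have "hderiv f (0 # hs) y = 0" for hs
    using linear_0[OF smooth_linear_hd[OF assms(1)]] .
  ultimately show ?thesis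
    by (intro that[of d]) (metis add_0_right diff_self mult_zero_left mult_zero_right norm_zero order_refl)+
qed

text \<open>\<open>frechet_derivative\<close> is an arbitrary choice at points without a derivative;
  the remainder estimate in \<open>smooth\<close>, read for fixed \<open>hs\<close>, shows that this
  case does not arise.\<close>

lemma hderiv_has_derivative:
  assumes "smooth f"
  shows "(hderiv f hs has_derivative (\<lambda>h. hderiv f (h # hs) y)) (at y)"
  unfolding has_derivative_at_alt
proof (intro conjI allI impI)
  obtain C where C: "norm (hderiv f gs y) \<le> C * norms gs" if "length gs = Suc (length hs)" for gs
    using smooth_bound[OF assms, of "Suc (length hs)" y] by blast
  show "bounded_linear (\<lambda>h. hderiv f (h # hs) y)"
  proof (rule bounded_linear_intro)
    show "norm (hderiv f (x # hs) y) \<le> norm x * (C * norms hs)" for x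
      using C[of "x # hs"] by (simp add: mult.left_commute)
  qed (simp_all add: linear_add[OF smooth_linear_hd[OF assms]] linear_scale[OF smooth_linear_hd[OF assms]])
  fix e :: real assume e: "e > 0"
  \<comment> \<open>The \<open>1\<close> keeps the tolerance \<open>e / Q\<close> positive when one
    of the fixed directions is zero.\<close>
  define Q where "Q = norms hs + 1"
  have Q: "Q > 0" "norms hs \<le> Q"
    using prod_list_norm_nonneg[of hs] by (simp_all add: Q_def)
  obtain d where d: "d > 0" "\<And>h gs. norm h < d \<Longrightarrow> length gs = length hs \<Longrightarrow>
    norm (hderiv f gs (y + h) - hderiv f gs y - hderiv f (h # gs) y) \<le> e / Q * norm h * norms gs"
    using smooth_remainder[OF assms, of "e / Q" "length hs" y] e Q by (metis divide_pos_pos)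
  have "norm (hderiv f hs z - hderiv f hs y - hderiv f ((z - y) # hs) y) \<le> e * norm (z - y)"
    if "norm (z - y) < d" for z
  proof -
    have "norm (hderiv f hs z - hderiv f hs y - hderiv f ((z - y) # hs) y)
        \<le> e / Q * norm (z - y) * norms hs"
      using d(2)[OF that, of hs] by simp
    also have "\<dots> \<le> e / Q * norm (z - y) * Q"
      using Q e by (intro mult_left_mono) auto
    finally show ?thesis using Q by simp
  qed
  with d(1) show "\<exists>d>0. \<forall>z. norm (z - y) < d \<longrightarrow>
      norm (hderiv f hs z - hderiv f hs y - hderiv f ((z - y) # hs) y) \<le> e * norm (z - y)"
    by blast
qed

lemma hderiv_path_derivative:
  assumes "smooth f"
  shows "((\<lambda>s. hderiv f hs (z + s *\<^sub>R a)) has_vector_derivative hderiv f (a # hs) (z + s *\<^sub>R a)) (at s within S)"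
proof -
  have "((\<lambda>s. z + s *\<^sub>R a) has_derivative (\<lambda>s. s *\<^sub>R a)) (at s within S)"
    by (auto intro!: derivative_eq_intros)
  from has_derivative_compose[OF this hderiv_has_derivative[OF assms]]
  show ?thesis
    by (simp add: has_vector_derivative_def linear_scale[OF smooth_linear_hd[OF assms]])
qed

text \<open>Both conditions of order \<open>k\<close> for \<open>hderiv f gs\<close> are those of
  order \<open>k + length gs\<close> for \<open>f\<close>, with the last arguments frozen at
  \<open>gs\<close>.\<close>

lemma smooth_hderiv:
  assumes "smooth f"
  shows "smooth (hderiv f gs)"
  unfolding smooth_def
proof (intro allI conjI impI)
  fix k y
  have "norm (hderiv f (hs @ gs) y) \<le> C * norms gs * norms hs"
    if "\<And>hs. length hs = k + length gs \<Longrightarrow> norm (hderiv f hs y) \<le> C * norms hs"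
      "length hs = k" for C hs
    using that(1)[of "hs @ gs"] that(2) by (simp add: mult_ac)
  moreover obtain C where "\<And>hs. length hs = k + length gs \<Longrightarrow> norm (hderiv f hs y) \<le> C * norms hs"
    using smooth_bound[OF assms, of "k + length gs" y] by blast
  ultimately show "bounded_multilinear k (\<lambda>hs. hderiv (hderiv f gs) hs y)"
    unfolding bounded_multilinear_def multilinear_def hderiv_append[symmetric]
    using smooth_linear[OF assms, of _ "_ @ gs"] by auto
  fix e :: real assume e: "e > 0"
  define Q where "Q = norms gs + 1"
  have Q: "Q > 0" "norms gs \<le> Q"
    using prod_list_norm_nonneg[of gs] by (simp_all add: Q_def)
  obtain d where d: "d > 0" "\<And>h hs. norm h < d \<Longrightarrow> length hs = k + length gs \<Longrightarrow>
    norm (hderiv f hs (y + h) - hderiv f hs y - hderiv f (h # hs) y) \<le> e / Q * norm h * norms hs"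
    using smooth_remainder[OF assms, of "e / Q" "k + length gs" y] e Q by (metis divide_pos_pos)
  have "norm (hderiv f (hs @ gs) (y + h) - hderiv f (hs @ gs) y - hderiv f (h # hs @ gs) y)
      \<le> e * norm h * norms hs" if h: "norm h < d" "length hs = k" for h hs
  proof -
    have "norm (hderiv f (hs @ gs) (y + h) - hderiv f (hs @ gs) y - hderiv f (h # hs @ gs) y)
      \<le> e / Q * norm h * (norms hs * norms gs)"
      using d(2)[of h "hs @ gs"] h by simp
    also have "\<dots> \<le> e / Q * norm h * (norms hs * Q)"
      using e Q prod_list_norm_nonneg[of hs] by (intro mult_left_mono) auto
    finally show ?thesis using Q by simp
  qed
  with d(1) show "\<forall>\<^sub>F h in at 0. \<forall>hs. length hs = k \<longrightarrow>
      norm (hderiv (hderiv f gs) hs (y + h) - hderiv (hderiv f gs) hs y - hderiv (hderiv f gs) (h # hs) y)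
      \<le> e * norm h * norms hs"
    unfolding eventually_at hderiv_append[symmetric] by (intro exI[of _ d]) (auto simp: dist_norm)
qed

section \<open>Symmetry of higher derivatives\<close>

lemma second_difference:
  assumes f: "smooth f" and "e > 0"
  obtains d where "d > 0" "\<And>t. 0 < t \<Longrightarrow> t < d \<Longrightarrow>
    norm (f (y + t *\<^sub>R a + t *\<^sub>R b) - f (y + t *\<^sub>R a) - f (y + t *\<^sub>R b) + f y - t\<^sup>2 *\<^sub>R hderiv f [b, a] y) \<le> e * t\<^sup>2"
proof -
  define M where "M = norm a + norm b + 1"
  have M: "M > 0" "norm a \<le> M" by (simp_all add: M_def add_nonneg_pos)
  \<comment> \<open>One factor \<open>M\<close> absorbs \<open>norm a\<close>, the other the bound
    \<open>t * M\<close> on the increments, and the \<open>2\<close> the two remainders that are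
    subtracted below.\<close>
  obtain d where d: "d > 0" "\<And>h hs. norm h < d \<Longrightarrow> length hs = 1 \<Longrightarrow>
    norm (hderiv f hs (y + h) - hderiv f hs y - hderiv f (h # hs) y) \<le> e / (2 * M * M) * norm h * norms hs"
    using smooth_remainder[OF f, of "e / (2 * M * M)" 1 y] assms(2) M
    by (metis divide_pos_pos mult_pos_pos zero_less_numeral)
  have R: "norm (hderiv f [a] (y + h) - hderiv f [a] y - hderiv f [h, a] y) \<le> e * t / 2"
    if "0 < t" "t < d / M" "norm h \<le> t * M" for h t
  proof -
    have "norm h < d" using that M by (simp add: field_simps)
    then have "norm (hderiv f [a] (y + h) - hderiv f [a] y - hderiv f [h, a] y) \<le> e / (2 * M * M) * norm h * norm a"
      using d(2)[of h "[a]"] by simp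
    also have "\<dots> \<le> e / (2 * M * M) * (t * M) * M"
      using that M assms(2) by (intro mult_mono) (auto intro!: divide_nonneg_nonneg)
    finally show ?thesis using M by (simp add: field_simps)
  qed
  have "norm (f (y + t *\<^sub>R a + t *\<^sub>R b) - f (y + t *\<^sub>R a) - f (y + t *\<^sub>R b) + f y - t\<^sup>2 *\<^sub>R hderiv f [b, a] y) \<le> e * t\<^sup>2"
    if t: "0 < t" "t < d / M" for t
  proof -
    \<comment> \<open>With the expected linear term removed, the derivative of \<open>g\<close> is a
      difference of two first order remainders of \<open>hderiv f [a]\<close>, and the mean value
      inequality on \<open>{0..t}\<close> applies.\<close>
    define g where "g s = f (y + t *\<^sub>R b + s *\<^sub>R a) - f (y + s *\<^sub>R a) - s *\<^sub>R t *\<^sub>R hderiv f [b, a] y" for s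
    define g' where "g' s = hderiv f [a] (y + t *\<^sub>R b + s *\<^sub>R a) - hderiv f [a] (y + s *\<^sub>R a) - t *\<^sub>R hderiv f [b, a] y" for s
    have der: "(g has_vector_derivative g' s) (at s within {0..t})" for s
      unfolding g_def g'_def
      using hderiv_path_derivative[OF f, of "[]"]
      by (auto intro!: derivative_eq_intros)
    have bnd: "norm (g' s) \<le> e * t" if s: "s \<in> {0..t}" for s
    proof -
      have n1: "norm (s *\<^sub>R a) \<le> t * norm a" "norm (t *\<^sub>R b) = t * norm b"
        using s t by (auto intro: mult_right_mono)
      have n2: "norm (t *\<^sub>R b + s *\<^sub>R a) \<le> t * M"
        using n1 norm_triangle_ineq[of "t *\<^sub>R b" "s *\<^sub>R a"] t by (simp add: M_def algebra_simps)
      have n3: "norm (s *\<^sub>R a) \<le> t * M"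
        using n1 M t mult_left_mono[of "norm a" M t] by linarith
      have lin: "hderiv f [t *\<^sub>R b + s *\<^sub>R a, a] y = t *\<^sub>R hderiv f [b, a] y + hderiv f [s *\<^sub>R a, a] y"
        using linear_add[OF smooth_linear_hd[OF f, of "[a]" y], of "t *\<^sub>R b" "s *\<^sub>R a"]
          linear_scale[OF smooth_linear_hd[OF f, of "[a]" y], of t b] by simp
      have "g' s = (hderiv f [a] (y + (t *\<^sub>R b + s *\<^sub>R a)) - hderiv f [a] y - hderiv f [t *\<^sub>R b + s *\<^sub>R a, a] y)
          - (hderiv f [a] (y + s *\<^sub>R a) - hderiv f [a] y - hderiv f [s *\<^sub>R a, a] y)"
        unfolding lin by (simp add: g'_def algebra_simps)
      also have "norm \<dots> \<le> e * t / 2 + e * t / 2"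
        by (rule order_trans[OF norm_triangle_ineq4 add_mono[OF R[OF t n2] R[OF t n3]]])
      finally show ?thesis by simp
    qed
    have "norm (g t - g 0) \<le> e * t * norm (t - 0)"
    proof (rule differentiable_bound[where S = "{0..t}" and f' = "\<lambda>s h. h *\<^sub>R g' s"])
      show "onorm (\<lambda>h. h *\<^sub>R g' s) \<le> e * t" if "s \<in> {0..t}" for s
        using bnd[OF that] by (intro onorm_bound) (auto simp: mult.commute intro!: mult_left_mono mult_nonneg_nonneg assms(2)[THEN less_imp_le] t(1)[THEN less_imp_le])
    qed (use der t in \<open>auto simp: has_vector_derivative_def\<close>)
    moreover have "g t - g 0 = f (y + t *\<^sub>R a + t *\<^sub>R b) - f (y + t *\<^sub>R a) - f (y + t *\<^sub>R b) + f y - t\<^sup>2 *\<^sub>R hderiv f [b, a] y"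
      by (simp add: g_def power2_eq_square algebra_simps)
    ultimately show ?thesis
      using t by (simp add: power2_eq_square)
  qed
  then show ?thesis
    using d(1) M by (intro that[of "d / M"]) auto
qed

text \<open>The second difference over the parallelogram spanned by \<open>t *\<^sub>R a\<close> and
  \<open>t *\<^sub>R b\<close> is symmetric in \<open>a\<close> and \<open>b\<close>, while after
  division by \<open>t\<^sup>2\<close> it tends to either of the two mixed derivatives.\<close>

lemma hderiv_swap2:
  assumes f: "smooth f"
  shows "hderiv f [a, b] y = hderiv f [b, a] y"
proof -
  have "norm (hderiv f [a, b] y - hderiv f [b, a] y) \<le> e" if "e > 0" for e
  proof -
    obtain d1 where d1: "d1 > 0" "\<And>t. 0 < t \<Longrightarrow> t < d1 \<Longrightarrow>
      norm (f (y + t *\<^sub>R a + t *\<^sub>R b) - f (y + t *\<^sub>R a) - f (y + t *\<^sub>R b) + f y - t\<^sup>2 *\<^sub>R hderiv f [b, a] y) \<le> e / 2 * t\<^sup>2"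
      using second_difference[OF f half_gt_zero[OF \<open>e > 0\<close>], of y a b] by blast
    obtain d2 where d2: "d2 > 0" "\<And>t. 0 < t \<Longrightarrow> t < d2 \<Longrightarrow>
      norm (f (y + t *\<^sub>R b + t *\<^sub>R a) - f (y + t *\<^sub>R b) - f (y + t *\<^sub>R a) + f y - t\<^sup>2 *\<^sub>R hderiv f [a, b] y) \<le> e / 2 * t\<^sup>2"
      using second_difference[OF f half_gt_zero[OF \<open>e > 0\<close>], of y b a] by blast
    define t where "t = min d1 d2 / 2"
    have t: "0 < t" "t < d1" "t < d2" using d1(1) d2(1) by (auto simp: t_def)
    define S where "S = f (y + t *\<^sub>R a + t *\<^sub>R b) - f (y + t *\<^sub>R a) - f (y + t *\<^sub>R b) + f y"
    have "norm (S - t\<^sup>2 *\<^sub>R hderiv f [b, a] y) \<le> e / 2 * t\<^sup>2" "norm (S - t\<^sup>2 *\<^sub>R hderiv f [a, b] y) \<le> e / 2 * t\<^sup>2"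
      using d1(2)[OF t(1,2)] d2(2)[OF t(1,3)] by (simp_all add: S_def algebra_simps)
    then have "norm ((S - t\<^sup>2 *\<^sub>R hderiv f [b, a] y) - (S - t\<^sup>2 *\<^sub>R hderiv f [a, b] y)) \<le> e / 2 * t\<^sup>2 + e / 2 * t\<^sup>2"
      by (intro order_trans[OF norm_triangle_ineq4 add_mono])
    moreover have "(S - t\<^sup>2 *\<^sub>R hderiv f [b, a] y) - (S - t\<^sup>2 *\<^sub>R hderiv f [a, b] y)
        = t\<^sup>2 *\<^sub>R (hderiv f [a, b] y - hderiv f [b, a] y)"
      by (simp add: algebra_simps)
    ultimately have "t\<^sup>2 * norm (hderiv f [a, b] y - hderiv f [b, a] y) \<le> t\<^sup>2 * e"
      by (simp add: mult.commute)
    then show ?thesis using t(1) by simp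
  qed
  then have "norm (hderiv f [a, b] y - hderiv f [b, a] y) \<le> 0"
    by (metis field_le_epsilon add_0)
  then show ?thesis by simp
qed

lemma hderiv_swap:
  assumes "smooth f"
  shows "hderiv f (a # b # hs) = hderiv f (b # a # hs)"
  using hderiv_swap2[OF smooth_hderiv[OF assms, of hs]]
  by (simp add: fun_eq_iff hderiv_append[symmetric])

lemma hderiv_move:
  assumes "smooth f"
  shows "hderiv f (xs @ a # ys) = hderiv f (a # xs @ ys)"
proof (induction xs)
  case (Cons x xs)
  have "hderiv f ((x # xs) @ a # ys) = hderiv f (x # a # xs @ ys)"
    using Cons by (simp add: hderiv.simps)
  then show ?case using hderiv_swap[OF assms] by simp
qed simp

text \<open>Children are listed in the numerical order of their names, which isomorphisms do not
  respect, so values of trees must not depend on the order of the directions.\<close>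

lemma hderiv_mset:
  assumes "smooth f" "mset hs = mset gs"
  shows "hderiv f hs = hderiv f gs"
  using assms(2)
proof (induction hs arbitrary: gs)
  case (Cons a hs)
  then have "a \<in> set gs" by (metis list.set_intros(1) set_mset_mset)
  then obtain xs ys where gs: "gs = xs @ a # ys" by (meson split_list)
  then have "hderiv f hs = hderiv f (xs @ ys)" using Cons by simp
  then show ?case using hderiv_move[OF assms(1), of xs a ys] gs by (simp add: hderiv.simps)
qed simp

lemma hderiv_sum:
  assumes "smooth f"
  shows "hderiv f (us @ (\<Sum>i\<in>A. v i) # ws) y = (\<Sum>i\<in>A. hderiv f (us @ v i # ws) y)"
  using linear_sum[OF smooth_linear[OF assms]] .

text \<open>The second part is the reason why a tree with several children of the root contributes
  nothing for the identity.\<close>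

lemma hderiv_id:
  fixes h :: "'a::real_normed_vector" and hs :: "'a list"
  shows "hderiv id [h] = (\<lambda>y. h)" "length hs \<ge> 2 \<Longrightarrow> hderiv id hs = (\<lambda>y. 0)"
proof -
  show 1: "hderiv id [h] = (\<lambda>y. h)" for h :: 'a
    by (simp add: id_def hderiv.simps)
  have *: "hderiv id (hs @ [a, b]) = (\<lambda>y. 0)" for hs and a b :: 'a
  proof (induction hs)
    case Nil
    show ?case using 1[of b] by (simp add: hderiv.simps)
  qed (simp add: hderiv.simps)
  assume "length hs \<ge> 2"
  then have "hs = butlast (butlast hs) @ [last (butlast hs), last hs]"
    by (cases hs rule: rev_cases; cases "butlast hs" rule: rev_cases) (auto simp: butlast_append)
  then show "hderiv id hs = (\<lambda>y. 0)" using *[of "butlast (butlast hs)" "last (butlast hs)" "last hs"] by simp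
qed

lemma smooth_id: "smooth id"
proof -
  have cases: "length hs = 0 \<or> length hs = 1 \<or> length hs \<ge> 2" for hs :: "'a list" by linarith
  have zero: "norm (hderiv id hs (y + h) - hderiv id hs y - hderiv id (h # hs) y) = 0" for hs and y h :: 'a
    using cases[of hs]
  proof (elim disjE)
    assume "length hs = 0" then show ?thesis using hderiv_id(1)[of h] by simp
  next
    assume "length hs = 1"
    then obtain a where "hs = [a]" by (metis One_nat_def length_0_conv length_Suc_conv)
    then show ?thesis using hderiv_id(1)[of a] hderiv_id(2)[of "[h, a]"] by simp
  next
    assume "length hs \<ge> 2" then show ?thesis using hderiv_id(2)[of hs] hderiv_id(2)[of "h # hs"] by simp
  qed
  have lin: "linear (\<lambda>v. hderiv id (us @ v # ws) y)" for us ws and y :: 'a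
  proof (cases "us = [] \<and> ws = []")
    case True
    then show ?thesis by (simp add: hderiv_id linear_ident)
  next
    case False
    then have "length (us @ v # ws) \<ge> 2" for v by (cases us; cases ws) simp_all
    then show ?thesis by (simp add: hderiv_id linear_zero)
  qed
  have bnd: "\<exists>C. \<forall>hs. length hs = k \<longrightarrow> norm (hderiv id hs y) \<le> C * norms hs" for k and y :: 'a
  proof (intro exI[of _ "if k = 0 then norm y else 1"] allI impI)
    fix hs :: "'a list" assume k: "length hs = k"
    show "norm (hderiv id hs y) \<le> (if k = 0 then norm y else 1) * norms hs"
      using cases[of hs]
    proof (elim disjE)
      assume "length hs = 1"
      then obtain a where "hs = [a]" by (metis One_nat_def length_0_conv length_Suc_conv)
      then show ?thesis using hderiv_id(1)[of a] k by simp
    next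
      assume "length hs \<ge> 2" then show ?thesis using hderiv_id(2)[of hs] prod_list_norm_nonneg[of hs] k by auto
    qed (use k in auto)
  qed
  show ?thesis
    unfolding smooth_def bounded_multilinear_def multilinear_def zero
    using lin bnd prod_list_norm_nonneg by (auto intro!: always_eventually mult_nonneg_nonneg)
qed

section \<open>Taylor's formula with bounds on compact sets\<close>

lemma hderiv_compact_bound:
  fixes f :: "'f::real_normed_vector \<Rightarrow> 'g::real_normed_vector"
  assumes f: "smooth f" and K: "compact K"
  obtains C where "C \<ge> 0"
    "\<And>z hs. z \<in> K \<Longrightarrow> length hs = k \<Longrightarrow> norm (hderiv f hs z) \<le> C * norms hs"
proof -
  \<comment> \<open>Derivatives of a smooth map may be unbounded on a bounded set in infinite
    dimensions; they are bounded locally, and compactness of \<open>K\<close> makes finitely many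
    local bounds suffice.\<close>
  have "\<exists>d>0. \<exists>C\<ge>0. \<forall>z hs. dist y z < d \<longrightarrow> length hs = k \<longrightarrow> norm (hderiv f hs z) \<le> C * norms hs" for y
  proof -
    obtain C0 where C0: "C0 \<ge> 0" "\<And>hs. length hs = k \<Longrightarrow> norm (hderiv f hs y) \<le> C0 * norms hs"
      using smooth_bound[OF f, of k y] by blast
    obtain C1 where C1: "C1 \<ge> 0" "\<And>hs. length hs = Suc k \<Longrightarrow> norm (hderiv f hs y) \<le> C1 * norms hs"
      using smooth_bound[OF f, of "Suc k" y] by blast
    obtain d where d: "d > 0" "\<And>h hs. norm h < d \<Longrightarrow> length hs = k \<Longrightarrow>
      norm (hderiv f hs (y + h) - hderiv f hs y - hderiv f (h # hs) y) \<le> 1 * norm h * norms hs"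
      using smooth_remainder[OF f, of 1 k y] by (metis zero_less_one)
    \<comment> \<open>On the ball of radius \<open>d\<close> the remainder, taken with tolerance 1,
      contributes \<open>d\<close>, the value at \<open>y\<close> contributes \<open>C0\<close> and
      the linear term \<open>C1 * d\<close>.\<close>
    have "norm (hderiv f hs z) \<le> (d + C0 + C1 * d) * norms hs"
      if z: "dist y z < d" "length hs = k" for z hs
    proof -
      let ?P = "norms hs"
      define h where "h = z - y"
      have h: "norm h < d" "z = y + h" using z by (simp_all add: h_def dist_norm norm_minus_commute)
      have "norm (hderiv f hs z) \<le> norm (hderiv f hs (y + h) - hderiv f hs y - hderiv f (h # hs) y)
          + norm (hderiv f hs y) + norm (hderiv f (h # hs) y)"
        unfolding h(2) by norm
      also have "\<dots> \<le> norm h * ?P + C0 * ?P + C1 * (norm h * ?P)"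
        using d(2)[OF h(1) z(2)] C0(2)[OF z(2)] C1(2)[of "h # hs"] z(2) by simp
      also have "\<dots> \<le> d * ?P + C0 * ?P + C1 * (d * ?P)"
        using h(1) C1(1) prod_list_norm_nonneg[of hs] by (intro add_mono mult_left_mono mult_right_mono) auto
      finally show ?thesis by (simp add: algebra_simps)
    qed
    then show ?thesis using d(1) C0(1) C1(1) by (intro exI[of _ d] conjI exI[of _ "d + C0 + C1 * d"]) auto
  qed
  then obtain d C where d: "\<And>y. d y > 0" and C: "\<And>y. C y \<ge> 0"
    "\<And>y z hs. dist y z < d y \<Longrightarrow> length hs = k \<Longrightarrow> norm (hderiv f hs z) \<le> C y * norms hs"
    by metis
  obtain Y where Y: "finite Y" "K \<subseteq> (\<Union>y\<in>Y. ball y (d y))"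
  proof (rule compactE_image[OF K, of K "\<lambda>y. ball y (d y)"])
    show "K \<subseteq> (\<Union>y\<in>K. ball y (d y))" using d by auto
  qed auto
  show ?thesis
  proof (rule that[of "\<Sum>y\<in>Y. C y"])
    show "(\<Sum>y\<in>Y. C y) \<ge> 0" using C(1) by (simp add: sum_nonneg)
    fix z and hs :: "'f list" assume z: "z \<in> K" "length hs = k"
    then obtain y where y: "y \<in> Y" "dist y z < d y" using Y by auto
    have "norm (hderiv f hs z) \<le> C y * norms hs" using C(2) y z by blast
    also have "\<dots> \<le> (\<Sum>y\<in>Y. C y) * norms hs"
      using y Y C(1) by (intro mult_right_mono prod_list_norm_nonneg member_le_sum) auto
    finally show "norm (hderiv f hs z) \<le> (\<Sum>y\<in>Y. C y) * norms hs" .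
  qed
qed

lemma prod_list_norm_replicate: "norms (replicate k D) = norm D ^ k"
  by (induction k) simp_all

text \<open>Taylor's formula with integral remainder along
  \<open>s \<mapsto> y + s *\<^sub>R D\<close>, so that bounds are required only on this segment;
  the weight in the remainder is at most 1.\<close>

lemma smooth_taylor:
  fixes f :: "'f::real_normed_vector \<Rightarrow> 'g::banach"
  assumes f: "smooth f" and C: "\<And>s hs. s \<in> {0..1} \<Longrightarrow> length hs = Suc N \<Longrightarrow>
    norm (hderiv f hs (y + s *\<^sub>R D)) \<le> C * norms hs"
  shows "norm (f (y + D) - (\<Sum>k\<le>N. (1 / fact k) *\<^sub>R hderiv f (replicate k D) y)) \<le> C * norm D ^ Suc N"
proof -
  define Df where "Df k s = hderiv f (replicate k D) (y + s *\<^sub>R D)" for k s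
  have "((\<lambda>x. ((1 - x) ^ (Suc N - 1) / fact (Suc N - 1)) *\<^sub>R Df (Suc N) x) has_integral
      Df 0 1 - (\<Sum>i<Suc N. ((1 - 0) ^ i / fact i) *\<^sub>R Df i 0)) {0..1}"
    by (rule Taylor_has_integral) (use hderiv_path_derivative[OF f] in \<open>auto simp: Df_def\<close>)
  moreover have CD: "norm (Df (Suc N) x) \<le> C * norm D ^ Suc N" if "x \<in> {0..1}" for x
    using C[OF that, of "replicate (Suc N) D"] by (simp only: Df_def length_replicate prod_list_norm_replicate)
  moreover have "0 \<le> C * norm D ^ Suc N"
    using CD[of 0] by (meson atLeastAtMost_iff norm_ge_zero order.trans order_refl zero_le_one)
  moreover have "norm (((1 - x) ^ (Suc N - 1) / fact (Suc N - 1)) *\<^sub>R Df (Suc N) x) \<le> C * norm D ^ Suc N"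
    if x: "x \<in> {0..1}" for x
  proof -
    have "(1 - x) ^ N \<le> 1" "(1::real) \<le> fact N"
      using x by (auto intro: power_le_one)
    then have "(1 - x) ^ N / fact N \<le> 1"
      by (metis divide_le_eq_1_pos fact_gt_zero order_trans)
    then have "\<bar>(1 - x) ^ N / fact N\<bar> * norm (Df (Suc N) x) \<le> 1 * norm (Df (Suc N) x)"
      using x by (intro mult_right_mono) auto
    with CD[OF x] show ?thesis by simp
  qed
  ultimately have "norm (Df 0 1 - (\<Sum>i<Suc N. ((1 - 0) ^ i / fact i) *\<^sub>R Df i 0)) \<le>
      (C * norm D ^ Suc N) * Henstock_Kurzweil_Integration.content {0..1::real}"
    by (intro has_integral_bound_real[where S = "{}"]) auto
  then show ?thesis
    by (simp add: Df_def lessThan_Suc_atMost)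
qed

section \<open>Finite rooted trees\<close>

lemma tree_orderD:
  assumes "tree_order r"
  shows "finite (Field r)" "finite r" "\<And>a. a \<in> Field r \<Longrightarrow> (a, a) \<in> r"
    "\<And>a b c. (a, b) \<in> r \<Longrightarrow> (b, c) \<in> r \<Longrightarrow> (a, c) \<in> r" "\<And>a b. (a, b) \<in> r \<Longrightarrow> (b, a) \<in> r \<Longrightarrow> a = b"
    "\<And>a b v. (a, v) \<in> r \<Longrightarrow> (b, v) \<in> r \<Longrightarrow> (a, b) \<in> r \<or> (b, a) \<in> r"
proof -
  show fin: "finite (Field r)"
    using assms by (simp add: tree_order_def)
  have "r \<subseteq> Field r \<times> Field r"
    by (auto simp: Field_def)
  then show "finite r"
    using fin by (meson finite_SigmaI finite_subset)
  show refl: "\<And>a. a \<in> Field r \<Longrightarrow> (a, a) \<in> r"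
    and "\<And>a b c. (a, b) \<in> r \<Longrightarrow> (b, c) \<in> r \<Longrightarrow> (a, c) \<in> r" "\<And>a b. (a, b) \<in> r \<Longrightarrow> (b, a) \<in> r \<Longrightarrow> a = b"
    using assms by (auto simp: tree_order_def partial_order_on_def preorder_on_def refl_on_def
        dest: transD antisymD)
  fix a b v assume ab: "(a, v) \<in> r" "(b, v) \<in> r"
  then have "v \<in> Field r" "a \<in> Field r" by (auto simp: Field_def)
  then have "total_on {w. (w, v) \<in> r \<and> w \<noteq> v} r"
    using assms by (auto simp: tree_order_def)
  then show "(a, b) \<in> r \<or> (b, a) \<in> r"
    using ab refl[OF \<open>a \<in> Field r\<close>] by (cases "a = b"; cases "a = v"; cases "b = v") (auto simp: total_on_def)
qed

lemma tree_root:
  assumes "tree_order r"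
  shows "tree_root r \<in> Field r" "\<And>b. (b, tree_root r) \<in> r \<Longrightarrow> b = tree_root r"
    "\<And>a. a \<in> Field r \<Longrightarrow> (\<And>b. (b, a) \<in> r \<Longrightarrow> b = a) \<Longrightarrow> a = tree_root r"
proof -
  have ex: "\<exists>!a. a \<in> Field r \<and> (\<forall>b. (b, a) \<in> r \<longrightarrow> b = a)"
    using assms by (simp add: tree_order_def)
  have *: "tree_root r \<in> Field r \<and> (\<forall>b. (b, tree_root r) \<in> r \<longrightarrow> b = tree_root r)"
    unfolding tree_root_def by (rule theI'[OF ex])
  then show "tree_root r \<in> Field r" "\<And>b. (b, tree_root r) \<in> r \<Longrightarrow> b = tree_root r" by auto
  show "\<And>a. a \<in> Field r \<Longrightarrow> (\<And>b. (b, a) \<in> r \<Longrightarrow> b = a) \<Longrightarrow> a = tree_root r"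
    using ex * by blast
qed

lemma tree_order_minimal:
  assumes r: "tree_order r" and S: "a \<in> S"
  obtains m where "m \<in> S" "\<And>b. b \<in> S \<Longrightarrow> (b, m) \<in> r \<Longrightarrow> b = m"
proof -
  \<comment> \<open>Fewest predecessors: a member of \<open>S\<close> strictly below
    \<open>m\<close> would have fewer.\<close>
  obtain m where m: "m \<in> S" "\<And>b. b \<in> S \<Longrightarrow> card {u. (u, m) \<in> r} \<le> card {u. (u, b) \<in> r}"
    using ex_has_least_nat[of "\<lambda>b. b \<in> S" a "\<lambda>b. card {u. (u, b) \<in> r}"] S by auto
  have "b = m" if b: "b \<in> S" "(b, m) \<in> r" for b
  proof (rule ccontr)
    assume "b \<noteq> m"
    then have "{u. (u, b) \<in> r} \<subset> {u. (u, m) \<in> r}"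
      using tree_orderD(3-5)[OF r] b(2) by (blast intro: FieldI2)
    moreover have "finite {u. (u, m) \<in> r}"
      by (rule finite_subset[OF _ tree_orderD(1)[OF r]]) (auto simp: Field_def)
    ultimately show False
      using m(2)[OF b(1)] psubset_card_mono not_le by metis
  qed
  with m(1) show ?thesis using that by blast
qed

lemma tree_root_below:
  assumes r: "tree_order r" and v: "v \<in> Field r"
  shows "(tree_root r, v) \<in> r"
proof -
  obtain m where m: "(m, v) \<in> r" "\<And>b. (b, v) \<in> r \<Longrightarrow> (b, m) \<in> r \<Longrightarrow> b = m"
    using tree_order_minimal[OF r, of v "{w. (w, v) \<in> r}"] tree_orderD(3)[OF r v] by auto
  have "b = m" if "(b, m) \<in> r" for b
    using m tree_orderD(4)[OF r that m(1)] that by blast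
  then have "m = tree_root r"
    using tree_root(3)[OF r] m(1) by (auto simp: Field_def)
  with m show ?thesis by simp
qed

lemma childrenD:
  assumes "w \<in> children r v"
  shows "(v, w) \<in> r" "w \<noteq> v" "w \<in> Field r" "\<And>u. (v, u) \<in> r \<Longrightarrow> (u, w) \<in> r \<Longrightarrow> u = v \<or> u = w"
  using assms by (auto simp: children_def Field_def)

lemma finite_children: "tree_order r \<Longrightarrow> finite (children r v)"
  using childrenD(3) tree_orderD(1) by (metis finite_subset subsetI)

lemma finite_vertices: "tree_order r \<Longrightarrow> finite (vertices r)"
  by (simp add: vertices_def tree_orderD)

lemma Field_eq_vertices: "tree_order r \<Longrightarrow> Field r = insert (tree_root r) (vertices r)"
  using tree_root(1) by (auto simp: vertices_def)

lemma children_vertices: "tree_order r \<Longrightarrow> w \<in> children r v \<Longrightarrow> w \<in> vertices r"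
  unfolding vertices_def using childrenD tree_root(2) by (metis Diff_iff singletonD)

text \<open>The child is the lowest non-root vertex below \<open>v\<close>. Two candidates are
  comparable, because the vertices below \<open>v\<close> form a chain, and comparable children of
  one vertex coincide.\<close>

lemma vertex_branch:
  assumes r: "tree_order r" and v: "v \<in> vertices r"
  shows "\<exists>!c. c \<in> children r (tree_root r) \<and> (c, v) \<in> r"
proof (rule ex_ex1I)
  have vf: "v \<in> Field r" "v \<noteq> tree_root r" using v by (auto simp: vertices_def)
  then have "v \<in> {w. (w, v) \<in> r \<and> w \<noteq> tree_root r}" using tree_orderD(3)[OF r] by blast
  from tree_order_minimal[OF r this] obtain m where "m \<in> {w. (w, v) \<in> r \<and> w \<noteq> tree_root r}"
    "\<And>b. b \<in> {w. (w, v) \<in> r \<and> w \<noteq> tree_root r} \<Longrightarrow> (b, m) \<in> r \<Longrightarrow> b = m" by blast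
  then have m: "(m, v) \<in> r" "m \<noteq> tree_root r" "\<And>b. (b, v) \<in> r \<Longrightarrow> b \<noteq> tree_root r \<Longrightarrow> (b, m) \<in> r \<Longrightarrow> b = m"
    by blast+
  have "m \<in> Field r" using m(1) by (auto simp: Field_def)
  then have "m \<in> children r (tree_root r)"
    using m tree_root_below[OF r] tree_orderD(4)[OF r] unfolding children_def by blast
  with m(1) show "\<exists>c. c \<in> children r (tree_root r) \<and> (c, v) \<in> r" by blast
next
  fix c d assume *: "c \<in> children r (tree_root r) \<and> (c, v) \<in> r" "d \<in> children r (tree_root r) \<and> (d, v) \<in> r"
  then have "(c, d) \<in> r \<or> (d, c) \<in> r" using tree_orderD(6)[OF r] by blast
  with * show "c = d" using childrenD by metis
qed

text \<open>Descending in this relation means climbing towards the leaves, so recursion along it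
  treats children before their parent.\<close>

lemma wf_upwards: "tree_order r \<Longrightarrow> wf {(w, v). (v, w) \<in> r \<and> w \<noteq> v}"
proof (rule wf_subset[OF wf_measure[of "\<lambda>v. card {u. (v, u) \<in> r}"]], safe)
  fix v w assume r: "tree_order r" and vw: "(v, w) \<in> r" "w \<noteq> v"
  have "{u. (v, u) \<in> r} \<subseteq> Field r" by (auto simp: Field_def)
  then have "finite {u. (v, u) \<in> r}" using tree_orderD(1)[OF r] finite_subset by blast
  moreover have "v \<in> Field r" using vw by (auto simp: Field_def)
  then have "{u. (w, u) \<in> r} \<subset> {u. (v, u) \<in> r}"
    using tree_orderD(3-5)[OF r] vw by blast
  ultimately show "(w, v) \<in> Wellfounded.measure (\<lambda>v. card {u. (v, u) \<in> r})"
    by (simp add: psubset_card_mono)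
qed

section \<open>Isomorphisms and the vectors at the vertices\<close>

lemma order_isoD:
  assumes "order_iso \<phi> r q"
  shows "bij_betw \<phi> (Field r) (Field q)"
    "\<And>a b. a \<in> Field r \<Longrightarrow> b \<in> Field r \<Longrightarrow> (a, b) \<in> r \<longleftrightarrow> (\<phi> a, \<phi> b) \<in> q"
  using assms by (auto simp: order_iso_def)

lemma order_iso_root:
  assumes r: "tree_order r" and q: "tree_order q" and \<phi>: "order_iso \<phi> r q"
  shows "\<phi> (tree_root r) = tree_root q"
proof (rule tree_root(3)[OF q])
  show "\<phi> (tree_root r) \<in> Field q"
    using bij_betw_apply[OF order_isoD(1)[OF \<phi>] tree_root(1)[OF r]] .
  fix b assume b: "(b, \<phi> (tree_root r)) \<in> q"
  then have "b \<in> Field q" by (auto simp: Field_def)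
  then obtain a where a: "a \<in> Field r" "b = \<phi> a"
    using order_isoD(1)[OF \<phi>] by (auto simp: bij_betw_def)
  with b have "(a, tree_root r) \<in> r" using order_isoD(2)[OF \<phi>] tree_root(1)[OF r] by blast
  then show "b = \<phi> (tree_root r)" using tree_root(2)[OF r] a by blast
qed

lemma order_iso_vertices:
  assumes r: "tree_order r" and q: "tree_order q" and \<phi>: "order_iso \<phi> r q"
  shows "bij_betw \<phi> (vertices r) (vertices q)"
  unfolding vertices_def order_iso_root[OF assms, symmetric]
  using bij_betw_DiffI[OF order_isoD(1)[OF \<phi>], of "{tree_root r}" "{\<phi> (tree_root r)}"] tree_root(1)[OF r]
    bij_betw_apply[OF order_isoD(1)[OF \<phi>] tree_root(1)[OF r]]
  by (simp add: bij_betw_def)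

lemma order_iso_children:
  assumes \<phi>: "order_iso \<phi> r q" and v: "v \<in> Field r"
  shows "children q (\<phi> v) = \<phi> ` children r v"
proof -
  have inj: "inj_on \<phi> (Field r)" and im: "\<phi> ` Field r = Field q"
    using order_isoD(1)[OF \<phi>] by (auto simp: bij_betw_def)
  have *: "\<phi> w \<in> children q (\<phi> v) \<longleftrightarrow> w \<in> children r v" if w: "w \<in> Field r" for w
  proof -
    have "(\<exists>u. (\<phi> v, u) \<in> q \<and> u \<noteq> \<phi> v \<and> (u, \<phi> w) \<in> q \<and> u \<noteq> \<phi> w) \<longleftrightarrow>
        (\<exists>u\<in>Field q. (\<phi> v, u) \<in> q \<and> u \<noteq> \<phi> v \<and> (u, \<phi> w) \<in> q \<and> u \<noteq> \<phi> w)"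
      by (auto simp: Field_def)
    also have "\<dots> \<longleftrightarrow> (\<exists>u\<in>Field r. (v, u) \<in> r \<and> u \<noteq> v \<and> (u, w) \<in> r \<and> u \<noteq> w)"
      unfolding im[symmetric] using order_isoD(2)[OF \<phi>] inj v w by (auto simp: inj_on_eq_iff)
    also have "\<dots> \<longleftrightarrow> (\<exists>u. (v, u) \<in> r \<and> u \<noteq> v \<and> (u, w) \<in> r \<and> u \<noteq> w)"
      by (auto simp: Field_def)
    finally show ?thesis
      using order_isoD(2)[OF \<phi> v w] inj_on_eq_iff[OF inj w v]
      by (simp only: children_def mem_Collect_eq)
  qed
  show ?thesis
  proof (intro set_eqI iffI)
    fix z assume z: "z \<in> children q (\<phi> v)"
    then obtain w where "w \<in> Field r" "z = \<phi> w" using im childrenD(3)[OF z] by blast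
    with z * show "z \<in> \<phi> ` children r v" by blast
  next
    fix z assume "z \<in> \<phi> ` children r v"
    then obtain w where w: "w \<in> children r v" "z = \<phi> w" by blast
    with * childrenD(3)[OF w(1)] show "z \<in> children q (\<phi> v)" by blast
  qed
qed

lemma mset_map_sorted_list: "finite A \<Longrightarrow> mset (map D (sorted_list_of_set A)) = image_mset D (mset_set A)"
  by (metis mset_map mset_sorted_list_of_multiset sorted_list_of_mset_set)

text \<open>The recursion of \<open>vertex_vectors\<close> for an arbitrary order \<open>r\<close>
  and a labelling of its vertices. Unions of branches are not chosen representatives, hence the
  independence from \<open>rep_tree\<close> and \<open>\<rho>\<close>.\<close>

definition decorates :: "('e \<Rightarrow> 'f \<Rightarrow> 'f) \<Rightarrow> 'f \<Rightarrow> nat rel \<Rightarrow> (nat \<Rightarrow> 'e) \<Rightarrow> (nat \<Rightarrow> 'f::real_normed_vector) \<Rightarrow> bool" where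
  "decorates V y r lab D \<longleftrightarrow>
     (\<forall>v\<in>vertices r. D v = hderiv (V (lab v)) (map D (sorted_list_of_set (children r v))) y)"

lemma decorates_exists:
  assumes r: "tree_order r"
  shows "\<exists>D. decorates V y r lab D"
proof -
  let ?R = "{(w, v). (v, w) \<in> r \<and> w \<noteq> v}"
  define H where "H D v = hderiv (V (lab v)) (map D (sorted_list_of_set (children r v))) y" for D v
  have "wfrec ?R H v = H (wfrec ?R H) v" for v
  proof -
    \<comment> \<open>Children precede their parent in \<open>?R\<close>, so restricting the
      function by \<open>cut\<close> does not affect the values that \<open>H\<close> reads.\<close>
    have "map (cut (wfrec ?R H) ?R v) (sorted_list_of_set (children r v))
        = map (wfrec ?R H) (sorted_list_of_set (children r v))"
      using finite_children[OF r, of v] by (intro map_cong) (auto simp: cut_def dest: childrenD)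
    then have "H (cut (wfrec ?R H) ?R v) v = H (wfrec ?R H) v"
      unfolding H_def by (rule arg_cong)
    then show ?thesis using wfrec[OF wf_upwards[OF r], of H v] by simp
  qed
  then show ?thesis
    unfolding decorates_def H_def by blast
qed

lemma hderiv_children_iso:
  assumes f: "smooth f" and r: "tree_order r" and \<phi>: "order_iso \<phi> r q" and v: "v \<in> Field r"
    and eq: "\<And>w. w \<in> children r v \<Longrightarrow> D w = D' (\<phi> w)"
  shows "hderiv f (map D' (sorted_list_of_set (children q (\<phi> v))))
    = hderiv f (map D (sorted_list_of_set (children r v)))"
proof (rule hderiv_mset[OF f])
  have "inj_on \<phi> (children r v)"
    using order_isoD(1)[OF \<phi>] childrenD(3) by (metis bij_betw_def inj_on_subset subsetI)
  then have "image_mset D' (mset_set (children q (\<phi> v))) = image_mset D' (image_mset \<phi> (mset_set (children r v)))"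
    by (simp add: order_iso_children[OF \<phi> v] image_mset_mset_set)
  also have "\<dots> = image_mset D (mset_set (children r v))"
    using eq by (auto intro!: image_mset_cong simp: multiset.map_comp finite_children[OF r])
  finally show "mset (map D' (sorted_list_of_set (children q (\<phi> v)))) = mset (map D (sorted_list_of_set (children r v)))"
    using finite_children[OF r, of v]
    by (simp add: mset_map_sorted_list order_iso_children[OF \<phi> v] del: mset_map)
qed

text \<open>Induction from the leaves. For \<phi> the identity it says that the recursion determines
  \<open>D\<close> on the non-root vertices, so the choice made in \<open>vertex_vectors\<close> is
  immaterial.\<close>

lemma decorates_iso:
  assumes V: "\<And>e. smooth (V e)" and r: "tree_order r" and q: "tree_order q" and \<phi>: "order_iso \<phi> r q"
    and lab: "\<And>v. v \<in> vertices r \<Longrightarrow> lab v = lab' (\<phi> v)"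
    and D: "decorates V y r lab D" and D': "decorates V y q lab' D'"
    and v: "v \<in> vertices r"
  shows "D v = D' (\<phi> v)"
  using v
proof (induction v rule: wf_induct[OF wf_upwards[OF r]])
  case (1 v)
  have vF: "v \<in> Field r" using 1 by (simp add: vertices_def)
  have "D w = D' (\<phi> w)" if "w \<in> children r v" for w
    using 1 childrenD(1,2)[OF that] children_vertices[OF r that] by blast
  from hderiv_children_iso[where f = "V (lab v)" and D = D and D' = D', OF V r \<phi> vF this]
  show ?case
    using D D' 1 lab[of v] bij_betw_apply[OF order_iso_vertices[OF r q \<phi>], of v]
    by (simp add: decorates_def)
qed

lemma hderiv_root_iso:
  assumes f: "smooth f" and V: "\<And>e. smooth (V e)" and r: "tree_order r" and q: "tree_order q" and \<phi>: "order_iso \<phi> r q"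
    and lab: "\<And>v. v \<in> vertices r \<Longrightarrow> lab v = lab' (\<phi> v)"
    and D: "decorates V y r lab D" and D': "decorates V y q lab' D'"
  shows "hderiv f (map D' (sorted_list_of_set (children q (tree_root q))))
    = hderiv f (map D (sorted_list_of_set (children r (tree_root r))))"
  using hderiv_children_iso[OF f r \<phi> tree_root(1)[OF r], of D D']
    decorates_iso[OF V r q \<phi> lab D D'] children_vertices[OF r]
  unfolding order_iso_root[OF r q \<phi>] by blast

section \<open>Branches at the root\<close>

lemma tree_order_Restr:
  assumes r: "tree_order r" and A: "A \<subseteq> Field r" "tree_root r \<in> A"
  shows "tree_order (Restr r A)" "Field (Restr r A) = A" "tree_root (Restr r A) = tree_root r"
    "vertices (Restr r A) = A - {tree_root r}"
proof -
  show F: "Field (Restr r A) = A"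
    using A(1) tree_orderD(3)[OF r] unfolding Field_def by blast
  have below: "(tree_root r, a) \<in> Restr r A" if "a \<in> A" for a
    using that A tree_root_below[OF r] by blast
  have "Partial_order (Restr r A)"
    unfolding partial_order_on_def preorder_on_def F
    using A(1) tree_orderD(3-5)[OF r]
    by (auto simp: refl_on_def trans_def antisym_def subset_iff)
  moreover have "total_on {w. (w, v) \<in> Restr r A \<and> w \<noteq> v} (Restr r A)" for v
    using tree_orderD(6)[OF r] by (auto simp: total_on_def)
  moreover have "\<exists>!a. a \<in> A \<and> (\<forall>b. (b, a) \<in> Restr r A \<longrightarrow> b = a)"
    using A(2) below tree_root(2)[OF r] by (intro ex1I[of _ "tree_root r"]) auto
  ultimately show *: "tree_order (Restr r A)"
    unfolding tree_order_def F using A(1) tree_orderD(1)[OF r] finite_subset by blast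
  show "tree_root (Restr r A) = tree_root r"
    using tree_root(2)[OF r] A(2) F by (intro tree_root(3)[OF *, symmetric]) auto
  then show "vertices (Restr r A) = A - {tree_root r}"
    by (simp add: vertices_def F)
qed

text \<open>A union of branches is closed upwards, so its non-root vertices keep all their children
  and only the root can lose some.\<close>

lemma branches:
  assumes r: "tree_order r" and I: "I \<subseteq> children r (tree_root r)"
  shows "tree_order (branches r I)" "tree_root (branches r I) = tree_root r"
    "vertices (branches r I) = {v. \<exists>c\<in>I. (c, v) \<in> r}"
    "v \<in> vertices (branches r I) \<Longrightarrow> children (branches r I) v = children r v"
    "children (branches r I) (tree_root r) = I"
proof -
  let ?B = "{v. \<exists>c\<in>I. (c, v) \<in> r}"
  let ?A = "{tree_root r} \<union> ?B"
  have A: "?A \<subseteq> Field r" "tree_root r \<in> ?A"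
    using tree_root(1)[OF r] by (auto simp: Field_def)
  have nroot: "tree_root r \<notin> ?B"
  proof
    assume "tree_root r \<in> ?B"
    then obtain c where c: "c \<in> I" "(c, tree_root r) \<in> r" by blast
    then have "c = tree_root r" using tree_root(2)[OF r] by blast
    moreover have "c \<in> children r (tree_root r)" using c I by blast
    ultimately show False by (simp add: children_def)
  qed
  note R = tree_order_Restr[OF r A, folded branches_def]
  show "tree_order (branches r I)" "tree_root (branches r I) = tree_root r" by (rule R)+
  show V: "vertices (branches r I) = ?B" using R(4) nroot by auto
  have up: "w \<in> ?B" if "v \<in> ?B" "(v, w) \<in> r" for v w
    using that tree_orderD(4)[OF r] by blast
  show "children (branches r I) v = children r v" if "v \<in> vertices (branches r I)"
  proof -
    have "v \<in> ?B" using that V by simp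
    then have "(v, w) \<in> branches r I \<longleftrightarrow> (v, w) \<in> r" "(v, u) \<in> r \<Longrightarrow> (u, w) \<in> branches r I \<longleftrightarrow> (u, w) \<in> r" for u w
      using up unfolding branches_def by blast+
    then show ?thesis unfolding children_def by blast
  qed
  have BI: "(a, b) \<in> branches r I \<longleftrightarrow> (a, b) \<in> r \<and> a \<in> ?A \<and> b \<in> ?A" for a b
    unfolding branches_def by blast
  show "children (branches r I) (tree_root r) = I"
  proof (intro set_eqI iffI)
    fix c assume c: "c \<in> children (branches r I) (tree_root r)"
    then have "(tree_root r, c) \<in> branches r I" "c \<noteq> tree_root r" by (auto dest: childrenD)
    then obtain d where d: "d \<in> I" "(d, c) \<in> r" using BI by blast
    have dr: "d \<in> children r (tree_root r)" using d I by blast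
    then have "(d, d) \<in> r" using childrenD(3)[OF dr] tree_orderD(3)[OF r] by blast
    then have "(tree_root r, d) \<in> branches r I" "(d, c) \<in> branches r I"
      using d childrenD(1)[OF dr] BI by blast+
    then have "d = tree_root r \<or> d = c" using childrenD(4)[OF c] by blast
    with d childrenD(2)[OF dr] show "c \<in> I" by blast
  next
    fix c assume c: "c \<in> I"
    then have cr: "c \<in> children r (tree_root r)" using I by blast
    then have "(c, c) \<in> r" using childrenD(3)[OF cr] tree_orderD(3)[OF r] by blast
    then have "(tree_root r, c) \<in> branches r I" using c childrenD(1)[OF cr] BI by blast
    then show "c \<in> children (branches r I) (tree_root r)"
      using childrenD(2,4)[OF cr] BI unfolding children_def by blast
  qed
qed

text \<open>Each non-root vertex lies above exactly one child of the root, by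
  \<open>vertex_branch\<close>, so complementary sets of children have complementary
  branches.\<close>

lemma branches_vertices_split:
  assumes r: "tree_order r" and I: "I \<subseteq> children r (tree_root r)"
  defines "J \<equiv> children r (tree_root r) - I"
  shows "vertices (branches r I) \<union> vertices (branches r J) = vertices r"
    "vertices (branches r I) \<inter> vertices (branches r J) = {}"
proof -
  have J: "J \<subseteq> children r (tree_root r)" by (simp add: J_def)
  show "vertices (branches r I) \<union> vertices (branches r J) = vertices r"
  proof (intro set_eqI iffI)
    fix v assume "v \<in> vertices (branches r I) \<union> vertices (branches r J)"
    then obtain c where c: "c \<in> children r (tree_root r)" "(c, v) \<in> r"
      using I J by (auto simp: branches[OF r I] branches[OF r J])
    then show "v \<in> vertices r"
      using childrenD(2)[OF c(1)] tree_root(2)[OF r] by (auto simp: vertices_def Field_def)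
  next
    fix v assume "v \<in> vertices r"
    then obtain c where "c \<in> children r (tree_root r)" "(c, v) \<in> r"
      using vertex_branch[OF r] by blast
    moreover from this have "c \<in> I \<or> c \<in> J" by (auto simp: J_def)
    ultimately show "v \<in> vertices (branches r I) \<union> vertices (branches r J)"
      unfolding branches(3)[OF r I] branches(3)[OF r J] by blast
  qed
  show "vertices (branches r I) \<inter> vertices (branches r J) = {}"
  proof (rule ccontr)
    assume "\<not> ?thesis"
    then obtain v c d where *: "c \<in> I" "(c, v) \<in> r" "d \<in> J" "(d, v) \<in> r"
      by (auto simp: branches[OF r I] branches[OF r J])
    have c: "c \<in> children r (tree_root r)" and d: "d \<in> children r (tree_root r)"
      using * I J by blast+
    then have "v \<in> vertices r"
      using * childrenD(2)[OF c] tree_root(2)[OF r, of c] by (auto simp: vertices_def Field_def)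
    then have "c = d" using vertex_branch[OF r] * c d by blast
    with * show False by (simp add: J_def)
  qed
qed

lemma branches_all:
  assumes r: "tree_order r"
  shows "branches r (children r (tree_root r)) = r"
proof -
  have "{tree_root r} \<union> {v. \<exists>c\<in>children r (tree_root r). (c, v) \<in> r} = Field r"
    using branches_vertices_split(1)[OF r subset_refl] Field_eq_vertices[OF r] branches(3)[OF r subset_refl]
      branches(3)[OF r empty_subsetI]
    by simp
  then show ?thesis unfolding branches_def by (auto simp: Field_def)
qed

text \<open>Labels and children of the non-root vertices are unchanged, so one family
  \<open>D\<close> computed on the whole tree serves both parts of a splitting.\<close>

lemma decorates_branches:
  assumes r: "tree_order r" and I: "I \<subseteq> children r (tree_root r)" and D: "decorates V y r lab D"
  shows "decorates V y (branches r I) lab D"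
  using D branches(4)[OF r I] branches_vertices_split(1)[OF r I] unfolding decorates_def by auto

section \<open>Isomorphism classes of trees\<close>

lemma tree_order_rep: "tree_order (rep_tree t)"
  using Quotient3_rep_reflp[OF Quotient3_tree, of t] by (simp add: same_tree_def)

lemma tree_of_abs:
  fixes r :: "nat rel"
  assumes "tree_order r"
  shows "tree_of r = abs_tree r"
proof -
  let ?q = "SOME q :: nat rel. tree_order q \<and> (\<exists>\<phi>. order_iso \<phi> r q)"
  have "tree_order ?q \<and> (\<exists>\<phi>. order_iso \<phi> r ?q)"
    using assms order_iso_id[of r] by (intro someI_ex[of "\<lambda>q :: nat rel. tree_order q \<and> (\<exists>\<phi>. order_iso \<phi> r q)"]) blast
  then have "same_tree r ?q" using assms by (simp add: same_tree_def)
  then show ?thesis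
    unfolding tree_of_def using Quotient3_rel_abs[OF Quotient3_tree] by metis
qed

lemma iso_rep_tree:
  fixes r :: "nat rel"
  assumes "tree_order r"
  shows "\<exists>\<phi>. order_iso \<phi> r (rep_tree (tree_of r))"
proof -
  have "same_tree r r" using assms order_iso_id by (auto simp: same_tree_def)
  then have "same_tree r (rep_tree (abs_tree r))"
    using Quotient3_rep_abs[OF Quotient3_tree] Quotient3_symp[OF Quotient3_tree] by (metis sympD)
  then show ?thesis by (simp add: same_tree_def tree_of_abs[OF assms])
qed

lemma tree_of_eqI:
  fixes r q :: "nat rel"
  assumes "tree_order r" "tree_order q" "order_iso \<phi> r q"
  shows "tree_of r = tree_of q"
  using assms Quotient3_rel_abs[OF Quotient3_tree, of r q] by (auto simp: tree_of_abs same_tree_def)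

lemma tree_of_rep [simp]: "tree_of (rep_tree t) = t"
  using Quotient3_abs_rep[OF Quotient3_tree] by (simp add: tree_of_abs tree_order_rep)

abbreviation root_children :: "tree \<Rightarrow> nat set" where
  "root_children t \<equiv> children (rep_tree t) (tree_root (rep_tree t))"

text \<open>The index set of the inner sum in the component of \<open>Delta_GL\<close> at
  \<open>(u, w)\<close>: the ways in which \<open>t\<close> arises from \<open>u\<close> and
  \<open>w\<close> by identification of the roots.\<close>

definition splittings :: "tree \<Rightarrow> tree \<Rightarrow> tree \<Rightarrow> nat set set" where
  "splittings t u w = {I. I \<subseteq> root_children t \<and> tree_of (branches (rep_tree t) I) = u \<and>
     tree_of (branches (rep_tree t) (root_children t - I)) = w}"

definition nchild :: "tree \<Rightarrow> nat" where
  "nchild t = card (root_children t)"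

lemma deg_tree_of:
  fixes r :: "nat rel"
  assumes r: "tree_order r"
  shows "deg (tree_of r) = card (vertices r)"
  using iso_rep_tree[OF r] order_iso_vertices[OF r tree_order_rep] bij_betw_same_card
  unfolding deg_def by metis

lemma nchild_tree_of:
  fixes r :: "nat rel"
  assumes r: "tree_order r"
  shows "nchild (tree_of r) = card (children r (tree_root r))"
proof -
  obtain \<phi> where \<phi>: "order_iso \<phi> r (rep_tree (tree_of r))" using iso_rep_tree[OF r] by blast
  have "inj_on \<phi> (children r (tree_root r))"
    using order_isoD(1)[OF \<phi>] childrenD(3) by (metis bij_betw_def inj_on_subset subsetI)
  then show ?thesis
    unfolding nchild_def order_iso_root[OF r tree_order_rep \<phi>, symmetric] order_iso_children[OF \<phi> tree_root(1)[OF r]]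
    by (rule card_image)
qed

lemma order_iso_image:
  assumes r: "tree_order r" and h: "inj_on h (Field r)"
  shows "tree_order (map_prod h h ` r)" "order_iso h r (map_prod h h ` r)"
proof -
  let ?q = "map_prod h h ` r"
  have F: "Field ?q = h ` Field r" by (force simp: Field_def)
  have e: "(h a, h b) \<in> ?q \<longleftrightarrow> (a, b) \<in> r" if "a \<in> Field r" "b \<in> Field r" for a b
  proof
    assume "(h a, h b) \<in> ?q"
    then obtain c d where "h a = h c" "h b = h d" "(c, d) \<in> r" by auto
    moreover from this have "c \<in> Field r" "d \<in> Field r" by (auto simp: Field_def)
    ultimately show "(a, b) \<in> r" using h that by (metis inj_onD)
  qed auto
  show iso: "order_iso h r ?q"
    unfolding order_iso_def F using h e by (auto simp: bij_betw_def)
  have q: "\<exists>c d. a = h c \<and> b = h d \<and> (c, d) \<in> r \<and> c \<in> Field r \<and> d \<in> Field r" if "(a, b) \<in> ?q" for a b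
    using that by (auto simp: Field_def)
  have "Partial_order ?q"
    unfolding partial_order_on_def preorder_on_def
  proof (intro conjI)
    show "refl_on (Field ?q) ?q"
      unfolding F refl_on_def using e tree_orderD(3)[OF r] by auto
    show "trans ?q"
    proof (rule transI)
      fix a b c assume "(a, b) \<in> ?q" "(b, c) \<in> ?q"
      then show "(a, c) \<in> ?q" using q[of a b] q[of b c] e tree_orderD(4)[OF r] by metis
    qed
    show "antisym ?q"
    proof (rule antisymI)
      fix a b assume "(a, b) \<in> ?q" "(b, a) \<in> ?q"
      then show "a = b" using q[of a b] e tree_orderD(5)[OF r] by metis
    qed
  qed (auto simp: Field_def)
  moreover have "\<exists>!a. a \<in> Field ?q \<and> (\<forall>b. (b, a) \<in> ?q \<longrightarrow> b = a)"
  proof (intro ex1I[of _ "h (tree_root r)"] conjI allI impI)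
    show "h (tree_root r) \<in> Field ?q" using F tree_root(1)[OF r] by blast
    fix b assume "(b, h (tree_root r)) \<in> ?q"
    then show "b = h (tree_root r)" using q[of b "h (tree_root r)"] e tree_root(1,2)[OF r] by metis
  next
    fix a assume a: "a \<in> Field ?q \<and> (\<forall>b. (b, a) \<in> ?q \<longrightarrow> b = a)"
    then obtain c where c: "c \<in> Field r" "a = h c" using F by blast
    then have "(h (tree_root r), a) \<in> ?q" using e tree_root_below[OF r] tree_root(1)[OF r] by blast
    with a show "a = h (tree_root r)" by metis
  qed
  moreover have "total_on {w. (w, v) \<in> ?q \<and> w \<noteq> v} ?q" for v
    unfolding total_on_def
  proof (intro ballI impI)
    fix a b assume "a \<in> {w. (w, v) \<in> ?q \<and> w \<noteq> v}" "b \<in> {w. (w, v) \<in> ?q \<and> w \<noteq> v}"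
    then have "(a, v) \<in> ?q" "(b, v) \<in> ?q" by auto
    then obtain a' b' v' where "a = h a'" "b = h b'" "v = h v'" "a' \<in> Field r" "b' \<in> Field r" "v' \<in> Field r"
      using q by metis
    then show "(a, b) \<in> ?q \<or> (b, a) \<in> ?q"
      using \<open>(a, v) \<in> ?q\<close> \<open>(b, v) \<in> ?q\<close> e tree_orderD(6)[OF r] by metis
  qed
  moreover have "finite (Field ?q)"
    unfolding F using tree_orderD(1)[OF r] by simp
  ultimately show "tree_order ?q"
    unfolding tree_order_def by blast
qed

text \<open>\<open>deg\<close> does not count the root, so a tree of degree \<open>n\<close> has a
  representative with carrier \<open>{..n}\<close>, and there are finitely many relations on this
  set.\<close>

lemma finite_trees: "finite {t. deg t = n}"
proof -
  have "t \<in> tree_of ` Pow ({..n} \<times> {..n})" if t: "deg t = n" for t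
  proof -
    let ?r = "rep_tree t"
    note r = tree_order_rep[of t]
    have "tree_root ?r \<notin> vertices ?r" by (simp add: vertices_def)
    then have "card (Field ?r) = Suc n"
      using t finite_vertices[OF r] by (simp add: Field_eq_vertices[OF r] deg_def)
    then obtain h where h: "bij_betw h (Field ?r) {..n}"
      using finite_same_card_bij[OF tree_orderD(1)[OF r], of "{..n}"] by auto
    note q = order_iso_image[OF r, of h]
    have "inj_on h (Field ?r)" "h ` Field ?r = {..n}" using h by (auto simp: bij_betw_def)
    then have "map_prod h h ` ?r \<subseteq> {..n} \<times> {..n}" by (auto simp: Field_def)
    moreover have "tree_of (map_prod h h ` ?r) = t"
      using tree_of_eqI[OF r q] \<open>inj_on h (Field ?r)\<close> by simp
    ultimately show ?thesis
      by (intro image_eqI[of _ _ "map_prod h h ` ?r"]) simp_all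
  qed
  then have "{t. deg t = n} \<subseteq> tree_of ` Pow ({..n} \<times> {..n})" by blast
  then show ?thesis using finite_subset by blast
qed

text \<open>\<open>t\<close> is the tree obtained from \<open>u\<close> and \<open>w\<close> by identification of the roots: the root becomes \<open>None\<close>,
  the other vertices of \<open>u\<close> and \<open>w\<close> the two kinds of \<open>Some\<close>.\<close>

lemma join_trees:
  fixes u w :: "nat rel"
  assumes u: "tree_order u" and w: "tree_order w"
  obtains t I where "I \<in> splittings t (tree_of u) (tree_of w)"
proof -
  define U where "U = (Some \<circ> Inl :: nat \<Rightarrow> (nat + nat) option) ` vertices u"
  define W where "W = (Some \<circ> Inr :: nat \<Rightarrow> (nat + nat) option) ` vertices w"
  define le where "le a b \<longleftrightarrow> (a = None \<and> b \<in> {None} \<union> U \<union> W)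
    \<or> (\<exists>x y. a = Some (Inl x) \<and> b = Some (Inl y) \<and> (x, y) \<in> u \<and> x \<in> vertices u \<and> y \<in> vertices u)
    \<or> (\<exists>x y. a = Some (Inr x) \<and> b = Some (Inr y) \<and> (x, y) \<in> w \<and> x \<in> vertices w \<and> y \<in> vertices w)" for a b
  define j where "j = {(a, b). le a b}"
  have vF: "a \<in> vertices u \<Longrightarrow> a \<in> Field u" "b \<in> vertices w \<Longrightarrow> b \<in> Field w" for a b
    by (auto simp: vertices_def)
  have none: "le a None \<longleftrightarrow> a = None" for a
    by (auto simp: le_def U_def W_def)
  have l: "le (Some (Inl x)) b \<longleftrightarrow> (\<exists>y. b = Some (Inl y) \<and> (x, y) \<in> u \<and> x \<in> vertices u \<and> y \<in> vertices u)" for x b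
    by (simp add: le_def)
  have r: "le (Some (Inr x)) b \<longleftrightarrow> (\<exists>y. b = Some (Inr y) \<and> (x, y) \<in> w \<and> x \<in> vertices w \<and> y \<in> vertices w)" for x b
    by (simp add: le_def)
  have n: "le None b \<longleftrightarrow> b \<in> {None} \<union> U \<union> W" for b
    by (simp add: le_def)
  have cases: "a = None \<or> (\<exists>x. a = Some (Inl x)) \<or> (\<exists>x. a = Some (Inr x))" for a :: "(nat + nat) option"
    by (metis not_Some_eq sum.exhaust)
  have UW: "Some (Inl x) \<in> U \<longleftrightarrow> x \<in> vertices u" "Some (Inr x) \<notin> U"
    "Some (Inr x) \<in> W \<longleftrightarrow> x \<in> vertices w" "Some (Inl x) \<notin> W" "None \<notin> U" "None \<notin> W" for x
    by (auto simp: U_def W_def)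
  have jF: "Field j = {None} \<union> U \<union> W"
  proof (intro equalityI subsetI)
    fix a assume "a \<in> {None} \<union> U \<union> W"
    then have "le None a" by (simp add: n)
    then show "a \<in> Field j" by (auto simp: j_def Field_def)
  next
    fix a assume "a \<in> Field j"
    then show "a \<in> {None} \<union> U \<union> W" by (auto simp: j_def Field_def le_def UW)
  qed
  have refl: "le a a" if "a \<in> Field j" for a
    using that cases[of a] tree_orderD(3)[OF u] tree_orderD(3)[OF w] vF by (auto simp: jF l r n UW)
  have trans: "le a c" if ab: "le a b" and bc: "le b c" for a b c
    using cases[of a]
  proof (elim disjE exE)
    assume "a = None" then show ?thesis using cases[of b] ab bc by (auto simp: l r n UW)
  next
    fix x assume "a = Some (Inl x)"
    then show ?thesis using ab bc tree_orderD(4)[OF u, of x] by (auto simp: l)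
  next
    fix x assume "a = Some (Inr x)"
    then show ?thesis using ab bc tree_orderD(4)[OF w, of x] by (auto simp: r)
  qed
  have asym: "a = b" if ab: "le a b" and ba: "le b a" for a b
    using cases[of a]
  proof (elim disjE exE)
    assume "a = None" then show ?thesis using ba by (simp add: none)
  next
    fix x assume "a = Some (Inl x)"
    then show ?thesis using ab ba tree_orderD(5)[OF u, of x] by (auto simp: l)
  next
    fix x assume "a = Some (Inr x)"
    then show ?thesis using ab ba tree_orderD(5)[OF w, of x] by (auto simp: r)
  qed
  have tot: "le a b \<or> le b a" if av: "le a v" and bv: "le b v" for a b v
  proof -
    have F: "a \<in> Field j" "b \<in> Field j" using av bv by (auto simp: j_def Field_def)
    show ?thesis using cases[of a] cases[of b]
    proof (elim disjE exE)
      fix x y assume "a = Some (Inl x)" "b = Some (Inl y)"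
      then show ?thesis using av bv tree_orderD(6)[OF u, of x _ y] by (auto simp: l)
    next
      fix x y assume "a = Some (Inr x)" "b = Some (Inr y)"
      then show ?thesis using av bv tree_orderD(6)[OF w, of x _ y] by (auto simp: r)
    next
      fix x y assume "a = Some (Inl x)" "b = Some (Inr y)"
      then show ?thesis using av bv by (auto simp: l r)
    next
      fix x y assume "a = Some (Inr x)" "b = Some (Inl y)"
      then show ?thesis using av bv by (auto simp: l r)
    qed (use F in \<open>auto simp: n jF\<close>)
  qed
  have jnone: "le None a" if "a \<in> Field j" for a using that by (simp add: jF n)
  have j: "tree_order j"
    unfolding tree_order_def partial_order_on_def preorder_on_def
  proof (intro conjI)
    show "finite (Field j)" using finite_vertices[OF u] finite_vertices[OF w] by (simp add: jF U_def W_def)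
    show "refl_on (Field j) j" using refl by (auto simp: refl_on_def j_def)
    show "trans j" using trans by (auto simp: trans_def j_def)
    show "antisym j" using asym by (auto simp: antisym_def j_def)
    show "\<exists>!a. a \<in> Field j \<and> (\<forall>b. (b, a) \<in> j \<longrightarrow> b = a)"
    proof (rule ex1I[of _ None])
      fix a assume "a \<in> Field j \<and> (\<forall>b. (b, a) \<in> j \<longrightarrow> b = a)"
      then show "a = None" using jnone[of a] by (auto simp: j_def)
    next
      have "(b, None) \<in> j \<longleftrightarrow> b = None" for b by (simp add: j_def none)
      then show "None \<in> Field j \<and> (\<forall>b. (b, None) \<in> j \<longrightarrow> b = None)" by (simp add: jF)
    qed
    show "\<forall>v\<in>Field j. total_on {w. (w, v) \<in> j \<and> w \<noteq> v} j"
      using tot unfolding total_on_def j_def by blast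
  qed (auto simp: Field_def)
  \<comment> \<open>Representatives are orders on natural numbers, so \<open>j\<close> is first
    transported by the injection \<open>to_nat\<close>.\<close>
  obtain \<phi> where \<phi>: "order_iso \<phi> j (rep_tree (tree_of (map_prod to_nat to_nat ` j)))"
    using order_iso_image[OF j, of to_nat] iso_rep_tree order_iso_comp by (metis inj_on_subset inj_to_nat subset_UNIV)
  define t where "t = tree_of (map_prod to_nat to_nat ` j)"
  let ?r = "rep_tree t"
  note iso = \<phi>[folded t_def]
  note rt = tree_order_rep[of t]
  have bij: "inj_on \<phi> (Field j)" "Field ?r = \<phi> ` Field j"
    using order_isoD(1)[OF iso] by (auto simp: bij_betw_def)
  have "b = None" if "(b, None) \<in> j" for b using that by (simp add: j_def none)
  then have jr: "tree_root j = None"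
    using tree_root(3)[OF j, of None] by (simp add: jF)
  then have root: "tree_root ?r = \<phi> None" using order_iso_root[OF j rt iso] by simp
  have ev: "(\<phi> a, \<phi> b) \<in> ?r \<longleftrightarrow> le a b" if "a \<in> Field j" "b \<in> Field j" for a b
    using order_isoD(2)[OF iso that] by (simp add: j_def)
  have Vr: "vertices ?r = \<phi> ` U \<union> \<phi> ` W"
    using bij unfolding vertices_def root jF by (auto simp: inj_on_def UW)
  define C where "C = children ?r (tree_root ?r)"
  define I where "I = C \<inter> \<phi> ` U"
  have "\<phi> ` U \<inter> \<phi> ` W = \<phi> ` (U \<inter> W)"
    by (rule inj_on_image_Int[OF bij(1), symmetric]) (auto simp: jF)
  also have "U \<inter> W = {}" by (auto simp: U_def W_def)
  finally have disj: "\<phi> ` U \<inter> \<phi> ` W = {}" by simp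
  have "C \<subseteq> \<phi> ` U \<union> \<phi> ` W"
    using children_vertices[OF rt] Vr by (auto simp: C_def)
  then have part: "C - I = C \<inter> \<phi> ` W"
    unfolding I_def using disj by blast
  \<comment> \<open>A set \<open>X\<close> that avoids the root and is closed in both directions
    under comparability off the root is filled by the branches that start in it. This is applied to
    \<open>U\<close> and \<open>W\<close>.\<close>
  have above: "{v. \<exists>c\<in>C \<inter> \<phi> ` X. (c, v) \<in> ?r} = \<phi> ` X"
    if X: "X \<subseteq> Field j" "None \<notin> X" and iff: "\<And>a b. a \<noteq> None \<Longrightarrow> le a b \<Longrightarrow> a \<in> X \<longleftrightarrow> b \<in> X" for X
  proof (intro set_eqI iffI)
    fix v assume "v \<in> {v. \<exists>c\<in>C \<inter> \<phi> ` X. (c, v) \<in> ?r}"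
    then obtain a where a: "a \<in> X" "(\<phi> a, v) \<in> ?r" by blast
    then have "v \<in> Field ?r" by (auto simp: Field_def)
    then obtain z where z: "z \<in> Field j" "v = \<phi> z" using bij by blast
    then have "le a z" using a X(1) ev[of a z] by blast
    moreover have "a \<noteq> None" using a(1) X(2) by metis
    ultimately have "z \<in> X" using iff a(1) by blast
    then show "v \<in> \<phi> ` X" using z(2) by blast
  next
    fix v assume "v \<in> \<phi> ` X"
    then obtain b where b: "b \<in> X" "v = \<phi> b" by blast
    then have "v \<in> vertices ?r" using X bij(1) unfolding vertices_def root bij(2) by (auto simp: inj_on_def jF)
    then obtain c where c: "c \<in> C" "(c, v) \<in> ?r" using vertex_branch[OF rt, of v] by (auto simp: C_def)
    then have "c \<in> Field ?r" by (auto simp: Field_def)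
    then obtain z where z: "z \<in> Field j" "c = \<phi> z" using bij by blast
    have "z \<noteq> None" using z(2) root childrenD(2)[OF c(1)[unfolded C_def]] by metis
    moreover have "le z b" using c(2) z b X(1) ev[of z b] by blast
    ultimately have "z \<in> X" using iff b(1) by blast
    then show "v \<in> {v. \<exists>c\<in>C \<inter> \<phi> ` X. (c, v) \<in> ?r}" using z(2) c by blast
  qed
  have "a \<in> U \<longleftrightarrow> b \<in> U" "a \<in> W \<longleftrightarrow> b \<in> W" if "a \<noteq> None" "le a b" for a b
    using that cases[of a] by (auto simp: l r UW)
  then have VI: "{v. \<exists>c\<in>I. (c, v) \<in> ?r} = \<phi> ` U" and VJ: "{v. \<exists>c\<in>C - I. (c, v) \<in> ?r} = \<phi> ` W"
    unfolding part unfolding I_def by (intro above; auto simp: jF UW)+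
  have IC: "I \<subseteq> C" "C - I \<subseteq> C" by (auto simp: I_def)
  \<comment> \<open>Both halves in one argument: \<open>K\<close> embeds the non-root vertices of
    \<open>s\<close> into \<open>j\<close>, and \<open>K'\<close> sends the root of \<open>s\<close>
    to the common root \<open>None\<close>.\<close>
  have iso_part: "tree_of (branches ?r J) = tree_of s"
    if s: "tree_order s" and J: "J \<subseteq> C" and K: "inj K" "\<And>v. K v \<noteq> None" "K ` vertices s \<subseteq> Field j"
      and VJ: "{v. \<exists>c\<in>J. (c, v) \<in> ?r} = \<phi> ` K ` vertices s"
      and le: "\<And>x y. x \<in> vertices s \<Longrightarrow> y \<in> vertices s \<Longrightarrow> le (K x) (K y) \<longleftrightarrow> (x, y) \<in> s" for J and s :: "nat rel" and K
  proof -
    define K' where "K' v = (if v = tree_root s then None else K v)" for v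
    have "Field (branches ?r J) = insert (\<phi> None) (\<phi> ` K ` vertices s)"
      using Field_eq_vertices[OF branches(1)[OF rt]] branches(2,3)[OF rt] J VJ root by (simp add: C_def)
    moreover have "K' ` Field s = insert None (K ` vertices s)"
      unfolding Field_eq_vertices[OF s] by (auto simp: K'_def vertices_def)
    moreover have "inj_on K' (Field s)"
      using K(1) K(2)[symmetric] K(2) by (auto simp: K'_def inj_on_def)
    moreover have "inj_on \<phi> (insert None (K ` vertices s))"
      using K(3) by (intro inj_on_subset[OF bij(1)]) (auto simp: jF)
    ultimately have bb: "bij_betw (\<phi> \<circ> K') (Field s) (Field (branches ?r J))"
      unfolding bij_betw_def image_comp[symmetric] by (metis comp_inj_on image_insert)
    have B: "(x, y) \<in> branches ?r J \<longleftrightarrow> (x, y) \<in> ?r"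
      if "x \<in> insert (\<phi> None) (\<phi> ` K ` vertices s)" "y \<in> insert (\<phi> None) (\<phi> ` K ` vertices s)" for x y
      using that unfolding branches_def VJ root by blast
    have "(a, b) \<in> s \<longleftrightarrow> ((\<phi> \<circ> K') a, (\<phi> \<circ> K') b) \<in> branches ?r J" if ab: "a \<in> Field s" "b \<in> Field s" for a b
    proof -
      have m: "K' v = None \<and> v = tree_root s \<or> K' v = K v \<and> v \<in> vertices s" if "v \<in> Field s" for v
        using that by (auto simp: K'_def vertices_def)
      have K'F: "K' v \<in> insert None (K ` vertices s)" "K' v \<in> Field j" if "v \<in> Field s" for v
        using m[OF that] K(3) by (auto simp: jF)
      have "((\<phi> \<circ> K') a, (\<phi> \<circ> K') b) \<in> branches ?r J \<longleftrightarrow> le (K' a) (K' b)"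
        using K'F[OF ab(1)] K'F[OF ab(2)] ev[of "K' a" "K' b"] by (subst B) auto
      also have "\<dots> \<longleftrightarrow> (a, b) \<in> s"
        using m[OF ab(1)] m[OF ab(2)]
      proof (elim disjE conjE)
        assume "K' a = K a" "a \<in> vertices s" "K' b = None" "b = tree_root s"
        then show ?thesis using none[of "K a"] K(2) tree_root(2)[OF s, of a] by (auto simp: vertices_def)
      next
        assume "K' a = K a" "a \<in> vertices s" "K' b = K b" "b \<in> vertices s"
        then show ?thesis using le by simp
      qed (use jnone[OF K'F(2)[OF ab(2)]] tree_root_below[OF s ab(2)] in simp_all)
      finally show ?thesis ..
    qed
    with bb have "order_iso (\<phi> \<circ> K') s (branches ?r J)"
      unfolding order_iso_def by blast
    from tree_of_eqI[OF s _ this] branches(1)[OF rt J[unfolded C_def]] show ?thesis by simp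
  qed
  have "inj (Some \<circ> Inl :: nat \<Rightarrow> (nat + nat) option)" "inj (Some \<circ> Inr :: nat \<Rightarrow> (nat + nat) option)"
    by (auto simp: inj_def)
  then have tu: "tree_of (branches ?r I) = tree_of u" and tw: "tree_of (branches ?r (C - I)) = tree_of w"
    using iso_part[OF u IC(1), of "Some \<circ> Inl"] iso_part[OF w IC(2), of "Some \<circ> Inr"] VI VJ
    by (auto simp: U_def W_def jF l r)
  show ?thesis
    using that[of I t] IC(1) tu tw by (simp add: C_def splittings_def)
qed

lemma deg_0_tree:
  assumes "deg t = 0"
  shows "Field (rep_tree t) = {tree_root (rep_tree t)}"
    "rep_tree t = {(tree_root (rep_tree t), tree_root (rep_tree t))}"
proof -
  note r = tree_order_rep[of t]
  show "Field (rep_tree t) = {tree_root (rep_tree t)}"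
    using assms finite_vertices[OF r] unfolding Field_eq_vertices[OF r] by (simp add: deg_def)
  moreover from this have "(tree_root (rep_tree t), tree_root (rep_tree t)) \<in> rep_tree t"
    using tree_orderD(3)[OF r] by blast
  ultimately show "rep_tree t = {(tree_root (rep_tree t), tree_root (rep_tree t))}"
    by (auto simp: Field_def)
qed

lemma deg_0_unique:
  assumes "deg t = 0" "deg s = 0"
  shows "t = s"
proof -
  let ?a = "tree_root (rep_tree t)" and ?b = "tree_root (rep_tree s)"
  have "order_iso (\<lambda>_. ?b) (rep_tree t) (rep_tree s)"
    using tree_orderD(3)[OF tree_order_rep, of ?a t] tree_orderD(3)[OF tree_order_rep, of ?b s]
    by (simp add: order_iso_def bij_betw_def deg_0_tree(1)[OF assms(1)] deg_0_tree(1)[OF assms(2)])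
  then show ?thesis
    using tree_of_eqI[OF tree_order_rep tree_order_rep, of _ t s] by simp
qed

lemma nchild_0_iff: "nchild t = 0 \<longleftrightarrow> deg t = 0"
proof -
  note r = tree_order_rep[of t]
  have "root_children t = {} \<longleftrightarrow> vertices (rep_tree t) = {}"
    using vertex_branch[OF r] children_vertices[OF r] by blast
  then show ?thesis
    by (simp add: nchild_def deg_def finite_vertices[OF r] finite_children[OF r])
qed

lemma nchild_le_deg: "nchild t \<le> deg t"
  using children_vertices[OF tree_order_rep] finite_vertices[OF tree_order_rep]
  unfolding nchild_def deg_def by (intro card_mono) auto

lemma deg_0_ex: "\<exists>t. deg t = 0"
proof -
  have F: "Field {(0::nat, 0::nat)} = {0}" by (auto simp: Field_def)
  have r: "tree_order {(0::nat, 0)}"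
    by (auto simp: tree_order_def F partial_order_on_def preorder_on_def refl_on_def
        trans_def antisym_def total_on_def)
  have "vertices {(0::nat, 0::nat)} = {}"
    using tree_root(1)[OF r] by (auto simp: vertices_def F)
  then show ?thesis using deg_tree_of[OF r] by auto
qed

section \<open>Completed tensor powers\<close>

lemma closure_seq_mem:
  fixes x :: "'a::real_normed_vector"
  assumes "x \<in> closure S" obtains X where "\<And>n::nat. X n \<in> S" "X \<longlonglongrightarrow> x"
  using assms by (auto simp: closure_sequential)

lemma closure_seqI:
  fixes x :: "'a::real_normed_vector"
  assumes "\<And>n::nat. X n \<in> S" "X \<longlonglongrightarrow> x"
  shows "x \<in> closure S"
  using assms by (auto simp: closure_sequential)

lemma subspace_closure:
  fixes S :: "'a::real_normed_vector set"
  assumes S: "subspace S"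
  shows "subspace (closure S)"
  unfolding subspace_def
proof (intro conjI ballI allI)
  show "0 \<in> closure S" using subspace_0[OF S] closure_subset by blast
  fix x assume x: "x \<in> closure S"
  then obtain X where X: "\<And>n::nat. X n \<in> S" "X \<longlonglongrightarrow> x" using closure_seq_mem by blast
  {
    fix y assume "y \<in> closure S"
    then obtain Y where Y: "\<And>n::nat. Y n \<in> S" "Y \<longlonglongrightarrow> y" using closure_seq_mem by blast
    have "(\<lambda>n. X n + Y n) \<longlonglongrightarrow> x + y" by (intro tendsto_add X Y)
    then show "x + y \<in> closure S"
      using subspace_add[OF S X(1) Y(1)] by (intro closure_seqI[of "\<lambda>n. X n + Y n"])
  }
  fix c
  have "(\<lambda>n. c *\<^sub>R X n) \<longlonglongrightarrow> c *\<^sub>R x" by (intro tendsto_scaleR tendsto_const X)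
  then show "c *\<^sub>R x \<in> closure S"
    using subspace_scale[OF S X(1)] by (intro closure_seqI[of "\<lambda>n. c *\<^sub>R X n"])
qed

text \<open>The extension by uniform continuity is linear only on the closure of \<open>S\<close>,
  whereas \<open>act\<close> asks for a linear map on the whole type.\<close>

lemma linear_extend_closure:
  fixes A :: "'a::real_normed_vector \<Rightarrow> 'b::banach"
  assumes S: "subspace S" and A: "linear A" and bnd: "\<And>a. a \<in> S \<Longrightarrow> norm (A a) \<le> norm a"
  obtains A' where "linear A'" "continuous_on (closure S) A'" "\<And>a. a \<in> S \<Longrightarrow> A' a = A a"
proof -
  have "dist (A a) (A b) \<le> dist a b" if "a \<in> S" "b \<in> S" for a b
    using bnd[OF subspace_diff[OF S that]] by (simp add: dist_norm linear_diff[OF A])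
  then have "uniformly_continuous_on S A"
    unfolding uniformly_continuous_on_def by (meson le_less_trans)
  then obtain g where g: "uniformly_continuous_on (closure S) g" "\<And>x. x \<in> S \<Longrightarrow> A x = g x"
    by (rule uniformly_continuous_on_extension_on_closure) blast
  have cont: "continuous_on (closure S) g" using g(1) by (rule uniformly_continuous_imp_continuous)
  have lim: "(\<lambda>n. A (X n)) \<longlonglongrightarrow> g x" if "\<And>n::nat. X n \<in> S" "X \<longlonglongrightarrow> x" for X x
  proof -
    have "x \<in> closure S" "X n \<in> closure S" for n
      using that closure_seqI[of X S] closure_subset[of S] by auto
    then have "(\<lambda>n. g (X n)) \<longlonglongrightarrow> g x"
      using that(2) by (intro continuous_on_tendsto_compose[OF cont]) auto
    then show ?thesis using g(2) that(1) by simp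
  qed
  have g_lin: "g (x + y) = g x + g y" "g (c *\<^sub>R x) = c *\<^sub>R g x" if x: "x \<in> closure S" and y: "y \<in> closure S" for x y c
  proof -
    obtain X where X: "\<And>n::nat. X n \<in> S" "X \<longlonglongrightarrow> x" using closure_seq_mem[OF x] by blast
    obtain Y where Y: "\<And>n::nat. Y n \<in> S" "Y \<longlonglongrightarrow> y" using closure_seq_mem[OF y] by blast
    have "(\<lambda>n. A (X n + Y n)) \<longlonglongrightarrow> g (x + y)"
      by (intro lim tendsto_add X Y subspace_add[OF S])
    moreover have "(\<lambda>n. A (X n + Y n)) \<longlonglongrightarrow> g x + g y"
      unfolding linear_add[OF A] by (intro tendsto_add lim X Y)
    ultimately show "g (x + y) = g x + g y" by (rule LIMSEQ_unique)
    have "(\<lambda>n. A (c *\<^sub>R X n)) \<longlonglongrightarrow> g (c *\<^sub>R x)"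
      by (intro lim tendsto_scaleR tendsto_const X subspace_scale[OF S])
    moreover have "(\<lambda>n. A (c *\<^sub>R X n)) \<longlonglongrightarrow> c *\<^sub>R g x"
      unfolding linear_scale[OF A] by (intro tendsto_scaleR tendsto_const lim X)
    ultimately show "g (c *\<^sub>R x) = c *\<^sub>R g x" by (rule LIMSEQ_unique)
  qed
  note sc = subspace_closure[OF S]
  \<comment> \<open>A Hamel basis of the closure: a linear map with the values of \<open>g\<close>
    on it agrees with \<open>g\<close> on the closure, whatever it does elsewhere.\<close>
  obtain B where B: "B \<subseteq> closure S" "independent B" "closure S \<subseteq> span B"
    using maximal_independent_subset by blast
  obtain A' where A': "linear A'" "\<forall>b\<in>B. A' b = g b"
    using linear_independent_extend[OF B(2)] by blast
  have z: "0 \<in> closure S" by (rule subspace_0[OF sc])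
  have "subspace {x \<in> closure S. A' x = g x}"
    unfolding subspace_def
    using g_lin(2)[OF z z, of 0] z
    by (auto simp: subspace_add[OF sc] subspace_scale[OF sc] linear_0[OF A'(1)] linear_add[OF A'(1)]
        linear_scale[OF A'(1)] g_lin)
  then have "span B \<subseteq> {x \<in> closure S. A' x = g x}"
    using A'(2) B(1) by (intro span_minimal) auto
  then have eq: "A' x = g x" if "x \<in> closure S" for x
    using that B(3) by blast
  show ?thesis
  proof (rule that[OF A'(1)])
    show "continuous_on (closure S) A'" using cont eq by (simp cong: continuous_on_cong)
    show "A' a = A a" if "a \<in> S" for a
      using eq[of a] g(2)[OF that] closure_subset that by auto
  qed
qed

text \<open>The functional is purely algebraic, as \<open>universal\<close> speaks of the algebraic
  tensor powers and of functionals without continuity.\<close>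

lemma separating_functional:
  fixes z :: "'a::real_vector"
  assumes "z \<noteq> 0"
  obtains l :: "'a \<Rightarrow> real" where "linear l" "l z = 1"
proof -
  have "independent {z}" using assms by simp
  from linear_independent_extend[OF this, of "\<lambda>_. 1::real"] that show ?thesis by auto
qed

context tensor_powers
begin

lemma tensor_append: "tensor \<iota> (us @ ws) = tensor \<iota> us * tensor \<iota> ws"
  by (simp add: tensor_def)

lemma tensor_Cons: "tensor \<iota> (v # ws) = \<iota> v * tensor \<iota> ws"
  by (simp add: tensor_def)

lemma tensor_mem: "length vs = k \<Longrightarrow> tensor \<iota> vs \<in> tensor_power \<iota> k"
  unfolding tensor_power_def by (rule span_base) blast

lemma subspace_tensor_power: "subspace (tensor_power \<iota> k)"
  by (simp add: tensor_power_def)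

lemma subspace_ctensor: "subspace (ctensor_power k)"
  unfolding ctensor_power_def by (rule subspace_closure[OF subspace_tensor_power])

lemma tensor_power_ctensor: "a \<in> tensor_power \<iota> k \<Longrightarrow> a \<in> ctensor_power k"
  unfolding ctensor_power_def using closure_subset by blast

lemma tensor_ctensor: "length vs = k \<Longrightarrow> tensor \<iota> vs \<in> ctensor_power k"
  by (intro tensor_power_ctensor tensor_mem)

lemma closed_ctensor: "closed (ctensor_power k)"
  by (simp add: ctensor_power_def)

lemma tensor_power_induct:
  assumes "a \<in> tensor_power \<iota> k" "subspace {a. P a}" "\<And>vs. length vs = k \<Longrightarrow> P (tensor \<iota> vs)"
  shows "P a"
  using span_minimal[of "{tensor \<iota> vs |vs. length vs = k}" "{a. P a}"] assms unfolding tensor_power_def by blast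

lemma mult_tensor_power:
  assumes "a \<in> tensor_power \<iota> k" "b \<in> tensor_power \<iota> l"
  shows "a * b \<in> tensor_power \<iota> (k + l)"
proof (rule tensor_power_induct[OF assms(1)])
  note S = subspace_tensor_power[of "k + l"]
  show "subspace {a. a * b \<in> tensor_power \<iota> (k + l)}"
    using S by (auto simp: subspace_def distrib_right)
  fix us :: "'e list" assume us: "length us = k"
  show "tensor \<iota> us * b \<in> tensor_power \<iota> (k + l)"
  proof (rule tensor_power_induct[OF assms(2)])
    show "subspace {b. tensor \<iota> us * b \<in> tensor_power \<iota> (k + l)}"
      using S by (auto simp: subspace_def distrib_left)
    show "tensor \<iota> us * tensor \<iota> vs \<in> tensor_power \<iota> (k + l)" if "length vs = l" for vs
      unfolding tensor_append[symmetric] using us that by (intro tensor_mem) simp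
  qed
qed

text \<open>The cross norm identity passes to limits. Hence a product of homogeneous elements of the
  completed powers vanishes only if a factor does.\<close>

lemma ctensor_mult:
  assumes "a \<in> ctensor_power k" "b \<in> ctensor_power l"
  shows "a * b \<in> ctensor_power (k + l)" "norm (a * b) = norm a * norm b"
proof -
  obtain X where X: "\<And>n::nat. X n \<in> tensor_power \<iota> k" "X \<longlonglongrightarrow> a"
    using closure_seq_mem assms(1) unfolding ctensor_power_def by blast
  obtain Y where Y: "\<And>n::nat. Y n \<in> tensor_power \<iota> l" "Y \<longlonglongrightarrow> b"
    using closure_seq_mem assms(2) unfolding ctensor_power_def by blast
  have lim: "(\<lambda>n. X n * Y n) \<longlonglongrightarrow> a * b" by (intro tendsto_mult X Y)
  then show "a * b \<in> ctensor_power (k + l)"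
    unfolding ctensor_power_def using mult_tensor_power[OF X(1) Y(1)]
    by (intro closure_seqI[of "\<lambda>n. X n * Y n"])
  have "(\<lambda>n. norm (X n * Y n)) \<longlonglongrightarrow> norm (a * b)" by (intro tendsto_norm lim)
  moreover have "(\<lambda>n. norm (X n * Y n)) \<longlonglongrightarrow> norm a * norm b"
    unfolding norm_mult_cross[OF X(1) Y(1)] by (intro tendsto_mult tendsto_norm X Y)
  ultimately show "norm (a * b) = norm a * norm b" by (rule LIMSEQ_unique)
qed

text \<open>Elementary tensors span a dense subspace. This reduces identities between extensions to
  identities between values of elementary labelled trees.\<close>

lemma linear_eq_on_ctensor:
  fixes \<Phi> \<Psi> :: "'a \<Rightarrow> 'b::real_normed_vector"
  assumes \<Phi>: "linear \<Phi>" "continuous_on (ctensor_power k) \<Phi>" and \<Psi>: "linear \<Psi>" "continuous_on (ctensor_power k) \<Psi>"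
    and eq: "\<And>vs. length vs = k \<Longrightarrow> \<Phi> (tensor \<iota> vs) = \<Psi> (tensor \<iota> vs)" and a: "a \<in> ctensor_power k"
  shows "\<Phi> a = \<Psi> a"
proof -
  have "\<Phi> x - \<Psi> x = 0" if "x \<in> tensor_power \<iota> k" for x
  proof (rule tensor_power_induct[OF that])
    show "subspace {a. \<Phi> a - \<Psi> a = 0}"
      using \<Phi>(1) \<Psi>(1) by (simp add: subspace_def linear_0 linear_add linear_scale)
  qed (use eq in simp)
  moreover have "continuous_on (ctensor_power k) (\<lambda>x. \<Phi> x - \<Psi> x)"
    by (intro continuous_intros \<Phi> \<Psi>)
  ultimately have "\<Phi> a - \<Psi> a = 0"
    using a continuous_constant_on_closure unfolding ctensor_power_def by blast
  then show ?thesis by simp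
qed

section \<open>Action of permutations on the completed tensor powers\<close>

lemma multilinear_permuted:
  fixes l :: "'a \<Rightarrow> real"
  assumes l: "linear l" and \<sigma>: "\<sigma> permutes {..<k}"
  shows "multilinear k (\<lambda>vs. l (tensor \<iota> (permute_list \<sigma> vs)))"
  unfolding multilinear_def
proof (intro allI impI)
  fix us ws :: "'e list" assume k: "length us + 1 + length ws = k"
  \<comment> \<open>\<open>permute_list\<close> puts the entry number \<open>\<sigma> i\<close> at
    position \<open>i\<close>, so the varying entry \<open>v\<close> lands at position
    \<open>j\<close>.\<close>
  define j where "j = inv \<sigma> (length us)"
  have j: "j < k" "\<sigma> j = length us"
    using k permutes_in_image[OF permutes_inv[OF \<sigma>], of "length us"] permutes_inverses[OF \<sigma>] by (auto simp: j_def)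
  define ys where "ys = permute_list \<sigma> (us @ 0 # ws)"
  have "permute_list \<sigma> (us @ v # ws) = take j ys @ v # drop (Suc j) ys" for v
  proof (rule nth_equalityI)
    fix i assume "i < length (permute_list \<sigma> (us @ v # ws))"
    then have i: "i < k" using k by simp
    then have "\<sigma> i < k" using permutes_in_image[OF \<sigma>] by simp
    have P: "permute_list \<sigma> (us @ x # ws) ! i = (us @ x # ws) ! \<sigma> i" for x
      using i k \<sigma> by (intro permute_list_nth) auto
    have "\<sigma> i = length us \<longleftrightarrow> i = j"
      using j permutes_inj[OF \<sigma>] by (metis injD)
    then show "permute_list \<sigma> (us @ v # ws) ! i = (take j ys @ v # drop (Suc j) ys) ! i"
      using i j k unfolding ys_def P
      by (cases "\<sigma> i" "length us" rule: linorder_cases; cases i j rule: linorder_cases)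
        (auto simp: nth_append P min_def nth_Cons')
  qed (use j k in \<open>auto simp: ys_def\<close>)
  then have "tensor \<iota> (permute_list \<sigma> (us @ v # ws)) = tensor \<iota> (take j ys) * (\<iota> v * tensor \<iota> (drop (Suc j) ys))" for v
    by (simp add: tensor_append tensor_Cons)
  then show "linear (\<lambda>v. l (tensor \<iota> (permute_list \<sigma> (us @ v # ws))))"
    using l linear_\<iota> by (intro linearI) (simp_all add: linear_add linear_scale distrib_left distrib_right)
qed

text \<open>Values prescribed on a basis of elementary tensors might be wrong on the others. A
  scalar functional that detects this contradicts \<open>universal\<close>, applied to the permuted
  multilinear form. The resulting map is isometric by \<open>norm_perm\<close> and so extends to the
  completion.\<close>

lemma act_exists:
  assumes \<sigma>: "\<sigma> permutes {..<k}"
  shows "\<exists>A. linear A \<and> continuous_on (ctensor_power k) A \<and>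
     (\<forall>vs. length vs = k \<longrightarrow> A (tensor \<iota> vs) = tensor \<iota> (permute_list \<sigma> vs))"
proof -
  let ?S = "{tensor \<iota> vs |vs. length vs = k}"
  obtain B where B: "B \<subseteq> ?S" "independent B" "?S \<subseteq> span B"
    using maximal_independent_subset by blast
  have "\<forall>b\<in>B. \<exists>vs. length vs = k \<and> tensor \<iota> vs = b" using B(1) by blast
  from bchoice[OF this] obtain c where c: "\<And>b. b \<in> B \<Longrightarrow> length (c b) = k \<and> tensor \<iota> (c b) = b"
    by blast
  obtain A where A: "linear A" "\<forall>b\<in>B. A b = tensor \<iota> (permute_list \<sigma> (c b))"
    using linear_independent_extend[OF B(2), of "\<lambda>b. tensor \<iota> (permute_list \<sigma> (c b))"] by blast
  have val: "A (tensor \<iota> vs) = tensor \<iota> (permute_list \<sigma> vs)" if vs: "length vs = k" for vs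
  proof (rule ccontr)
    assume "\<not> ?thesis"
    then have "A (tensor \<iota> vs) - tensor \<iota> (permute_list \<sigma> vs) \<noteq> 0" by simp
    then obtain l :: "'a \<Rightarrow> real" where l: "linear l" "l (A (tensor \<iota> vs) - tensor \<iota> (permute_list \<sigma> vs)) = 1"
      by (rule separating_functional)
    obtain L where L: "linear L" "\<forall>vs. length vs = k \<longrightarrow> L (tensor \<iota> vs) = l (tensor \<iota> (permute_list \<sigma> vs))"
      using universal[OF multilinear_permuted[OF l(1) \<sigma>]] by blast
    have "L b = (l \<circ> A) b" if "b \<in> B" for b
      using c[OF that] A(2) L(2) that by (metis comp_apply)
    then have "L x = (l \<circ> A) x" if "x \<in> span B" for x
      using linear_eq_on_span[OF L(1) linear_compose[OF A(1) l(1)] _ that] by blast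
    then have "L (tensor \<iota> vs) = l (A (tensor \<iota> vs))"
      using B(3) vs by auto
    with L(2) vs l show False by (simp add: linear_diff)
  qed
  have "norm (A a) \<le> norm a" if "a \<in> tensor_power \<iota> k" for a
    using norm_perm[OF \<sigma> A(1) _ that] val by simp
  from linear_extend_closure[OF subspace_tensor_power A(1) this]
  obtain A' where A': "linear A'" "continuous_on (closure (tensor_power \<iota> k)) A'"
    "\<And>a. a \<in> tensor_power \<iota> k \<Longrightarrow> A' a = A a" by blast
  then show ?thesis
    using val tensor_mem[of _ k] by (intro exI[of _ A']) (simp add: ctensor_power_def)
qed

lemma act:
  assumes "\<sigma> permutes {..<k}"
  shows "linear (act k \<sigma>)" "continuous_on (ctensor_power k) (act k \<sigma>)"
    "length vs = k \<Longrightarrow> act k \<sigma> (tensor \<iota> vs) = tensor \<iota> (permute_list \<sigma> vs)"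
  using someI_ex[OF act_exists[OF assms]] unfolding act_def by blast+

lemma act_ctensor:
  assumes \<sigma>: "\<sigma> permutes {..<k}" and a: "a \<in> ctensor_power k"
  shows "act k \<sigma> a \<in> ctensor_power k"
proof -
  have "act k \<sigma> x \<in> ctensor_power k" if "x \<in> tensor_power \<iota> k" for x
  proof (rule tensor_power_induct[OF that])
    show "subspace {a. act k \<sigma> a \<in> ctensor_power k}"
      using subspace_ctensor[of k] act(1)[OF \<sigma>]
      by (simp add: subspace_def linear_0 linear_add linear_scale)
    show "act k \<sigma> (tensor \<iota> vs) \<in> ctensor_power k" if "length vs = k" for vs
      unfolding act(3)[OF \<sigma> that] using that by (intro tensor_ctensor) simp
  qed
  then have "act k \<sigma> ` closure (tensor_power \<iota> k) \<subseteq> ctensor_power k"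
    using act(2)[OF \<sigma>] closed_ctensor unfolding ctensor_power_def[of k]
    by (intro image_closure_subset) (auto simp: ctensor_power_def)
  with a show ?thesis unfolding ctensor_power_def by blast
qed

text \<open>\<open>permute_list\<close> reverses compositions, so \<open>act\<close> is a right
  action.\<close>

lemma act_act:
  assumes \<sigma>: "\<sigma> permutes {..<k}" and \<tau>: "\<tau> permutes {..<k}" and a: "a \<in> ctensor_power k"
  shows "act k \<tau> (act k \<sigma> a) = act k (\<sigma> \<circ> \<tau>) a"
proof -
  have \<sigma>\<tau>: "\<sigma> \<circ> \<tau> permutes {..<k}" using permutes_compose[OF \<tau> \<sigma>] .
  have "(act k \<tau> \<circ> act k \<sigma>) a = act k (\<sigma> \<circ> \<tau>) a"
  proof (rule linear_eq_on_ctensor[OF _ _ act(1,2)[OF \<sigma>\<tau>] _ a])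
    show "linear (act k \<tau> \<circ> act k \<sigma>)" by (rule linear_compose[OF act(1)[OF \<sigma>] act(1)[OF \<tau>]])
    show "continuous_on (ctensor_power k) (act k \<tau> \<circ> act k \<sigma>)"
      using act(2)[OF \<sigma>] act(2)[OF \<tau>] act_ctensor[OF \<sigma>]
      by (intro continuous_on_compose continuous_on_subset[OF act(2)[OF \<tau>]]) auto
    show "(act k \<tau> \<circ> act k \<sigma>) (tensor \<iota> vs) = act k (\<sigma> \<circ> \<tau>) (tensor \<iota> vs)" if "length vs = k" for vs
      using that \<tau> by (simp add: act(3)[OF \<sigma>] act(3)[OF \<tau>] act(3)[OF \<sigma>\<tau>] permute_list_compose)
  qed
  then show ?thesis by simp
qed

lemma symmetrizer_linear:
  assumes "\<And>\<sigma>. \<sigma> \<in> H \<Longrightarrow> \<sigma> permutes {..<k}"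
  shows "linear (symmetrizer k H)"
  unfolding symmetrizer_def
  by (intro linear_compose_scale_right linear_compose_sum ballI act(1) assms)

lemma zero_sym_ker:
  assumes "\<And>\<sigma>. \<sigma> \<in> H \<Longrightarrow> \<sigma> permutes {..<k}"
  shows "0 \<in> sym_ker k H"
  using linear_0[OF symmetrizer_linear[OF assms]] subspace_0[OF subspace_ctensor] by (simp add: sym_ker_def)

text \<open>Averaging over \<open>H\<close> does not change an invariant map, so it kills whatever
  the symmetrizer kills and passes to the quotient.\<close>

lemma vanish_on_sym_ker:
  assumes \<Phi>: "linear \<Phi>" and H: "finite H" "H \<noteq> {}"
    and inv: "\<And>\<sigma> a. \<sigma> \<in> H \<Longrightarrow> a \<in> ctensor_power k \<Longrightarrow> \<Phi> (act k \<sigma> a) = \<Phi> a" and a: "a \<in> sym_ker k H"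
  shows "\<Phi> a = 0"
proof -
  have "a \<in> ctensor_power k" "symmetrizer k H a = 0" using a by (auto simp: sym_ker_def)
  then have "0 = \<Phi> (symmetrizer k H a)" by (simp add: linear_0[OF \<Phi>])
  also have "\<dots> = (1 / real (card H)) *\<^sub>R (\<Sum>\<sigma>\<in>H. \<Phi> (act k \<sigma> a))"
    by (simp add: symmetrizer_def linear_scale[OF \<Phi>] linear_sum[OF \<Phi>])
  also have "\<dots> = (1 / real (card H)) *\<^sub>R (\<Sum>\<sigma>\<in>H. \<Phi> a)"
    using inv \<open>a \<in> ctensor_power k\<close> by simp
  also have "\<dots> = \<Phi> a"
    using H by (simp add: sum_constant_scaleR)
  finally show ?thesis by simp
qed

end

section \<open>Values of labelled trees\<close>

lemma smooth_bounded_linear: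
  assumes "smooth f"
  shows "bounded_linear (\<lambda>v. hderiv f (us @ v # ws) y)"
proof -
  obtain C where C: "norm (hderiv f hs y) \<le> C * norms hs"
    if "length hs = length us + 1 + length ws" for hs
    using smooth_bound[OF assms, of "length us + 1 + length ws" y] by blast
  note lin = smooth_linear[OF assms, of us ws y]
  show ?thesis
  proof (rule bounded_linear_intro)
    show "norm (hderiv f (us @ v # ws) y) \<le> norm v * (C * norms us * norms ws)" for v
      using C[of "us @ v # ws"] by (simp add: mult_ac)
  qed (simp_all add: linear_add[OF lin] linear_scale[OF lin])
qed

lemma slot_perm:
  assumes f: "bij_betw f B {..<card B}" and g: "bij_betw g B {..<card B}"
  shows "slot_perm B f g permutes {..<card B}" "v \<in> B \<Longrightarrow> slot_perm B f g (f v) = g v"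
proof -
  have "bij_betw (g \<circ> inv_into B f) {..<card B} {..<card B}"
    by (rule bij_betw_trans[OF bij_betw_inv_into[OF f] g])
  then have "bij_betw (slot_perm B f g) {..<card B} {..<card B}"
    by (rule bij_betw_cong[THEN iffD1, rotated]) (simp add: slot_perm_def)
  then show "slot_perm B f g permutes {..<card B}"
    by (rule bij_imp_permutes) (simp add: slot_perm_def)
  show "slot_perm B f g (f v) = g v" if "v \<in> B"
    using that f bij_betw_apply[OF f that] by (auto simp: slot_perm_def bij_betw_def)
qed

lemma permute_list_slot_perm:
  assumes f: "bij_betw f B {..<card B}" and g: "bij_betw g B {..<card B}" and "length vs = card B" "v \<in> B"
  shows "permute_list (slot_perm B f g) vs ! f v = vs ! g v"
  using slot_perm[OF f g] bij_betw_apply[OF f assms(4)] assms(3,4)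
  by (subst permute_list_nth) auto

lemma coset_eqD:
  assumes "coset N a = coset N b" "0 \<in> N"
  shows "a - b \<in> N"
proof -
  have "a \<in> coset N a" using assms(2) by (force simp: coset_def)
  then show ?thesis using assms(1) by (auto simp: coset_def)
qed

text \<open>Reflection of the order is not part of the definition of \<open>SG\<close>. A bijection
  that preserves the order maps the finite set of comparable pairs injectively into itself, hence
  onto.\<close>

lemma automorphism_iso:
  assumes r: "tree_order r" and \<pi>: "\<pi> permutes vertices r"
    and mono: "\<forall>v\<in>vertices r. \<forall>w\<in>vertices r. (v, w) \<in> r \<longrightarrow> (\<pi> v, \<pi> w) \<in> r"
  shows "order_iso \<pi> r r"
proof -
  let ?V = "vertices r"
  define E where "E = {(v, w). (v, w) \<in> r \<and> v \<in> ?V \<and> w \<in> ?V}"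
  have finE: "finite E"
    by (rule finite_subset[OF _ tree_orderD(2)[OF r]]) (auto simp: E_def)
  have inj: "inj_on (map_prod \<pi> \<pi>) E"
    using permutes_inj[OF \<pi>] by (auto simp: inj_on_def inj_def)
  have "(map_prod \<pi> \<pi>) ` E \<subseteq> E"
    using mono permutes_in_image[OF \<pi>] by (auto simp: E_def)
  then have surj: "(map_prod \<pi> \<pi>) ` E = E"
    using endo_inj_surj[OF finE _ inj] by blast
  have reflect: "(v, w) \<in> r" if "(\<pi> v, \<pi> w) \<in> r" "v \<in> ?V" "w \<in> ?V" for v w
  proof -
    have "(\<pi> v, \<pi> w) \<in> map_prod \<pi> \<pi> ` E"
      unfolding surj using that permutes_in_image[OF \<pi>] by (simp add: E_def)
    then obtain a b where "(a, b) \<in> E" "\<pi> a = \<pi> v" "\<pi> b = \<pi> w" by auto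
    then show ?thesis using permutes_inj[OF \<pi>] by (auto simp: E_def inj_def)
  qed
  have root: "\<pi> (tree_root r) = tree_root r"
    by (rule permutes_not_in[OF \<pi>]) (simp add: vertices_def)
  have "\<pi> ` Field r = Field r"
    unfolding Field_eq_vertices[OF r] by (simp add: root permutes_image[OF \<pi>])
  then have bij: "bij_betw \<pi> (Field r) (Field r)"
    using permutes_inj_on[OF \<pi>] by (simp add: bij_betw_def)
  have "(a, b) \<in> r \<longleftrightarrow> (\<pi> a, \<pi> b) \<in> r" if ab: "a \<in> Field r" "b \<in> Field r" for a b
  proof (cases "a = tree_root r")
    case True
    have "\<pi> b \<in> Field r" using bij_betw_apply[OF bij ab(2)] .
    then show ?thesis
      using True root tree_root_below[OF r] ab by simp
  next
    case a: False
    then have aV: "a \<in> ?V" using ab by (simp add: vertices_def)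
    show ?thesis
    proof (cases "b = tree_root r")
      case True
      then show ?thesis
        using a aV root tree_root(2)[OF r, of a] tree_root(2)[OF r, of "\<pi> a"] permutes_in_image[OF \<pi>, of a]
        by (auto simp: vertices_def)
    next
      case False
      then have "b \<in> ?V" using ab by (simp add: vertices_def)
      then show ?thesis using aV mono reflect by blast
    qed
  qed
  with bij show ?thesis by (simp add: order_iso_def)
qed

section \<open>Slots of the vertices of a splitting\<close>

context labelled_trees
begin

lemma bij_rho: "bij_betw (\<rho> t) (vertices (rep_tree t)) {..<card (vertices (rep_tree t))}"
  using bij_\<rho>[of t] by (simp add: deg_def)

lemma enum:
  fixes r :: "nat rel"
  assumes r: "tree_order r"
  obtains \<phi> where "order_iso \<phi> r (rep_tree (tree_of r))" "enum r = \<rho> (tree_of r) \<circ> \<phi>"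
  using that[OF someI_ex[OF iso_rep_tree[OF r]]] by (simp add: enum_def)

lemma bij_enum:
  fixes r :: "nat rel"
  assumes r: "tree_order r"
  shows "bij_betw (enum r) (vertices r) {..<card (vertices r)}"
proof -
  obtain \<phi> where \<phi>: "order_iso \<phi> r (rep_tree (tree_of r))" "enum r = \<rho> (tree_of r) \<circ> \<phi>"
    using enum[OF r] by blast
  show ?thesis
    unfolding \<phi>(2) using bij_betw_trans[OF order_iso_vertices[OF r tree_order_rep \<phi>(1)] bij_\<rho>] deg_tree_of[OF r]
    by simp
qed

lemma split_slot_bij:
  assumes r: "tree_order r" and I: "I \<subseteq> children r (tree_root r)"
  defines "q \<equiv> branches r I" and "q' \<equiv> branches r (children r (tree_root r) - I)"
  shows "bij_betw (split_slot q q') (vertices r) {..<card (vertices r)}"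
    "card (vertices r) = card (vertices q) + card (vertices q')"
proof -
  have q: "tree_order q" "tree_order q'"
    using branches(1)[OF r I] branches(1)[OF r, of "children r (tree_root r) - I"] by (auto simp: q_def q'_def)
  note split = branches_vertices_split[OF r I, folded q_def q'_def]
  show card: "card (vertices r) = card (vertices q) + card (vertices q')"
    unfolding split(1)[symmetric] using split(2) q by (intro card_Un_disjoint finite_vertices)
  have 1: "bij_betw (split_slot q q') (vertices q) {..<card (vertices q)}"
    by (rule bij_betw_cong[THEN iffD1, OF _ bij_enum[OF q(1)]]) (simp add: split_slot_def)
  have "bij_betw ((+) (card (vertices q)) \<circ> enum q') (vertices q') {card (vertices q)..<card (vertices r)}"
  proof (rule bij_betw_trans[OF bij_enum[OF q(2)]])
    show "bij_betw ((+) (card (vertices q))) {..<card (vertices q')} {card (vertices q)..<card (vertices r)}"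
      unfolding card lessThan_atLeast0 using bij_betw_add[of "card (vertices q)" "{0..<card (vertices q')}"]
      by (simp add: add.commute bij_betw_def)
  qed
  then have 2: "bij_betw (split_slot q q') (vertices q') {card (vertices q)..<card (vertices r)}"
    by (rule bij_betw_cong[THEN iffD1, rotated]) (use split(2) in \<open>auto simp: split_slot_def\<close>)
  have "{..<card (vertices q)} \<union> {card (vertices q)..<card (vertices r)} = {..<card (vertices r)}"
    using card by auto
  moreover have "{..<card (vertices q)} \<inter> {card (vertices q)..<card (vertices r)} = {}" by auto
  ultimately show "bij_betw (split_slot q q') (vertices r) {..<card (vertices r)}"
    using bij_betw_combine[OF 1 2] split(1) by simp
qed

text \<open>The vertices of the branches at \<open>I\<close> occupy the first slots, matching the
  order of the factors in \<open>some_rep (g u) * some_rep (g w)\<close>.\<close>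

definition branch_slot :: "tree \<Rightarrow> nat set \<Rightarrow> nat \<Rightarrow> nat" where
  "branch_slot t I = split_slot (branches (rep_tree t) I) (branches (rep_tree t) (root_children t - I))"

lemma splitting:
  assumes "I \<in> splittings t u w"
  shows "deg t = deg u + deg w" "bij_betw (branch_slot t I) (vertices (rep_tree t)) {..<card (vertices (rep_tree t))}"
proof -
  have I: "I \<subseteq> root_children t" and J: "root_children t - I \<subseteq> root_children t"
    using assms by (auto simp: splittings_def)
  note bij = split_slot_bij[OF tree_order_rep I]
  show "bij_betw (branch_slot t I) (vertices (rep_tree t)) {..<card (vertices (rep_tree t))}"
    unfolding branch_slot_def by (rule bij(1))
  show "deg t = deg u + deg w"
    using bij(2) assms deg_tree_of[OF branches(1)[OF tree_order_rep I]] deg_tree_of[OF branches(1)[OF tree_order_rep J]]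
    by (simp add: splittings_def deg_def)
qed

lemma Delta_GL_splittings:
  "Delta_GL g u w = coset (E_zero2 u w) (\<Sum>t | deg t = deg u + deg w. \<Sum>I\<in>splittings t u w.
     act (deg t) (slot_perm (vertices (rep_tree t)) (branch_slot t I) (\<rho> t)) (some_rep (g t)))"
  by (simp add: Delta_GL_def splittings_def branch_slot_def Let_def)

end

text \<open>The algebraic part takes place at a single time; \<open>y\<close> is the value of the
  path there.\<close>

locale smooth_fields = labelled_trees \<iota> \<rho>
  for \<iota> :: "'e::banach \<Rightarrow> 'a::{real_normed_algebra_1, banach}" and \<rho> +
  fixes V :: "'e \<Rightarrow> 'f::banach \<Rightarrow> 'f" and y :: 'f
  assumes smooth_V: "\<And>e. smooth (V e)"
begin

text \<open>\<open>Psi_elem\<close> refers to the chosen representative; by invariance under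
  isomorphism any other order with matching labels may be used to compute it.\<close>

lemma Psi_elem_eq:
  assumes f: "smooth f" and r: "tree_order r" and \<phi>: "order_iso \<phi> r (rep_tree u)"
    and lab: "\<And>v. v \<in> vertices r \<Longrightarrow> lab v = vs ! \<rho> u (\<phi> v)" and D: "decorates V y r lab D"
  shows "Psi_elem V f y u vs = hderiv f (map D (sorted_list_of_set (children r (tree_root r)))) y"
proof -
  have "decorates V y (rep_tree u) (\<lambda>v. vs ! \<rho> u v) (vertex_vectors V y u vs)"
    using someI_ex[OF decorates_exists[OF tree_order_rep[of u], of V y "\<lambda>v. vs ! \<rho> u v"]]
    unfolding decorates_def vertex_vectors_def .
  from hderiv_root_iso[OF f smooth_V r tree_order_rep \<phi> lab D this]
  show ?thesis by (simp add: Psi_elem_def)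
qed

lemma Psi_elem_enum:
  assumes f: "smooth f" and r: "tree_order r" and u: "tree_of r = u"
    and lab: "\<And>v. v \<in> vertices r \<Longrightarrow> lab v = vs ! enum r v" and D: "decorates V y r lab D"
  shows "Psi_elem V f y u vs = hderiv f (map D (sorted_list_of_set (children r (tree_root r)))) y"
proof -
  obtain \<phi> where \<phi>: "order_iso \<phi> r (rep_tree u)" "enum r = \<rho> u \<circ> \<phi>"
    using enum[OF r] u by blast
  show ?thesis using \<phi>(2) lab by (intro Psi_elem_eq[OF f r \<phi>(1) _ D]) simp
qed

lemma SG_permutes: "\<sigma> \<in> SG u \<Longrightarrow> \<sigma> permutes {..<deg u}"
proof -
  assume "\<sigma> \<in> SG u"
  then obtain \<pi> where \<pi>: "\<sigma> = slot_perm (vertices (rep_tree u)) (\<rho> u) (\<rho> u \<circ> \<pi>)" "\<pi> permutes vertices (rep_tree u)"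
    unfolding SG_def by blast
  show ?thesis
    unfolding \<pi>(1) deg_def
    by (rule slot_perm(1)[OF bij_rho bij_betw_trans[OF permutes_imp_bij[OF \<pi>(2)] bij_rho]])
qed

text \<open>Both values are read off from one decoration \<open>D\<close>, through the identity on
  the left and through the automorphism \<pi> on the right.\<close>

lemma Psi_elem_SG:
  assumes f: "smooth f" and \<sigma>: "\<sigma> \<in> SG u" and vs: "length vs = deg u"
  shows "Psi_elem V f y u (permute_list \<sigma> vs) = Psi_elem V f y u vs"
proof -
  let ?r = "rep_tree u"
  obtain \<pi> where \<pi>: "\<sigma> = slot_perm (vertices ?r) (\<rho> u) (\<rho> u \<circ> \<pi>)" "\<pi> permutes vertices ?r"
    "\<forall>v\<in>vertices ?r. \<forall>w\<in>vertices ?r. (v, w) \<in> ?r \<longrightarrow> (\<pi> v, \<pi> w) \<in> ?r"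
    using \<sigma> unfolding SG_def by blast
  note r = tree_order_rep[of u]
  obtain D where D: "decorates V y ?r (\<lambda>v. vs ! \<rho> u (\<pi> v)) D"
    using decorates_exists[OF r] by blast
  have "permute_list \<sigma> vs ! \<rho> u v = vs ! \<rho> u (\<pi> v)" if "v \<in> vertices ?r" for v
    using permute_list_slot_perm[OF bij_rho bij_betw_trans[OF permutes_imp_bij[OF \<pi>(2)] bij_rho] _ that, of vs] vs
    by (simp add: \<pi>(1) deg_def)
  then have "Psi_elem V f y u (permute_list \<sigma> vs) = hderiv f (map D (sorted_list_of_set (children ?r (tree_root ?r)))) y"
    by (intro Psi_elem_eq[OF f r order_iso_id _ D]) simp
  also have "\<dots> = Psi_elem V f y u vs"
    by (rule Psi_elem_eq[OF f r automorphism_iso[OF r \<pi>(2,3)] _ D, symmetric]) simp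
  finally show ?thesis .
qed

text \<open>One decoration \<open>D\<close> of \<open>t\<close> decorates both parts. The planted
  part has a single root child \<open>c\<close> and is sent to \<open>D c\<close> by the identity.
  By symmetry the argument \<open>D c\<close> of the derivative of \<open>f\<close> can be moved to
  the end of the list, where it turns \<open>f\<close> into \<open>hderiv f [D c]\<close>, a
  derivative in a constant direction.\<close>

lemma Psi_elem_split:
  assumes f: "smooth f" and I: "I \<in> splittings t u w" and u: "nchild u = 1"
    and len: "length us = deg u" "length ws = deg w"
    and lab: "\<And>v. v \<in> vertices (rep_tree t) \<Longrightarrow> (us @ ws) ! branch_slot t I v = vs ! \<rho> t v"
  shows "Psi_elem V f y t vs = Psi_elem V (hderiv f [Psi_elem V id y u us]) y w ws"
proof -
  let ?r = "rep_tree t" let ?C = "children ?r (tree_root ?r)"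
  define q where "q = branches ?r I"
  define q' where "q' = branches ?r (?C - I)"
  note r = tree_order_rep[of t]
  have IC: "I \<subseteq> ?C" and tu: "tree_of q = u" and tw: "tree_of q' = w" and J: "?C - I \<subseteq> ?C"
    using I by (auto simp: splittings_def q_def q'_def)
  note q = branches[OF r IC, folded q_def] and q' = branches[OF r J, folded q'_def]
  note sp = branches_vertices_split[OF r IC, folded q_def q'_def]
  have slot: "branch_slot t I = split_slot q q'" by (simp add: branch_slot_def q_def q'_def)
  have cq: "card (vertices q) = deg u" using deg_tree_of[OF q(1)] tu by simp
  have us: "us ! enum q v = vs ! \<rho> t v" if v: "v \<in> vertices q" for v
    using lab[of v] v bij_betw_apply[OF bij_enum[OF q(1)] v] len cq UnI1[OF v, of "vertices q'"]
    unfolding sp(1) slot by (simp add: split_slot_def nth_append)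
  have ws: "ws ! enum q' v = vs ! \<rho> t v" if v: "v \<in> vertices q'" for v
  proof -
    have "v \<notin> vertices q" using v sp(2) by blast
    then show ?thesis
      using lab[of v] len cq UnI2[OF v, of "vertices q"] unfolding sp(1) slot by (simp add: split_slot_def nth_append)
  qed
  have "card I = 1" using u tu nchild_tree_of[OF q(1)] q(2,5) by simp
  then obtain c where c: "I = {c}" by (auto simp: card_1_singleton_iff)
  obtain D where D: "decorates V y ?r (\<lambda>v. vs ! \<rho> t v) D" using decorates_exists[OF r] by blast
  have "Psi_elem V id y u us = hderiv id (map D (sorted_list_of_set (children q (tree_root q)))) y"
    using us by (intro Psi_elem_enum[OF smooth_id q(1) tu _ decorates_branches[OF r IC D, folded q_def]]) simp
  then have v: "Psi_elem V id y u us = D c"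
    using q(2,5) c by (simp add: hderiv_id)
  let ?L = "map D (sorted_list_of_set (?C - {c}))"
  have "Psi_elem V (hderiv f [D c]) y w ws = hderiv (hderiv f [D c]) (map D (sorted_list_of_set (children q' (tree_root q')))) y"
    using ws by (intro Psi_elem_enum[OF smooth_hderiv[OF f] q'(1) tw _ decorates_branches[OF r J D, folded q'_def]]) simp
  also have "\<dots> = hderiv f (?L @ [D c]) y"
    using q'(2,5) c by (simp add: hderiv_append)
  also have "mset (?L @ [D c]) = mset (map D (sorted_list_of_set ?C))"
  proof -
    have "c \<in> ?C" using c IC by blast
    then have "mset_set ?C = add_mset c (mset_set (?C - {c}))"
      using finite_children[OF r] by (rule mset_set.remove[rotated])
    then show ?thesis
      using finite_children[OF r] by (simp add: mset_map_sorted_list del: mset_map)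
  qed
  then have "hderiv f (?L @ [D c]) = hderiv f (map D (sorted_list_of_set ?C))"
    by (rule hderiv_mset[OF f])
  also have "hderiv f (map D (sorted_list_of_set ?C)) y = Psi_elem V f y t vs"
    by (rule Psi_elem_eq[OF f r order_iso_id _ D, symmetric]) simp
  finally show ?thesis unfolding v ..
qed

section \<open>Extensions to the completed tensor powers\<close>

lemma Psi_tree: "\<exists>\<Phi>. Psi_extension V f y t \<Phi> \<Longrightarrow> Psi_extension V f y t (Psi_tree V f y t)"
  unfolding Psi_tree_def by (rule someI_ex[of "Psi_extension V f y t"])

lemma Psi_extension_unique:
  assumes "Psi_extension V f y t \<Phi>" "Psi_extension V f y t \<Phi>'" "a \<in> ctensor_power (deg t)"
  shows "\<Phi> a = \<Phi>' a"
  by (rule linear_eq_on_ctensor[where k = "deg t"]) (use assms in \<open>simp_all add: Psi_extension_def\<close>)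

lemma linear_on_act_eq:
  fixes \<Phi> \<Psi> :: "'a \<Rightarrow> 'g::real_normed_vector"
  assumes \<Phi>: "linear \<Phi>" "continuous_on (ctensor_power k) \<Phi>" and \<Psi>: "linear \<Psi>" "continuous_on (ctensor_power k) \<Psi>"
    and \<sigma>: "\<sigma> permutes {..<k}"
    and eq: "\<And>vs. length vs = k \<Longrightarrow> \<Phi> (tensor \<iota> (permute_list \<sigma> vs)) = \<Psi> (tensor \<iota> vs)" and a: "a \<in> ctensor_power k"
  shows "\<Phi> (act k \<sigma> a) = \<Psi> a"
proof -
  have "(\<Phi> \<circ> act k \<sigma>) a = \<Psi> a"
  proof (rule linear_eq_on_ctensor[OF _ _ \<Psi> _ a])
    show "linear (\<Phi> \<circ> act k \<sigma>)" by (rule linear_compose[OF act(1)[OF \<sigma>] \<Phi>(1)])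
    show "continuous_on (ctensor_power k) (\<Phi> \<circ> act k \<sigma>)"
      using act_ctensor[OF \<sigma>]
      by (intro continuous_on_compose act(2)[OF \<sigma>] continuous_on_subset[OF \<Phi>(2)]) auto
  qed (simp add: act(3)[OF \<sigma>] eq)
  then show ?thesis by simp
qed

lemma SG_id: "id \<in> SG u"
proof -
  have "slot_perm (vertices (rep_tree u)) (\<rho> u) (\<rho> u \<circ> id) i = i" for i
  proof (cases "i < card (vertices (rep_tree u))")
    case True
    then have "i \<in> \<rho> u ` vertices (rep_tree u)" using bij_rho[of u] by (auto simp: bij_betw_def)
    then show ?thesis using True by (simp add: slot_perm_def f_inv_into_f)
  qed (simp add: slot_perm_def)
  then have "slot_perm (vertices (rep_tree u)) (\<rho> u) (\<rho> u \<circ> id) = id" by auto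
  then show ?thesis
    unfolding SG_def mem_Collect_eq by (intro exI[of _ id]) (simp add: permutes_id)
qed

lemma finite_SG: "finite (SG u)"
  by (rule finite_subset[of _ "{\<sigma>. \<sigma> permutes {..<deg u}}"]) (auto simp: SG_permutes finite_permutations)

text \<open>This makes the arbitrary choice in \<open>some_rep\<close> harmless: representatives of
  one coset have the same value.\<close>

lemma Psi_extension_E_zero:
  assumes f: "smooth f" and \<Phi>: "Psi_extension V f y u \<Phi>" and a: "a \<in> E_zero u"
  shows "\<Phi> a = 0"
proof (rule vanish_on_sym_ker[OF _ finite_SG _ _ a[unfolded E_zero_def]])
  note \<Phi>' = \<Phi>[unfolded Psi_extension_def]
  show "linear \<Phi>" using \<Phi>' by blast
  show "SG u \<noteq> {}" using SG_id by blast
  show "\<Phi> (act (deg u) \<sigma> b) = \<Phi> b" if "\<sigma> \<in> SG u" "b \<in> ctensor_power (deg u)" for \<sigma> b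
    using that \<Phi>' Psi_elem_SG[OF f that(1)]
    by (intro linear_on_act_eq[of \<Phi> "deg u" \<Phi>] SG_permutes) auto
qed

lemma SG2_permutes:
  assumes "\<sigma> \<in> SG2 u w"
  shows "\<sigma> permutes {..<deg u + deg w}"
    "\<exists>\<pi>\<in>SG u. \<exists>\<tau>\<in>SG w. \<forall>(us :: 'e list) ws. length us = deg u \<longrightarrow> length ws = deg w \<longrightarrow>
       permute_list \<sigma> (us @ ws) = permute_list \<pi> us @ permute_list \<tau> ws"
proof -
  obtain \<pi> \<tau> where \<sigma>: "\<sigma> = (\<lambda>i. if i < deg u then \<pi> i else deg u + \<tau> (i - deg u))" and m: "\<pi> \<in> SG u" "\<tau> \<in> SG w"
    using assms unfolding SG2_def by blast
  note \<pi> = SG_permutes[OF m(1)] and \<tau> = SG_permutes[OF m(2)]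
  have \<pi>l: "\<pi> i < deg u \<longleftrightarrow> i < deg u" and \<tau>l: "\<tau> i < deg w \<longleftrightarrow> i < deg w" for i
    using permutes_in_image[OF \<pi>] permutes_in_image[OF \<tau>] by auto
  have "inj_on \<sigma> {..<deg u + deg w}"
  proof (rule inj_onI)
    fix i j assume ij: "\<sigma> i = \<sigma> j"
    have iff: "i < deg u \<longleftrightarrow> j < deg u"
    proof (rule ccontr)
      assume "\<not> ?thesis"
      then show False using ij \<pi>l[of i] \<pi>l[of j] by (auto simp: \<sigma> split: if_splits)
    qed
    show "i = j"
    proof (cases "i < deg u")
      case True
      then have "\<pi> i = \<pi> j" using ij iff by (simp add: \<sigma>)
      then show ?thesis using permutes_inj[OF \<pi>] by (simp add: inj_eq)
    next
      case False
      then have "\<tau> (i - deg u) = \<tau> (j - deg u)" using ij iff by (simp add: \<sigma>)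
      then have "i - deg u = j - deg u" using permutes_inj[OF \<tau>] by (simp add: inj_eq)
      then show ?thesis using False iff by simp
    qed
  qed
  moreover have "\<sigma> ` {..<deg u + deg w} \<subseteq> {..<deg u + deg w}"
  proof
    fix j assume "j \<in> \<sigma> ` {..<deg u + deg w}"
    then obtain i where i: "i < deg u + deg w" "j = \<sigma> i" by auto
    then show "j \<in> {..<deg u + deg w}"
      using \<pi>l[of i] \<tau>l[of "i - deg u"] by (auto simp: \<sigma>)
  qed
  ultimately have "bij_betw \<sigma> {..<deg u + deg w} {..<deg u + deg w}"
    by (simp add: bij_betw_def endo_inj_surj)
  then show perm: "\<sigma> permutes {..<deg u + deg w}"
    by (rule bij_imp_permutes) (use permutes_not_in[OF \<tau>] in \<open>auto simp: \<sigma>\<close>)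
  have "permute_list \<sigma> (us @ ws) = permute_list \<pi> us @ permute_list \<tau> ws"
    if "length us = deg u" "length ws = deg w" for us ws :: "'e list"
  proof (rule nth_equalityI)
    fix i assume "i < length (permute_list \<sigma> (us @ ws))"
    then have i: "i < deg u + deg w" using that by simp
    show "permute_list \<sigma> (us @ ws) ! i = (permute_list \<pi> us @ permute_list \<tau> ws) ! i"
    proof (cases "i < deg u")
      case True
      then show ?thesis
        using i that \<pi>l[of i] by (simp add: permute_list_def nth_append \<sigma>)
    next
      case False
      then have "i - deg u < deg w" using i by simp
      then show ?thesis
        using False i that \<tau>l[of "i - deg u"] by (simp add: permute_list_def nth_append \<sigma>)
    qed
  qed (use that in simp)
  with m show "\<exists>\<pi>\<in>SG u. \<exists>\<tau>\<in>SG w. \<forall>(us :: 'e list) ws. length us = deg u \<longrightarrow> length ws = deg w \<longrightarrow>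
       permute_list \<sigma> (us @ ws) = permute_list \<pi> us @ permute_list \<tau> ws" by blast
qed

lemma finite_SG2: "finite (SG2 u w)"
proof (rule finite_subset)
  show "SG2 u w \<subseteq> (\<lambda>(\<sigma>, \<tau>) i. if i < deg u then \<sigma> i else deg u + \<tau> (i - deg u)) ` (SG u \<times> SG w)"
    by (auto simp: SG2_def)
qed (simp add: finite_SG)

lemma SG2_nonempty: "SG2 u w \<noteq> {}"
  using SG_id[of u] SG_id[of w] unfolding SG2_def by blast

text \<open>\<open>graft_form f u w B\<close>: \<open>B\<close> extends the value of \<open>f\<close> on the labelled tree obtained from the planted
  tree \<open>u\<close> and the tree \<open>w\<close> by identification of the roots.\<close>

definition graft_form :: "('f \<Rightarrow> 'g::banach) \<Rightarrow> tree \<Rightarrow> tree \<Rightarrow> ('a \<Rightarrow> 'g) \<Rightarrow> bool" where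
  "graft_form f u w B \<longleftrightarrow> linear B \<and> continuous_on (ctensor_power (deg u + deg w)) B \<and>
     (\<forall>us ws. length us = deg u \<longrightarrow> length ws = deg w \<longrightarrow>
        B (tensor \<iota> (us @ ws)) = Psi_elem V (hderiv f [Psi_elem V id y u us]) y w ws)"

text \<open>The two tensor factors cannot be treated one after the other, since no extension for
  derivatives of \<open>f\<close> is known yet. Instead \<open>u\<close> and \<open>w\<close> are
  joined to a tree \<open>t\<close>, and the extension for \<open>f\<close> on \<open>t\<close> is
  composed with a relabelling; \<open>Psi_elem_split\<close> identifies its values on elementary
  tensors.\<close>

lemma graft_form_exists:
  assumes f: "smooth f" and u: "nchild u = 1"
    and ext: "\<And>t. deg t = deg u + deg w \<Longrightarrow> \<exists>\<Phi>. Psi_extension V f y t \<Phi>"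
  shows "\<exists>B. graft_form f u w B"
proof -
  obtain t I where I: "I \<in> splittings t u w"
    using join_trees[OF tree_order_rep[of u] tree_order_rep[of w]] by (metis tree_of_rep)
  note dt = splitting(1)[OF I] and bij = splitting(2)[OF I]
  obtain \<Phi> where \<Phi>: "Psi_extension V f y t \<Phi>" using ext[OF dt] by blast
  \<comment> \<open>The inverse of the relabelling in \<open>Delta_GL\<close>: from slots ordered by
    parts to the enumeration of \<open>t\<close>.\<close>
  define \<sigma> where "\<sigma> = slot_perm (vertices (rep_tree t)) (\<rho> t) (branch_slot t I)"
  have \<sigma>: "\<sigma> permutes {..<deg t}"
    unfolding \<sigma>_def deg_def by (rule slot_perm(1)[OF bij_rho bij])
  have val: "Psi_elem V f y t (permute_list \<sigma> (us @ ws)) = Psi_elem V (hderiv f [Psi_elem V id y u us]) y w ws"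
    if len: "length us = deg u" "length ws = deg w" for us ws
  proof (rule Psi_elem_split[OF f I u len])
    show "(us @ ws) ! branch_slot t I v = permute_list \<sigma> (us @ ws) ! \<rho> t v" if "v \<in> vertices (rep_tree t)" for v
      unfolding \<sigma>_def using len dt that
      by (intro permute_list_slot_perm[OF bij_rho bij, symmetric]) (simp_all add: deg_def)
  qed
  have "graft_form f u w (\<Phi> \<circ> act (deg t) \<sigma>)"
    unfolding graft_form_def
  proof (intro conjI allI impI)
    show "linear (\<Phi> \<circ> act (deg t) \<sigma>)"
      using \<Phi> linear_compose[OF act(1)[OF \<sigma>]] by (auto simp: Psi_extension_def)
    show "continuous_on (ctensor_power (deg u + deg w)) (\<Phi> \<circ> act (deg t) \<sigma>)"
      unfolding dt[symmetric] using \<Phi> act_ctensor[OF \<sigma>]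
      by (intro continuous_on_compose act(2)[OF \<sigma>]) (auto simp: Psi_extension_def intro: continuous_on_subset)
    show "(\<Phi> \<circ> act (deg t) \<sigma>) (tensor \<iota> (us @ ws)) = Psi_elem V (hderiv f [Psi_elem V id y u us]) y w ws"
      if "length us = deg u" "length ws = deg w" for us ws
    proof -
      have "act (deg t) \<sigma> (tensor \<iota> (us @ ws)) = tensor \<iota> (permute_list \<sigma> (us @ ws))"
        by (rule act(3)[OF \<sigma>]) (use that dt in simp)
      then show ?thesis
        using that \<Phi> dt val[OF that] by (simp add: Psi_extension_def)
    qed
  qed
  then show ?thesis by blast
qed

text \<open>Freezing the first factor produces the missing extension for the derivative of
  \<open>f\<close>, in the direction \<open>\<Phi> a\<close> for any \<open>a\<close> in the
  completed power, elementary or not.\<close>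

lemma graft_form_mult:
  assumes f: "smooth f" and B: "graft_form f u w B" and \<Phi>: "Psi_extension V id y u \<Phi>" and a: "a \<in> ctensor_power (deg u)"
  shows "Psi_extension V (hderiv f [\<Phi> a]) y w (\<lambda>b. B (a * b))"
proof -
  note B' = B[unfolded graft_form_def] and \<Phi>' = \<Phi>[unfolded Psi_extension_def]
  have cont: "continuous_on (ctensor_power k) (\<lambda>z. B (h z))"
    if "continuous_on (ctensor_power k) h" "h ` ctensor_power k \<subseteq> ctensor_power (deg u + deg w)" for h k
    by (rule continuous_on_compose2[OF _ that]) (use B' in blast)
  have val: "B (a * tensor \<iota> ws) = Psi_elem V (hderiv f [\<Phi> a]) y w ws" if ws: "length ws = deg w" for ws
  proof -
    define L where "L = map (vertex_vectors V y w ws) (sorted_list_of_set (root_children w))"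
    have L: "Psi_elem V (hderiv f [v]) y w ws = hderiv f (L @ [v]) y" for v
      by (simp add: Psi_elem_def L_def hderiv_append)
    have bl: "bounded_linear (\<lambda>v. hderiv f (L @ [v]) y)" using smooth_bounded_linear[OF f, of L "[]"] .
    \<comment> \<open>For a fixed second factor both sides are linear and continuous in
      \<open>a\<close>, so elementary \<open>a\<close> suffice.\<close>
    have "B (a * tensor \<iota> ws) = hderiv f (L @ [\<Phi> a]) y"
    proof (rule linear_eq_on_ctensor[where k = "deg u" and \<Phi> = "\<lambda>a. B (a * tensor \<iota> ws)" and \<Psi> = "\<lambda>a. hderiv f (L @ [\<Phi> a]) y", OF _ _ _ _ _ a])
      show "linear (\<lambda>a. B (a * tensor \<iota> ws))"
        using B' by (intro linearI) (simp_all add: linear_add linear_scale distrib_right)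
      show "continuous_on (ctensor_power (deg u)) (\<lambda>a. B (a * tensor \<iota> ws))"
        using ctensor_mult(1)[OF _ tensor_ctensor[OF ws]] by (intro cont continuous_intros) auto
      show "linear (\<lambda>a. hderiv f (L @ [\<Phi> a]) y)"
        using linear_compose[of \<Phi>, OF _ bounded_linear.linear[OF bl]] \<Phi>' by (simp add: o_def)
      show "continuous_on (ctensor_power (deg u)) (\<lambda>a. hderiv f (L @ [\<Phi> a]) y)"
        using \<Phi>' by (intro bounded_linear.continuous_on[OF bl]) auto
      show "B (tensor \<iota> us * tensor \<iota> ws) = hderiv f (L @ [\<Phi> (tensor \<iota> us)]) y" if "length us = deg u" for us
        using B' \<Phi>' that ws by (simp add: tensor_append[symmetric] L)
    qed
    then show ?thesis by (simp add: L)
  qed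
  show ?thesis
    unfolding Psi_extension_def
  proof (intro conjI allI impI)
    show "linear (\<lambda>b. B (a * b))"
      using B' by (intro linearI) (simp_all add: linear_add linear_scale distrib_left)
    show "continuous_on (ctensor_power (deg w)) (\<lambda>b. B (a * b))"
      using ctensor_mult(1)[OF a] by (intro cont continuous_intros) auto
  qed (rule val)
qed

text \<open>An identity in the completed tensor product holds modulo \<open>E_zero2\<close> only;
  the invariance of \<open>Psi_elem\<close> under \<open>SG\<close> in both parts makes
  \<open>B\<close> insensitive to that.\<close>

lemma graft_form_E_zero2:
  assumes f: "smooth f" and B: "graft_form f u w B" and a: "a \<in> E_zero2 u w"
  shows "B a = 0"
proof (rule vanish_on_sym_ker[OF _ finite_SG2 SG2_nonempty _ a[unfolded E_zero2_def]])
  note B' = B[unfolded graft_form_def]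
  show "linear B" using B' by blast
  fix \<sigma> b assume \<sigma>: "\<sigma> \<in> SG2 u w" and b: "b \<in> ctensor_power (deg u + deg w)"
  obtain \<pi> \<tau> where m: "\<pi> \<in> SG u" "\<tau> \<in> SG w" and p: "\<And>(us :: 'e list) ws. length us = deg u \<Longrightarrow> length ws = deg w \<Longrightarrow>
       permute_list \<sigma> (us @ ws) = permute_list \<pi> us @ permute_list \<tau> ws"
    using SG2_permutes(2)[OF \<sigma>] by blast
  show "B (act (deg u + deg w) \<sigma> b) = B b"
  proof (rule linear_on_act_eq[OF _ _ _ _ SG2_permutes(1)[OF \<sigma>] _ b])
    fix vs :: "'e list" assume "length vs = deg u + deg w"
    then have "vs = take (deg u) vs @ drop (deg u) vs" "length (take (deg u) vs) = deg u" "length (drop (deg u) vs) = deg w"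
      by auto
    then obtain us ws where vs: "vs = us @ ws" "length us = deg u" "length ws = deg w" by blast
    have "B (tensor \<iota> (permute_list \<pi> us @ permute_list \<tau> ws))
        = Psi_elem V (hderiv f [Psi_elem V id y u (permute_list \<pi> us)]) y w (permute_list \<tau> ws)"
      using B' vs by simp
    also have "\<dots> = B (tensor \<iota> (us @ ws))"
      using B' vs Psi_elem_SG[OF smooth_id m(1) vs(2)] Psi_elem_SG[OF smooth_hderiv[OF f] m(2) vs(3)] by simp
    finally show "B (tensor \<iota> (permute_list \<sigma> vs)) = B (tensor \<iota> vs)"
      using p[OF vs(2,3)] vs(1) by simp
  qed (use B' in auto)
qed

text \<open>Whichever splitting of \<open>t\<close> is used, \<open>B\<close> returns the value of
  \<open>f\<close> on \<open>t\<close>, so the terms of the coproduct that come from one tree all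
  contribute equally.\<close>

lemma graft_form_split:
  assumes f: "smooth f" and B: "graft_form f u w B" and u: "nchild u = 1" and \<Phi>: "Psi_extension V f y t \<Phi>"
    and I: "I \<in> splittings t u w" and a: "a \<in> ctensor_power (deg t)"
  shows "B (act (deg t) (slot_perm (vertices (rep_tree t)) (branch_slot t I) (\<rho> t)) a) = \<Phi> a"
proof -
  note dt = splitting(1)[OF I] and bij = splitting(2)[OF I]
  let ?\<sigma> = "slot_perm (vertices (rep_tree t)) (branch_slot t I) (\<rho> t)"
  have "?\<sigma> permutes {..<deg t}"
    unfolding deg_def by (rule slot_perm(1)[OF bij bij_rho])
  then show ?thesis
  proof (rule linear_on_act_eq[OF _ _ _ _ _ _ a, rotated 4])
    fix vs :: "'e list" assume vs: "length vs = deg t"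
    define us where "us = take (deg u) (permute_list ?\<sigma> vs)"
    define ws where "ws = drop (deg u) (permute_list ?\<sigma> vs)"
    have len: "length us = deg u" "length ws = deg w" and ap: "permute_list ?\<sigma> vs = us @ ws"
      using vs dt by (auto simp: us_def ws_def)
    have "Psi_elem V f y t vs = Psi_elem V (hderiv f [Psi_elem V id y u us]) y w ws"
    proof (rule Psi_elem_split[OF f I u len])
      show "(us @ ws) ! branch_slot t I v = vs ! \<rho> t v" if "v \<in> vertices (rep_tree t)" for v
        unfolding ap[symmetric] using vs that
        by (intro permute_list_slot_perm[OF bij bij_rho]) (simp_all add: deg_def)
    qed
    then show "B (tensor \<iota> (permute_list ?\<sigma> vs)) = \<Phi> (tensor \<iota> vs)"
      using B \<Phi> vs len by (simp add: ap graft_form_def Psi_extension_def)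
  qed (use B \<Phi> dt in \<open>auto simp: graft_form_def Psi_extension_def\<close>)
qed

section \<open>Evaluation of the coproduct\<close>

lemma E_zero_subset: "E_zero t \<subseteq> ctensor_power (deg t)"
  by (auto simp: E_zero_def sym_ker_def)

lemma zero_E_zero: "0 \<in> E_zero t"
  unfolding E_zero_def by (intro zero_sym_ker SG_permutes)

lemma zero_E_zero2: "0 \<in> E_zero2 u w"
  unfolding E_zero2_def by (intro zero_sym_ker SG2_permutes)

lemma E_tree_mem:
  assumes "C \<in> E_tree t" "c \<in> C"
  shows "c \<in> ctensor_power (deg t)" "C = coset (E_zero t) a \<Longrightarrow> c - a \<in> E_zero t"
  using assms E_zero_subset subspace_add[OF subspace_ctensor, of _ "deg t"] unfolding E_tree_def coset_def by auto

lemma some_rep_mem: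
  assumes "C \<in> E_tree t"
  shows "some_rep C \<in> C"
proof -
  obtain a where "C = coset (E_zero t) a" using assms by (auto simp: E_tree_def)
  then have "a + 0 \<in> C" unfolding coset_def using zero_E_zero by blast
  then show ?thesis unfolding some_rep_def by (rule someI[of "\<lambda>x. x \<in> C"])
qed

lemma some_rep_ctensor: "g \<in> Tr \<Longrightarrow> some_rep (g t) \<in> ctensor_power (deg t)"
  by (rule E_tree_mem(1)[of "g t" t, OF _ some_rep_mem[of "g t" t]]) (simp_all add: Tr_def)

text \<open>\<open>B\<close> is applied to both sides of
  \<open>Delta_GL g u w = otimes g g u w\<close>. The tensor product becomes a value for the
  derivative of \<open>f\<close> on \<open>w\<close>, the coproduct a sum of values for
  \<open>f\<close>.\<close>

lemma coproduct_step:
  assumes g: "group_like g" and f: "smooth f" and u: "nchild u = 1"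
    and ext: "\<And>t. deg t = deg u + deg w \<Longrightarrow> \<exists>\<Phi>. Psi_extension V f y t \<Phi>"
    and extu: "\<exists>\<Phi>. Psi_extension V id y u \<Phi>"
  defines "v \<equiv> Psi_tree V id y u (some_rep (g u))"
  shows "\<exists>\<Phi>. Psi_extension V (hderiv f [v]) y w \<Phi>"
    "Psi_tree V (hderiv f [v]) y w (some_rep (g w))
      = (\<Sum>t | deg t = deg u + deg w. \<Sum>I\<in>splittings t u w. Psi_tree V f y t (some_rep (g t)))"
proof -
  have gT: "g \<in> Tr" using g by (simp add: group_like_def)
  note c = some_rep_ctensor[OF gT]
  obtain B where B: "graft_form f u w B" using graft_form_exists[OF f u ext] by blast
  note mult = graft_form_mult[OF f B Psi_tree[OF extu] c[of u], folded v_def]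
  then show ex: "\<exists>\<Phi>. Psi_extension V (hderiv f [v]) y w \<Phi>" by blast
  have "Psi_tree V (hderiv f [v]) y w (some_rep (g w)) = B (some_rep (g u) * some_rep (g w))"
    by (rule Psi_extension_unique[OF Psi_tree[OF ex] mult c])
  also have "\<dots> = B (\<Sum>t | deg t = deg u + deg w. \<Sum>I\<in>splittings t u w.
       act (deg t) (slot_perm (vertices (rep_tree t)) (branch_slot t I) (\<rho> t)) (some_rep (g t)))"
    (is "_ = B ?S")
  proof -
    have "Delta_GL g u w = otimes g g u w" using g by (simp add: group_like_def)
    then have "?S - some_rep (g u) * some_rep (g w) \<in> E_zero2 u w"
      unfolding Delta_GL_splittings otimes_def by (rule coset_eqD[OF _ zero_E_zero2])
    from graft_form_E_zero2[OF f B this] show ?thesis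
      using B by (simp add: graft_form_def linear_diff)
  qed
  also have "\<dots> = (\<Sum>t | deg t = deg u + deg w. \<Sum>I\<in>splittings t u w. Psi_tree V f y t (some_rep (g t)))"
  proof -
    have lin: "linear B" using B by (simp add: graft_form_def)
    show ?thesis
      unfolding linear_sum[OF lin]
    proof (intro sum.cong refl, elim CollectE)
      fix t I assume "deg t = deg u + deg w" and I: "I \<in> splittings t u w"
      then have "Psi_extension V f y t (Psi_tree V f y t)" by (intro Psi_tree ext)
      then show "B (act (deg t) (slot_perm (vertices (rep_tree t)) (branch_slot t I) (\<rho> t)) (some_rep (g t)))
        = Psi_tree V f y t (some_rep (g t))"
        by (rule graft_form_split[OF f B u _ I c])
    qed
  qed
  finally show "Psi_tree V (hderiv f [v]) y w (some_rep (g w))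
      = (\<Sum>t | deg t = deg u + deg w. \<Sum>I\<in>splittings t u w. Psi_tree V f y t (some_rep (g t)))" .
qed

end

section \<open>Group-like elements\<close>

text \<open>If \<open>P i\<close> is given the degree \<open>i\<close>, then \<open>degree_part P k L n\<close> is the part of total degree \<open>n\<close> of
  \<open>L [S, \<dots>, S]\<close> with \<open>k\<close> arguments \<open>S = (\<Sum>i\<ge>1. P i)\<close>.\<close>

primrec degree_part :: "(nat \<Rightarrow> 'f) \<Rightarrow> nat \<Rightarrow> ('f list \<Rightarrow> 'g::real_vector) \<Rightarrow> nat \<Rightarrow> 'g" where
  "degree_part P 0 L n = (if n = 0 then L [] else 0)"
| "degree_part P (Suc k) L n = (\<Sum>i=1..n. degree_part P k (\<lambda>hs. L (hs @ [P i])) (n - i))"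

text \<open>The Taylor polynomial of order \<open>N\<close> of \<open>f\<close> at \<open>y\<close>
  in the increment \<open>P 1 + ... + P N\<close>, with all products of total degree above
  \<open>N\<close> left out.\<close>

definition degree_expansion :: "nat \<Rightarrow> (nat \<Rightarrow> 'f::real_normed_vector) \<Rightarrow> ('f \<Rightarrow> 'g::real_normed_vector) \<Rightarrow> 'f \<Rightarrow> 'g" where
  "degree_expansion N P f y = (\<Sum>k\<le>N. (1 / fact k) *\<^sub>R (\<Sum>n\<le>N. degree_part P k (\<lambda>hs. hderiv f hs y) n))"

lemma degree_part_sum:
  "degree_part P k (\<lambda>hs. \<Sum>j\<in>J. L j hs) n = (\<Sum>j\<in>J. degree_part P k (L j) n)"
proof (induction k arbitrary: L n)
  case (Suc k)
  then show ?case by (simp add: sum.swap[of _ J])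
qed simp

text \<open>The origin of the factorial: one of \<open>k + 1\<close> root children can be removed in
  \<open>k + 1\<close> ways.\<close>

lemma count_splittings:
  assumes C: "finite C"
  shows "card {I. I \<subseteq> C \<and> card I = 1 \<and> card (C - I) = k} = (if card C = Suc k then Suc k else 0)"
proof (cases "card C = Suc k")
  case True
  then have "{I. I \<subseteq> C \<and> card I = 1 \<and> card (C - I) = k} = {I. I \<subseteq> C \<and> card I = 1}"
    using C by (auto simp: card_Diff_subset finite_subset)
  then show ?thesis using True n_subsets[OF C, of 1] by simp
next
  case False
  have "card C = Suc k" if "I \<subseteq> C" "card I = 1" "card (C - I) = k" for I
    using that C card_mono[OF C that(1)] by (simp add: card_Diff_subset finite_subset)
  then have "{I. I \<subseteq> C \<and> card I = 1 \<and> card (C - I) = k} = {}" using False by blast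
  then show ?thesis using False by (simp only: card.empty if_False)
qed

section \<open>The component of a group-like element on the trivial tree\<close>

context tensor_powers
begin

lemma act_id:
  assumes "a \<in> ctensor_power k"
  shows "act k id a = a"
  by (rule linear_eq_on_ctensor[OF act(1,2) linear_id continuous_on_id' _ assms, simplified])
    (simp_all add: act(3) permutes_id)

text \<open>Composition with \<sigma> permutes \<open>H\<close>, so it only reorders the
  sum.\<close>

lemma symmetrizer_act:
  assumes H: "finite H" "\<And>\<sigma>. \<sigma> \<in> H \<Longrightarrow> \<sigma> permutes {..<k}" "\<And>\<sigma> \<tau>. \<sigma> \<in> H \<Longrightarrow> \<tau> \<in> H \<Longrightarrow> \<sigma> \<circ> \<tau> \<in> H"
    and \<sigma>: "\<sigma> \<in> H" and a: "a \<in> ctensor_power k"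
  shows "symmetrizer k H (act k \<sigma> a) = symmetrizer k H a"
proof -
  have "inj_on ((\<circ>) \<sigma>) H"
    using permutes_inj[OF H(2)[OF \<sigma>]] by (auto intro!: inj_onI simp: fun_eq_iff inj_eq)
  moreover have "(\<circ>) \<sigma> ` H \<subseteq> H" using H(3)[OF \<sigma>] by blast
  ultimately have "(\<circ>) \<sigma> ` H = H" using endo_inj_surj[OF H(1)] by blast
  have "(\<Sum>\<tau>\<in>H. act k \<tau> (act k \<sigma> a)) = (\<Sum>\<tau>\<in>H. act k (\<sigma> \<circ> \<tau>) a)"
    using H(2) \<sigma> by (intro sum.cong refl act_act[OF _ _ a]) auto
  also have "\<dots> = (\<Sum>\<tau>\<in>(\<circ>) \<sigma> ` H. act k \<tau> a)"
    by (simp add: sum.reindex[OF \<open>inj_on ((\<circ>) \<sigma>) H\<close>])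
  finally show ?thesis
    unfolding symmetrizer_def \<open>(\<circ>) \<sigma> ` H = H\<close> by simp
qed

end

context smooth_fields
begin

lemma SG_comp:
  assumes "\<sigma> \<in> SG u" "\<tau> \<in> SG u"
  shows "\<sigma> \<circ> \<tau> \<in> SG u"
proof -
  let ?B = "vertices (rep_tree u)" let ?r = "rep_tree u"
  obtain \<pi> where \<pi>: "\<sigma> = slot_perm ?B (\<rho> u) (\<rho> u \<circ> \<pi>)" "\<pi> permutes ?B"
    "\<forall>v\<in>?B. \<forall>w\<in>?B. (v, w) \<in> ?r \<longrightarrow> (\<pi> v, \<pi> w) \<in> ?r"
    using assms(1) unfolding SG_def by blast
  obtain \<pi>' where \<pi>': "\<tau> = slot_perm ?B (\<rho> u) (\<rho> u \<circ> \<pi>')" "\<pi>' permutes ?B"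
    "\<forall>v\<in>?B. \<forall>w\<in>?B. (v, w) \<in> ?r \<longrightarrow> (\<pi>' v, \<pi>' w) \<in> ?r"
    using assms(2) unfolding SG_def by blast
  have bij: "bij_betw (\<rho> u \<circ> p) ?B {..<card ?B}" if "p permutes ?B" for p
    by (rule bij_betw_trans[OF permutes_imp_bij[OF that] bij_rho])
  have p: "\<pi> \<circ> \<pi>' permutes ?B" using permutes_compose[OF \<pi>'(2) \<pi>(2)] .
  have "(\<sigma> \<circ> \<tau>) i = slot_perm ?B (\<rho> u) (\<rho> u \<circ> (\<pi> \<circ> \<pi>')) i" for i
  proof (cases "i < card ?B")
    case True
    then obtain v where v: "v \<in> ?B" "i = \<rho> u v" using bij_rho[of u] by (auto simp: bij_betw_def)
    have v': "\<pi>' v \<in> ?B" using v permutes_in_image[OF \<pi>'(2)] by simp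
    show ?thesis
      using slot_perm(2)[OF bij_rho bij[OF \<pi>(2)] v'] slot_perm(2)[OF bij_rho bij[OF \<pi>'(2)] v(1)]
        slot_perm(2)[OF bij_rho bij[OF p] v(1)]
      by (simp add: \<pi>(1) \<pi>'(1) v(2))
  next
    case False
    then show ?thesis by (simp add: \<pi>(1) \<pi>'(1) slot_perm_def)
  qed
  then have "\<sigma> \<circ> \<tau> = slot_perm ?B (\<rho> u) (\<rho> u \<circ> (\<pi> \<circ> \<pi>'))" by blast
  moreover have "\<forall>v\<in>?B. \<forall>w\<in>?B. (v, w) \<in> ?r \<longrightarrow> ((\<pi> \<circ> \<pi>') v, (\<pi> \<circ> \<pi>') w) \<in> ?r"
    using \<pi>(3) \<pi>'(3) permutes_in_image[OF \<pi>'(2)] by simp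
  ultimately show ?thesis using p unfolding SG_def by blast
qed

text \<open>\<open>enum\<close> picks some isomorphism of the representative with itself, so on
  \<open>rep_tree u\<close> it may differ from \<open>\<rho> u\<close>; the difference is an
  automorphism.\<close>

lemma enum_rep_SG:
  assumes f: "\<And>v. v \<in> vertices (rep_tree u) \<Longrightarrow> f v = enum (rep_tree u) v"
  shows "slot_perm (vertices (rep_tree u)) f (\<rho> u) \<in> SG u"
proof -
  let ?r = "rep_tree u" let ?B = "vertices ?r"
  note r = tree_order_rep[of u]
  obtain \<phi> where \<phi>: "order_iso \<phi> ?r ?r" "enum ?r = \<rho> u \<circ> \<phi>"
    using enum[OF r] by (metis tree_of_rep)
  have \<phi>B: "bij_betw \<phi> ?B ?B" using order_iso_vertices[OF r r \<phi>(1)] .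
  define \<pi> where "\<pi> v = (if v \<in> ?B then inv_into ?B \<phi> v else v)" for v
  have inv: "inv_into ?B \<phi> v \<in> ?B" "\<phi> (inv_into ?B \<phi> v) = v" if "v \<in> ?B" for v
    using that \<phi>B by (auto simp: bij_betw_def inv_into_into f_inv_into_f)
  have "bij_betw \<pi> ?B ?B"
    by (rule bij_betw_cong[THEN iffD1, OF _ bij_betw_inv_into[OF \<phi>B]]) (simp add: \<pi>_def)
  then have \<pi>: "\<pi> permutes ?B" by (rule bij_imp_permutes) (simp add: \<pi>_def)
  have mono: "\<forall>v\<in>?B. \<forall>w\<in>?B. (v, w) \<in> ?r \<longrightarrow> (\<pi> v, \<pi> w) \<in> ?r"
  proof (intro ballI impI)
    fix v w assume vw: "v \<in> ?B" "w \<in> ?B" "(v, w) \<in> ?r"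
    then have "(\<phi> (\<pi> v), \<phi> (\<pi> w)) \<in> ?r" using inv by (simp add: \<pi>_def)
    moreover have "\<pi> v \<in> Field ?r" "\<pi> w \<in> Field ?r" using inv vw by (auto simp: \<pi>_def vertices_def)
    ultimately show "(\<pi> v, \<pi> w) \<in> ?r" using order_isoD(2)[OF \<phi>(1)] by blast
  qed
  have fB: "bij_betw f ?B {..<card ?B}"
    by (rule bij_betw_cong[THEN iffD1, OF _ bij_enum[OF r]]) (simp add: f)
  have "slot_perm ?B f (\<rho> u) i = slot_perm ?B (\<rho> u) (\<rho> u \<circ> \<pi>) i" for i
  proof (cases "i < card ?B")
    case True
    then obtain v where v: "v \<in> ?B" "i = f v" using fB by (auto simp: bij_betw_def)
    have w: "\<phi> v \<in> ?B" using bij_betw_apply[OF \<phi>B v(1)] .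
    have "\<pi> (\<phi> v) = v" using w v(1) \<phi>B by (simp add: \<pi>_def bij_betw_def)
    moreover have "i = \<rho> u (\<phi> v)" using v f \<phi>(2) by simp
    ultimately show ?thesis
      using slot_perm(2)[OF fB bij_rho v(1)] v(2)
        slot_perm(2)[OF bij_rho bij_betw_trans[OF permutes_imp_bij[OF \<pi>] bij_rho] w] by simp
  next
    case False
    then show ?thesis by (simp add: slot_perm_def)
  qed
  then have "slot_perm ?B f (\<rho> u) = slot_perm ?B (\<rho> u) (\<rho> u \<circ> \<pi>)" by blast
  then show ?thesis using \<pi> mono unfolding SG_def by blast
qed

lemma SG2_unit:
  assumes "deg e = 0"
  shows "SG2 u e = SG u" "E_zero2 u e = E_zero u"
proof -
  have "\<tau> = id" if "\<tau> \<in> SG e" for \<tau>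
    using SG_permutes[OF that] assms by simp
  moreover have "(\<lambda>i. if i < deg u then \<sigma> i else deg u + id (i - deg u)) = \<sigma>" if "\<sigma> \<in> SG u" for \<sigma>
    using permutes_not_in[OF SG_permutes[OF that]] by auto
  ultimately show "SG2 u e = SG u"
    using SG_id[of e] unfolding SG2_def by (auto; metis)
  then show "E_zero2 u e = E_zero u" by (simp add: E_zero2_def E_zero_def assms)
qed

lemma subspace_E_zero: "subspace (E_zero t)"
proof -
  have "linear (symmetrizer (deg t) (SG t))" by (rule symmetrizer_linear[OF SG_permutes])
  then show ?thesis
    using subspace_ctensor[of "deg t"] unfolding E_zero_def sym_ker_def subspace_def
    by (simp add: linear_0 linear_add linear_scale)
qed

text \<open>In the component at \<open>(u, e)\<close> the only splitting leaves no child of the root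
  for \<open>e\<close>, so the coproduct returns \<open>g u\<close> itself, up to an automorphism
  coming from \<open>enum\<close>.\<close>

lemma coproduct_unit:
  assumes g: "group_like g" and e: "deg e = 0"
  obtains \<sigma> where "\<sigma> \<in> SG u" "act (deg u) \<sigma> (some_rep (g u)) - some_rep (g u) * some_rep (g e) \<in> E_zero u"
proof -
  let ?S = "\<lambda>t I. act (deg t) (slot_perm (vertices (rep_tree t)) (branch_slot t I) (\<rho> t)) (some_rep (g t))"
  have all: "branches (rep_tree t) (root_children t) = rep_tree t" for t
    by (rule branches_all[OF tree_order_rep])
  have I: "I = root_children t \<and> t = u" if "I \<in> splittings t u e" for I t
  proof -
    have "root_children t - I \<subseteq> root_children t" by blast
    note b = branches[OF tree_order_rep this]
    have "nchild e = card (root_children t - I)"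
      using nchild_tree_of[OF b(1)] b(2,5) that by (auto simp: splittings_def)
    then have "card (root_children t - I) = 0" using e nchild_0_iff[of e] by simp
    moreover have "finite (root_children t - I)" using finite_children[OF tree_order_rep] by blast
    ultimately have "root_children t - I = {}" by (metis card_0_eq)
    then have "I = root_children t" using that by (auto simp: splittings_def)
    then show ?thesis using that all[of t] by (auto simp: splittings_def)
  qed
  have "deg (tree_of (branches (rep_tree u) {})) = 0"
    using deg_tree_of[OF branches(1)[OF tree_order_rep empty_subsetI]] branches(3)[OF tree_order_rep empty_subsetI] by simp
  then have "root_children u \<in> splittings u u e"
    using all[of u] deg_0_unique[OF _ e] by (simp add: splittings_def)
  then have Iu: "splittings u u e = {root_children u}" using I by blast
  have It: "splittings t u e = {}" if "t \<noteq> u" for t using I that by blast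
  have inner: "(\<Sum>I\<in>splittings t u e. ?S t I) = (if t = u then ?S u (root_children u) else 0)" for t
    by (cases "t = u") (simp_all add: Iu It)
  have eq: "(\<Sum>t | deg t = deg u + deg e. \<Sum>I\<in>splittings t u e. ?S t I) = ?S u (root_children u)"
    unfolding inner using finite_trees[of "deg u"] e by simp
  have "Delta_GL g u e = otimes g g u e" using g by (simp add: group_like_def)
  then have F: "(\<Sum>t | deg t = deg u + deg e. \<Sum>I\<in>splittings t u e. ?S t I) - some_rep (g u) * some_rep (g e) \<in> E_zero2 u e"
    unfolding Delta_GL_splittings otimes_def by (rule coset_eqD[OF _ zero_E_zero2])
  have "slot_perm (vertices (rep_tree u)) (branch_slot u (root_children u)) (\<rho> u) \<in> SG u"
    by (rule enum_rep_SG) (simp add: branch_slot_def split_slot_def all)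
  then show ?thesis
    by (rule that) (use F in \<open>simp only: eq SG2_unit(2)[OF e]\<close>)
qed

text \<open>The component on the trivial tree is idempotent, hence 0 or 1. If it were 0, the
  components at \<open>(u, e)\<close> would make all of \<open>g\<close> vanish, which
  \<open>group_like\<close> excludes.\<close>

lemma group_like_unit:
  assumes g: "group_like g" and e: "deg e = 0"
  shows "some_rep (g e) = 1"
proof -
  have gT: "g \<in> Tr" using g by (simp add: group_like_def)
  note c = some_rep_ctensor[OF gT]
  let ?a = "some_rep (g e)"
  have one: "1 \<in> ctensor_power 0" using tensor_ctensor[of "[]" 0] by (simp add: tensor_def)
  have a: "?a \<in> ctensor_power 0" using c[of e] e by simp
  obtain \<sigma> where \<sigma>: "\<sigma> \<in> SG e" "act (deg e) \<sigma> ?a - ?a * ?a \<in> E_zero e"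
    using coproduct_unit[OF g e] by blast
  have SGe: "\<tau> = id" if "\<tau> \<in> SG e" for \<tau> using SG_permutes[OF that] e by simp
  have "act (deg e) \<sigma> ?a = ?a" using SGe[OF \<sigma>(1)] act_id[OF a] e by simp
  with \<sigma>(2) have "?a - ?a * ?a \<in> sym_ker 0 (SG e)" by (simp add: E_zero_def e)
  \<comment> \<open>\<open>SG e\<close> contains only the identity, so the congruence modulo
    \<open>E_zero e\<close> is an equality in the algebra.\<close>
  then have "id (?a - ?a * ?a) = 0"
  proof (rule vanish_on_sym_ker[OF linear_id finite_SG, rotated 2])
    show "id (act 0 \<tau> b) = id b" if "\<tau> \<in> SG e" "b \<in> ctensor_power 0" for \<tau> b
      using SGe[OF that(1)] act_id[OF that(2)] by simp
  qed (use SG_id[of e] in blast)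
  then have "?a * (?a - 1) = 0" by (simp add: algebra_simps)
  \<comment> \<open>Cancellation rests on the cross norm identity, as a Banach algebra may have zero
    divisors.\<close>
  moreover have "norm (?a * (?a - 1)) = norm ?a * norm (?a - 1)"
    by (rule ctensor_mult(2)[OF a subspace_diff[OF subspace_ctensor a one]])
  ultimately have "?a = 0 \<or> ?a = 1" by auto
  moreover have False if 0: "?a = 0"
  proof -
    have "g u = E_zero u" for u
    proof -
      obtain \<sigma> where \<sigma>: "\<sigma> \<in> SG u" "act (deg u) \<sigma> (some_rep (g u)) - some_rep (g u) * ?a \<in> E_zero u"
        using coproduct_unit[OF g e] by blast
      then have "symmetrizer (deg u) (SG u) (act (deg u) \<sigma> (some_rep (g u))) = 0"
        by (simp add: 0 E_zero_def sym_ker_def)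
      then have "symmetrizer (deg u) (SG u) (some_rep (g u)) = 0"
        using symmetrizer_act[OF finite_SG SG_permutes SG_comp \<sigma>(1) c] by simp
      then have z: "some_rep (g u) \<in> E_zero u" using c[of u] by (simp add: E_zero_def sym_ker_def)
      have gu: "g u \<in> E_tree u" using gT by (simp add: Tr_def)
      then obtain b where b: "g u = coset (E_zero u) b" by (auto simp: E_tree_def)
      have "some_rep (g u) - b \<in> E_zero u" using E_tree_mem(2)[OF gu some_rep_mem[OF gu] b] .
      then have bz: "b \<in> E_zero u" using subspace_diff[OF subspace_E_zero z] by fastforce
      have "coset (E_zero u) b = E_zero u"
      proof (intro equalityI subsetI)
        fix x assume "x \<in> E_zero u"
        then have "x - b \<in> E_zero u" using bz subspace_diff[OF subspace_E_zero] by blast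
        then show "x \<in> coset (E_zero u) b" unfolding coset_def by (intro image_eqI[of _ _ "x - b"]) auto
      qed (use bz subspace_add[OF subspace_E_zero] in \<open>auto simp: coset_def\<close>)
      then show ?thesis using b by simp
    qed
    then have "g = E_zero" by blast
    then show False using g by (simp add: group_like_def)
  qed
  ultimately show ?thesis by blast
qed

section \<open>The exact expansion by the number of root children\<close>

definition tree_sum :: "(tree \<Rightarrow> 'a set) \<Rightarrow> ('f \<Rightarrow> 'g::banach) \<Rightarrow> nat \<Rightarrow> nat \<Rightarrow> 'g" where
  "tree_sum g f n k = (\<Sum>t | deg t = n \<and> nchild t = k. Psi_tree V f y t (some_rep (g t)))"

text \<open>For \<open>i \<ge> 1\<close> the part of degree \<open>i\<close> of the predicted
  increment of the path. For \<open>i = 0\<close> and group-like \<open>g\<close> the same formula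
  gives \<open>y\<close> itself.\<close>

definition increment :: "(tree \<Rightarrow> 'a set) \<Rightarrow> nat \<Rightarrow> 'f" where
  "increment g i = (\<Sum>u | deg u = i. Psi_tree V id y u (some_rep (g u)))"

lemma Psi_id_zero:
  assumes ext: "\<exists>\<Phi>. Psi_extension V id y u \<Phi>" and u: "nchild u \<ge> 2" and a: "a \<in> ctensor_power (deg u)"
  shows "Psi_tree V id y u a = 0"
proof -
  have "length (map D (sorted_list_of_set (root_children u))) \<ge> 2" for D :: "nat \<Rightarrow> 'f"
    using u by (simp add: nchild_def)
  then have "Psi_elem V id y u vs = 0" for vs
    unfolding Psi_elem_def by (simp add: hderiv_id)
  then have "Psi_extension V id y u (\<lambda>_. 0)"
    by (simp add: Psi_extension_def linear_zero)
  from Psi_extension_unique[OF Psi_tree[OF ext] this a] show ?thesis .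
qed

lemma increment_planted:
  assumes g: "g \<in> Tr" and i: "i \<ge> 1" and ext: "\<And>u. deg u = i \<Longrightarrow> \<exists>\<Phi>. Psi_extension V id y u \<Phi>"
  shows "increment g i = (\<Sum>u | deg u = i \<and> nchild u = 1. Psi_tree V id y u (some_rep (g u)))"
  unfolding increment_def
proof (rule sum.mono_neutral_right)
  show "\<forall>u\<in>{u. deg u = i} - {u. deg u = i \<and> nchild u = 1}. Psi_tree V id y u (some_rep (g u)) = 0"
  proof
    fix u assume u: "u \<in> {u. deg u = i} - {u. deg u = i \<and> nchild u = 1}"
    then have "nchild u \<noteq> 0" using i nchild_0_iff[of u] by auto
    with u have "nchild u \<ge> 2" by auto
    with u show "Psi_tree V id y u (some_rep (g u)) = 0"
      using Psi_id_zero[OF ext] some_rep_ctensor[OF g] by blast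
  qed
qed (auto simp: finite_trees)

text \<open>Double counting of the pairs of a tree \<open>t\<close> and a single child of its root:
  the left side groups them by the two parts of the splitting, the right side by
  \<open>t\<close>.\<close>

lemma sum_splittings:
  fixes h :: "tree \<Rightarrow> 'g::real_vector"
  shows "(\<Sum>(u, w) | deg u + deg w = n \<and> nchild u = 1 \<and> nchild w = k. \<Sum>t | deg t = n. \<Sum>I\<in>splittings t u w. h t)
    = (\<Sum>t | deg t = n \<and> nchild t = Suc k. real (Suc k) *\<^sub>R h t)"
proof -
  let ?S = "{(u, w). deg u + deg w = n \<and> nchild u = 1 \<and> nchild w = k}"
  let ?C = "\<lambda>t. root_children t"
  let ?b = "\<lambda>t I. (tree_of (branches (rep_tree t) I), tree_of (branches (rep_tree t) (?C t - I)))"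
  have finS: "finite ?S"
  proof (rule finite_subset)
    show "?S \<subseteq> (\<Union>i\<le>n. {t. deg t = i}) \<times> (\<Union>i\<le>n. {t. deg t = i})" by auto
  qed (simp add: finite_trees)
  have C: "finite (?C t)" for t by (rule finite_children[OF tree_order_rep])
  have "(\<Sum>z\<in>?S. \<Sum>I | I \<subseteq> ?C t \<and> ?b t I = z. h t) = (if nchild t = Suc k then real (Suc k) *\<^sub>R h t else 0)"
    if t: "deg t = n" for t
  proof -
    have mem: "?b t I \<in> ?S \<longleftrightarrow> card I = 1 \<and> card (?C t - I) = k" if I: "I \<subseteq> ?C t" for I
    proof -
      have J: "?C t - I \<subseteq> ?C t" by blast
      note b = branches[OF tree_order_rep I] and b' = branches[OF tree_order_rep J]
      have "deg (tree_of (branches (rep_tree t) I)) + deg (tree_of (branches (rep_tree t) (?C t - I))) = n"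
        using split_slot_bij(2)[OF tree_order_rep I] t deg_tree_of[OF b(1)] deg_tree_of[OF b'(1)]
        by (simp add: deg_def)
      then show ?thesis
        using nchild_tree_of[OF b(1)] nchild_tree_of[OF b'(1)] b(2,5) b'(2,5) by simp
    qed
    have "(\<Sum>z\<in>?S. \<Sum>I | I \<subseteq> ?C t \<and> ?b t I = z. h t) = (\<Sum>z\<in>?S. \<Sum>I \<in> {I \<in> {I. I \<subseteq> ?C t \<and> ?b t I \<in> ?S}. ?b t I = z}. h t)"
      by (intro sum.cong) auto
    also have "\<dots> = (\<Sum>I | I \<subseteq> ?C t \<and> ?b t I \<in> ?S. h t)"
      using C[of t] by (intro sum.group finS) auto
    also have "{I. I \<subseteq> ?C t \<and> ?b t I \<in> ?S} = {I. I \<subseteq> ?C t \<and> card I = 1 \<and> card (?C t - I) = k}"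
      using mem by blast
    also have "(\<Sum>I\<in>\<dots>. h t) = real (card {I. I \<subseteq> ?C t \<and> card I = 1 \<and> card (?C t - I) = k}) *\<^sub>R h t"
      by (simp add: sum_constant_scaleR)
    finally show ?thesis
      unfolding count_splittings[OF C] by (simp add: nchild_def)
  qed
  then have "(\<Sum>t | deg t = n. \<Sum>z\<in>?S. \<Sum>I | I \<subseteq> ?C t \<and> ?b t I = z. h t)
      = (\<Sum>t | deg t = n. if nchild t = Suc k then real (Suc k) *\<^sub>R h t else 0)"
    by (intro sum.cong) auto
  also have "\<dots> = (\<Sum>t | deg t = n \<and> nchild t = Suc k. real (Suc k) *\<^sub>R h t)"
    using finite_trees[of n] by (simp add: sum.If_cases Int_def)
  finally show ?thesis
    by (subst (asm) sum.swap) (simp add: case_prod_unfold prod_eq_iff splittings_def)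
qed

text \<open>Both \<open>f\<close> and \<open>n\<close> are general in the induction, because one
  step passes to \<open>hderiv f [v u]\<close> and to the degree \<open>n - deg u\<close>. The
  factor \<open>k + 1\<close> that turns \<open>fact k\<close> into \<open>fact (Suc k)\<close> is
  the number of splittings of each tree.\<close>

lemma tree_sum_expansion:
  fixes f :: "'f \<Rightarrow> 'g::banach"
  assumes g: "group_like g" and f: "smooth f"
    and extid: "\<And>u. deg u \<le> n \<Longrightarrow> \<exists>\<Phi>. Psi_extension V id y u \<Phi>"
    and ext: "\<And>t. deg t = n \<Longrightarrow> \<exists>\<Phi>. Psi_extension V f y t \<Phi>"
  shows "fact k *\<^sub>R tree_sum g f n k = degree_part (increment g) k (\<lambda>hs. hderiv f hs y) n"
  using f extid ext
proof (induction k arbitrary: f n)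
  case 0
  show ?case
  proof (cases "n = 0")
    case True
    obtain e where e: "deg e = 0" using deg_0_ex by blast
    have "{t. deg t = n \<and> nchild t = 0} = {e}"
      using True e by (auto simp: nchild_0_iff intro: deg_0_unique)
    \<comment> \<open>The normalisation of \<open>g\<close> enters here: its component on the
      trivial tree is the empty tensor.\<close>
    then have "tree_sum g f n 0 = Psi_tree V f y e (tensor \<iota> [])"
      by (simp add: tree_sum_def group_like_unit[OF g e] tensor_def)
    also have "\<dots> = Psi_elem V f y e []"
      using Psi_tree[OF 0(3)[of e]] True e by (simp add: Psi_extension_def)
    also have "root_children e = {}"
      using nchild_0_iff[of e] e finite_children[OF tree_order_rep] by (simp add: nchild_def)
    then have "Psi_elem V f y e [] = f y" by (simp add: Psi_elem_def)
    finally show ?thesis using True by simp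
  next
    case False
    then have empty: "{t. deg t = n \<and> nchild t = 0} = {}" using nchild_0_iff by auto
    have "tree_sum g f n 0 = 0" unfolding tree_sum_def empty by simp
    then show ?thesis using False by simp
  qed
next
  case (Suc k)
  have gT: "g \<in> Tr" using g by (simp add: group_like_def)
  note f = Suc(2) and extid = Suc(3) and ext = Suc(4)
  define v where "v u = Psi_tree V id y u (some_rep (g u))" for u
  let ?F = "\<lambda>u. hderiv f [v u]"
  have step1: "\<exists>\<Phi>. Psi_extension V (?F u) y w \<Phi>"
    and step2: "Psi_tree V (?F u) y w (some_rep (g w))
      = (\<Sum>t | deg t = n. \<Sum>I\<in>splittings t u w. Psi_tree V f y t (some_rep (g t)))"
    if u: "nchild u = 1" and n: "deg u + deg w = n" for u w
    using coproduct_step[OF g f u, of w, folded v_def] ext extid[of u] n by auto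
  have "fact (Suc k) *\<^sub>R tree_sum g f n (Suc k)
      = fact k *\<^sub>R (\<Sum>t | deg t = n \<and> nchild t = Suc k. real (Suc k) *\<^sub>R Psi_tree V f y t (some_rep (g t)))"
    by (simp add: tree_sum_def scaleR_sum_right mult.commute)
  also have "\<dots> = fact k *\<^sub>R (\<Sum>(u, w) | deg u + deg w = n \<and> nchild u = 1 \<and> nchild w = k. Psi_tree V (?F u) y w (some_rep (g w)))"
    unfolding sum_splittings[symmetric] using step2 by (intro arg_cong[of _ _ "(*\<^sub>R) (fact k)"] sum.cong) auto
  \<comment> \<open>The planted trees are sorted by degree; \<open>i\<close> starts at 1 since the
    root child already counts for the degree.\<close>
  also have "(\<Sum>(u, w) | deg u + deg w = n \<and> nchild u = 1 \<and> nchild w = k. Psi_tree V (?F u) y w (some_rep (g w)))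
      = (\<Sum>i=1..n. \<Sum>u | deg u = i \<and> nchild u = 1. tree_sum g (?F u) (n - i) k)"
  proof -
    have fin: "finite {u. deg u = i \<and> nchild u = j}" for i j
      by (rule finite_subset[OF _ finite_trees[of i]]) auto
    have "(\<Sum>i=1..n. \<Sum>u | deg u = i \<and> nchild u = 1. tree_sum g (?F u) (n - i) k)
      = (\<Sum>(i, u, w)\<in>(SIGMA i:{1..n}. SIGMA u:{u. deg u = i \<and> nchild u = 1}. {w. deg w = n - i \<and> nchild w = k}).
          Psi_tree V (?F u) y w (some_rep (g w)))"
      unfolding tree_sum_def using fin by (simp add: sum.Sigma)
    also have "\<dots> = (\<Sum>(u, w) | deg u + deg w = n \<and> nchild u = 1 \<and> nchild w = k. Psi_tree V (?F u) y w (some_rep (g w)))"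
    proof (rule sum.reindex_bij_witness[where i = "\<lambda>(u, w). (deg u, u, w)" and j = snd])
      have "deg u \<ge> 1" if "nchild u = 1" for u using nchild_le_deg[of u] that by simp
      then show "(case z of (u, w) \<Rightarrow> (deg u, u, w)) \<in> (SIGMA i:{1..n}. SIGMA u:{u. deg u = i \<and> nchild u = 1}. {w. deg w = n - i \<and> nchild w = k})"
        if "z \<in> {(u, w). deg u + deg w = n \<and> nchild u = 1 \<and> nchild w = k}" for z
        using that by auto
    qed auto
    finally show ?thesis ..
  qed
  also have "fact k *\<^sub>R \<dots> = (\<Sum>i=1..n. \<Sum>u | deg u = i \<and> nchild u = 1.
      degree_part (increment g) k (\<lambda>hs. hderiv f (hs @ [v u]) y) (n - i))"
    unfolding scaleR_sum_right
  proof (intro sum.cong refl)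
    fix i u assume i: "i \<in> {1..n}" and u: "u \<in> {u. deg u = i \<and> nchild u = 1}"
    have "fact k *\<^sub>R tree_sum g (?F u) (n - i) k = degree_part (increment g) k (\<lambda>hs. hderiv (?F u) hs y) (n - i)"
    proof (rule Suc.IH[OF smooth_hderiv[OF f]])
      \<comment> \<open>No assumption covers \<open>?F u\<close>; its extensions on trees of degree
        \<open>n - i\<close> come from those for \<open>f\<close> in degree
        \<open>n\<close>.\<close>
      show "\<exists>\<Phi>. Psi_extension V (?F u) y w \<Phi>" if "deg w = n - i" for w
        using step1[of u w] u i that by simp
    qed (use extid in auto)
    then show "fact k *\<^sub>R tree_sum g (?F u) (n - i) k = degree_part (increment g) k (\<lambda>hs. hderiv f (hs @ [v u]) y) (n - i)"
      by (simp add: hderiv_append)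
  qed
  \<comment> \<open>Linearity in the last argument gathers the planted trees of degree
    \<open>i\<close> into \<open>increment g i\<close>.\<close>
  also have "\<dots> = (\<Sum>i=1..n. degree_part (increment g) k (\<lambda>hs. hderiv f (hs @ [increment g i]) y) (n - i))"
  proof (intro sum.cong refl)
    fix i assume i: "i \<in> {1..n}"
    have "\<exists>\<Phi>. Psi_extension V id y u \<Phi>" if "deg u = i" for u
      by (rule extid) (use that i in simp)
    then have inc: "increment g i = (\<Sum>u | deg u = i \<and> nchild u = 1. v u)"
      unfolding v_def using i by (intro increment_planted[OF gT]) simp_all
    show "(\<Sum>u | deg u = i \<and> nchild u = 1. degree_part (increment g) k (\<lambda>hs. hderiv f (hs @ [v u]) y) (n - i))
      = degree_part (increment g) k (\<lambda>hs. hderiv f (hs @ [increment g i]) y) (n - i)"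
      unfolding inc hderiv_sum[OF f, of _ _ _ "[]"] degree_part_sum ..
  qed
  finally show ?case by simp
qed

end

section \<open>Estimates\<close>

text \<open>The copies of \<open>a\<close> are replaced by \<open>b\<close> from the right, one at a
  time. Since \<open>B \<ge> 1\<close>, the powers that occur may be raised to a common one.\<close>

lemma multilinear_replicate_diff:
  fixes L :: "'f::real_normed_vector list \<Rightarrow> 'g::real_normed_vector"
  assumes "\<And>us ws. linear (\<lambda>v. L (us @ v # ws))"
    and "\<And>hs. length hs = k \<Longrightarrow> norm (L hs) \<le> M * norms hs"
    and "M \<ge> 0" "B \<ge> 1" "norm a \<le> B" "norm b \<le> B"
  shows "norm (L (replicate k a) - L (replicate k b)) \<le> M * k * B ^ k * norm (a - b)"
  using assms(1-3)
proof (induction k arbitrary: L M)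
  case (Suc k)
  note lin = Suc(2) and bound = Suc(3) and M = Suc(4)
  let ?Lb = "\<lambda>hs. L (hs @ [b])"
  have rep: "replicate (Suc k) z = replicate k z @ [z]" for z :: 'f by (simp add: replicate_append_same)
  have 1: "norm (L (replicate k a @ [a - b])) \<le> M * B ^ Suc k * norm (a - b)"
  proof -
    have "norm (L (replicate k a @ [a - b])) \<le> M * (norm a ^ k * norm (a - b))"
      using bound[of "replicate k a @ [a - b]"] by (simp add: prod_list_norm_replicate del: map_replicate)
    also have "\<dots> \<le> M * (B ^ Suc k * norm (a - b))"
    proof (intro mult_left_mono mult_right_mono M norm_ge_zero)
      have "norm a ^ k \<le> B ^ k" using assms(5) by (intro power_mono) auto
      also have "\<dots> \<le> B ^ Suc k" using assms(4) by (intro power_increasing) auto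
      finally show "norm a ^ k \<le> B ^ Suc k" .
    qed
    finally show ?thesis by (simp add: mult.assoc)
  qed
  have 2: "norm (?Lb (replicate k a) - ?Lb (replicate k b)) \<le> M * norm b * k * B ^ k * norm (a - b)"
  proof (rule Suc.IH)
    show "linear (\<lambda>v. ?Lb (us @ v # ws))" for us ws using lin[of us "ws @ [b]"] by simp
    show "norm (?Lb hs) \<le> M * norm b * norms hs" if "length hs = k" for hs
      using bound[of "hs @ [b]"] that by (simp add: mult_ac)
  qed (use M in simp)
  have "M * norm b * k * B ^ k * norm (a - b) \<le> M * B * k * B ^ k * norm (a - b)"
    using assms(4,6) M by (intro mult_right_mono mult_left_mono) auto
  moreover have "L (replicate (Suc k) a) - L (replicate (Suc k) b)
      = L (replicate k a @ [a - b]) + (?Lb (replicate k a) - ?Lb (replicate k b))"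
    unfolding rep using linear_diff[OF lin[of "replicate k a" "[]"], of a b] by simp
  then have "norm (L (replicate (Suc k) a) - L (replicate (Suc k) b))
      \<le> M * B ^ Suc k * norm (a - b) + M * norm b * k * B ^ k * norm (a - b)"
    using norm_triangle_le[OF add_mono[OF 1 2]] by simp
  ultimately show ?case by (simp add: algebra_simps)
qed simp

text \<open>The two summands are the two sources of error in \<open>degree_part_estimate\<close>:
  the induction hypothesis for the other arguments, and the terms in which one argument alone
  exceeds the degree. At \<open>k = 0\<close> nothing is discarded.\<close>

primrec estimate_const :: "real \<Rightarrow> nat \<Rightarrow> nat \<Rightarrow> real" where
  "estimate_const A N 0 = 0"
| "estimate_const A N (Suc k) = N * A * estimate_const A N k + N * A * (N * A) ^ k"

lemma estimate_const_nonneg: "A \<ge> 0 \<Longrightarrow> estimate_const A N k \<ge> 0"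
  by (induction k) auto

lemma norm_sum_powers:
  fixes P :: "nat \<Rightarrow> 'f::real_normed_vector"
  assumes "\<And>i. i \<in> {1..N} \<Longrightarrow> norm (P i) \<le> A * q ^ i" "0 \<le> q" "q \<le> 1" "A \<ge> 0"
  shows "norm (\<Sum>i=1..N. P i) \<le> N * A"
proof -
  have "norm (P i) \<le> A" if "i \<in> {1..N}" for i
    using assms(1)[OF that] mult_left_mono[OF power_le_one[OF assms(2,3), of i] assms(4)] by simp
  then have "(\<Sum>i=1..N. norm (P i)) \<le> (\<Sum>i=1..N. A)" by (intro sum_mono)
  then show ?thesis using norm_sum[of P "{1..N}"] by simp
qed

text \<open>The last argument is expanded into the \<open>P i\<close>. For \<open>i \<le> m\<close>
  the other arguments may still use the degree \<open>m - i\<close>, which is why \<open>m\<close>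
  varies in the induction; for \<open>i > m\<close> the bound on \<open>P i\<close> alone gives
  \<open>q ^ Suc m\<close>.\<close>

lemma degree_part_estimate:
  fixes L :: "'f::real_normed_vector list \<Rightarrow> 'g::real_normed_vector"
  assumes "\<And>us ws. linear (\<lambda>v. L (us @ v # ws))"
    and "\<And>hs. length hs = k \<Longrightarrow> norm (L hs) \<le> M * norms hs"
    and "M \<ge> 0" "m \<le> N"
    and A: "A \<ge> 0" and q: "0 \<le> q" "q \<le> 1" and P: "\<And>i. i \<in> {1..N} \<Longrightarrow> norm (P i) \<le> A * q ^ i"
  shows "norm (L (replicate k (\<Sum>i=1..N. P i)) - (\<Sum>n\<le>m. degree_part P k L n)) \<le> M * estimate_const A N k * q ^ Suc m"
  using assms(1-4)
proof (induction k arbitrary: L M m)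
  case 0
  then show ?case by simp
next
  case (Suc k)
  note lin = Suc(2) and bound = Suc(3) and M = Suc(4) and m = Suc(5)
  define S where "S = (\<Sum>i=1..N. P i)"
  define L' where "L' i = (\<lambda>hs. L (hs @ [P i]))" for i
  have linL': "linear (\<lambda>v. L' i (us @ v # ws))" for i us ws
    using lin[of us "ws @ [P i]"] by (simp add: L'_def)
  have boundL': "norm (L' i hs) \<le> M * norm (P i) * norms hs" if "length hs = k" for i hs
    using bound[of "hs @ [P i]"] that by (simp add: L'_def mult_ac)
  have MP: "M * norm (P i) \<le> M * A * q ^ i" if "i \<in> {1..N}" for i
    using mult_left_mono[OF P[OF that] M] by (simp add: mult.assoc)
  have S: "norm S \<le> N * A" unfolding S_def by (rule norm_sum_powers[OF P q A])
  have "L (replicate (Suc k) S) = L (replicate k S @ [S])" by (simp add: replicate_append_same)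
  also have "\<dots> = (\<Sum>i=1..N. L' i (replicate k S))"
    unfolding L'_def using linear_sum[OF lin[of "replicate k S" "[]"], of P "{1..N}"] by (simp add: S_def)
  also have "{1..N} = {1..m} \<union> {Suc m..N}" using m by auto
  also have "(\<Sum>i\<in>\<dots>. L' i (replicate k S)) = (\<Sum>i=1..m. L' i (replicate k S)) + (\<Sum>i=Suc m..N. L' i (replicate k S))"
    by (rule sum.union_disjoint) auto
  finally have 1: "L (replicate (Suc k) S) = (\<Sum>i=1..m. L' i (replicate k S)) + (\<Sum>i=Suc m..N. L' i (replicate k S))" .
  have "(\<Sum>n\<le>m. degree_part P (Suc k) L n) = (\<Sum>n\<le>m. \<Sum>i=1..n. degree_part P k (L' i) (n - i))"
    by (simp add: L'_def)
  also have "\<dots> = (\<Sum>(n, i) \<in> (SIGMA n:{..m}. {1..n}). degree_part P k (L' i) (n - i))"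
    by (simp add: sum.Sigma)
  \<comment> \<open>The new \<open>n\<close> is the degree left to the other arguments.\<close>
  also have "\<dots> = (\<Sum>(i, n) \<in> (SIGMA i:{1..m}. {..m - i}). degree_part P k (L' i) n)"
    by (rule sum.reindex_bij_witness[where i = "\<lambda>(i, n). (n + i, i)" and j = "\<lambda>(n, i). (i, n - i)"]) auto
  also have "\<dots> = (\<Sum>i=1..m. \<Sum>n\<le>m - i. degree_part P k (L' i) n)"
    by (simp add: sum.Sigma)
  finally have 2: "(\<Sum>n\<le>m. degree_part P (Suc k) L n) = (\<Sum>i=1..m. \<Sum>n\<le>m - i. degree_part P k (L' i) n)" .
  have diff: "L (replicate (Suc k) S) - (\<Sum>n\<le>m. degree_part P (Suc k) L n)
      = (\<Sum>i=1..m. L' i (replicate k S) - (\<Sum>n\<le>m - i. degree_part P k (L' i) n)) + (\<Sum>i=Suc m..N. L' i (replicate k S))"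
    unfolding 1 2 by (simp add: sum_subtractf)
  let ?E = "estimate_const A N k"
  have E: "?E \<ge> 0" by (rule estimate_const_nonneg[OF A])
  have "norm (\<Sum>i=1..m. L' i (replicate k S) - (\<Sum>n\<le>m - i. degree_part P k (L' i) n)) \<le> (\<Sum>i=1..m. M * A * ?E * q ^ Suc m)"
  proof (rule sum_norm_le)
    fix i assume i: "i \<in> {1..m}"
    then have iN: "i \<in> {1..N}" using m by auto
    have "norm (L' i (replicate k S) - (\<Sum>n\<le>m - i. degree_part P k (L' i) n)) \<le> M * norm (P i) * ?E * q ^ Suc (m - i)"
      unfolding S_def by (rule Suc.IH[OF linL' boundL']) (use M m in auto)
    also have "\<dots> \<le> M * A * q ^ i * ?E * q ^ Suc (m - i)"
      using MP[OF iN] E q by (intro mult_right_mono) auto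
    also have "\<dots> = M * A * ?E * (q ^ i * q ^ Suc (m - i))" by (simp add: mult_ac)
    also have "q ^ i * q ^ Suc (m - i) = q ^ Suc m"
      using i by (simp add: power_add[symmetric] del: power_Suc)
    finally show "norm (L' i (replicate k S) - (\<Sum>n\<le>m - i. degree_part P k (L' i) n)) \<le> M * A * ?E * q ^ Suc m" .
  qed
  also have "\<dots> = m * (M * A * ?E * q ^ Suc m)" by simp
  also have "\<dots> \<le> N * (M * A * ?E * q ^ Suc m)"
    using m M A E q by (intro mult_right_mono) auto
  finally have a: "norm (\<Sum>i=1..m. L' i (replicate k S) - (\<Sum>n\<le>m - i. degree_part P k (L' i) n)) \<le> N * (M * A * ?E * q ^ Suc m)" .
  have "norm (\<Sum>i=Suc m..N. L' i (replicate k S)) \<le> (\<Sum>i=Suc m..N. M * A * q ^ Suc m * (N * A) ^ k)"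
  proof (rule sum_norm_le)
    fix i assume i: "i \<in> {Suc m..N}"
    then have iN: "i \<in> {1..N}" by auto
    have "norm (L' i (replicate k S)) \<le> M * norm (P i) * norm S ^ k"
      using boundL'[of "replicate k S" i] by (simp only: prod_list_norm_replicate length_replicate)
    also have "\<dots> \<le> M * A * q ^ Suc m * (N * A) ^ k"
    proof (rule mult_mono[OF _ power_mono[OF S norm_ge_zero]])
      have "q ^ i \<le> q ^ Suc m" using i q by (intro power_decreasing) auto
      then have "M * A * q ^ i \<le> M * A * q ^ Suc m" using M A by (intro mult_left_mono) auto
      with MP[OF iN] show "M * norm (P i) \<le> M * A * q ^ Suc m" by linarith
    qed (use M A q in auto)
    finally show "norm (L' i (replicate k S)) \<le> M * A * q ^ Suc m * (N * A) ^ k" .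
  qed
  also have "\<dots> = (N - m) * (M * A * q ^ Suc m * (N * A) ^ k)" by simp
  also have "\<dots> \<le> N * (M * A * q ^ Suc m * (N * A) ^ k)"
    using m M A q by (intro mult_right_mono) auto
  finally have b: "norm (\<Sum>i=Suc m..N. L' i (replicate k S)) \<le> N * (M * A * q ^ Suc m * (N * A) ^ k)" .
  have "norm (L (replicate (Suc k) S) - (\<Sum>n\<le>m. degree_part P (Suc k) L n))
      \<le> N * (M * A * ?E * q ^ Suc m) + N * (M * A * q ^ Suc m * (N * A) ^ k)"
    unfolding diff by (rule norm_triangle_le[OF add_mono[OF a b]])
  also have "\<dots> = M * estimate_const A N (Suc k) * q ^ Suc m"
    by (simp add: algebra_simps)
  finally show ?case by (simp only: S_def)
qed

text \<open>In the application \<open>q\<close> is the \<open>p\<close>-th root of \<omega>, or 1.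
  The constant has to serve all pairs of times at once, so it is chosen before \<open>y\<close>,
  \<open>D\<close>, \<open>P\<close> and \<open>q\<close>; compactness of \<open>K\<close> makes
  this possible.\<close>

lemma smooth_increment_estimate:
  fixes f :: "'f::real_normed_vector \<Rightarrow> 'g::banach"
  assumes f: "smooth f" and K: "compact K" and A: "A \<ge> 0"
  shows "\<exists>C\<ge>0. \<forall>y D P q. (\<forall>s\<in>{0..1}. y + s *\<^sub>R D \<in> K) \<longrightarrow> 0 \<le> q \<longrightarrow> q \<le> 1 \<longrightarrow>
    (\<forall>i\<in>{1..N}. norm (P i) \<le> A * q ^ i) \<longrightarrow> norm D \<le> A * q \<longrightarrow>
    norm (f (y + D) - degree_expansion N P f y)
      \<le> C * (norm (D - (\<Sum>i=1..N. P i)) + q ^ Suc N)"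
proof -
  have "\<exists>C\<ge>0. \<forall>z\<in>K. \<forall>hs. length hs = k \<longrightarrow> norm (hderiv f hs z) \<le> C * norms hs" for k
    using hderiv_compact_bound[OF f K, of k] by metis
  then obtain Mk where Mk: "\<And>k. Mk k \<ge> 0"
    "\<And>k z hs. z \<in> K \<Longrightarrow> length hs = k \<Longrightarrow> norm (hderiv f hs z) \<le> Mk k * norms hs"
    by metis
  define M where "M = (\<Sum>k\<le>Suc N. Mk k)"
  have M0: "M \<ge> 0" unfolding M_def using Mk(1) by (simp add: sum_nonneg)
  have M: "norm (hderiv f hs z) \<le> M * norms hs" if "z \<in> K" "length hs = k" "k \<le> Suc N" for z hs k
  proof -
    have "Mk k \<le> M" unfolding M_def using Mk(1) that(3) by (intro member_le_sum) auto
    then show ?thesis using Mk(2)[OF that(1,2)] mult_right_mono[OF _ prod_list_norm_nonneg] by (meson order_trans)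
  qed
  \<comment> \<open>Large enough for \<open>D\<close>, for the sum of the \<open>P i\<close>, and
    for the requirement \<open>B \<ge> 1\<close> of
    \<open>multilinear_replicate_diff\<close>.\<close>
  define B where "B = A + N * A + 1"
  have B: "B \<ge> 1" "A \<le> B" "N * A \<le> B" using A by (auto simp: B_def)
  let ?c = "\<lambda>k. M * k * B ^ k + M * estimate_const A N k"
  \<comment> \<open>Three errors: the Taylor remainder, the replacement of \<open>D\<close> by the
    sum of the \<open>P i\<close> in each derivative, and the truncation by total degree. The
    factors \<open>1 / fact k\<close> are bounded by 1.\<close>
  define C where "C = M * A ^ Suc N + (\<Sum>k\<le>N. ?c k)"
  have c0: "?c k \<ge> 0" for k using M0 B estimate_const_nonneg[OF A] by auto
  show ?thesis
  proof (intro exI[of _ C] conjI allI impI)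
    have "(\<Sum>k\<le>N. ?c k) \<ge> 0" by (rule sum_nonneg) (rule c0)
    then show "C \<ge> 0" unfolding C_def using M0 A by (intro add_nonneg_nonneg) auto
    fix y D :: 'f and P :: "nat \<Rightarrow> 'f" and q :: real
    assume "\<forall>s\<in>{0..1}. y + s *\<^sub>R D \<in> K" and q: "0 \<le> q" "q \<le> 1"
      and "\<forall>i\<in>{1..N}. norm (P i) \<le> A * q ^ i" and D: "norm D \<le> A * q"
    then have seg: "\<And>s. s \<in> {0..1} \<Longrightarrow> y + s *\<^sub>R D \<in> K"
      and P: "\<And>i. i \<in> {1..N} \<Longrightarrow> norm (P i) \<le> A * q ^ i" by blast+
    define S where "S = (\<Sum>i=1..N. P i)"
    define R where "R = norm (D - S) + q ^ Suc N"
    have R: "norm (D - S) \<le> R" "q ^ Suc N \<le> R" using q by (auto simp: R_def)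
    let ?L = "\<lambda>hs. hderiv f hs y"
    have yK: "y \<in> K" using seg[of 0] by simp
    have SB: "norm S \<le> B" using norm_sum_powers[of N P A q, OF P q A] B by (simp add: S_def)
    have DB: "norm D \<le> B" using D B mult_left_mono[OF q(2) A] by simp
    have taylor: "norm (f (y + D) - (\<Sum>k\<le>N. (1 / fact k) *\<^sub>R ?L (replicate k D))) \<le> M * A ^ Suc N * R"
    proof -
      have "norm (f (y + D) - (\<Sum>k\<le>N. (1 / fact k) *\<^sub>R ?L (replicate k D))) \<le> M * norm D ^ Suc N"
        by (rule smooth_taylor[OF f]) (use M[OF seg] in auto)
      also have "\<dots> \<le> M * (A * q) ^ Suc N" using D M0 by (intro mult_left_mono power_mono) auto
      also have "\<dots> = M * A ^ Suc N * q ^ Suc N" by (simp add: power_mult_distrib mult_ac)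
      also have "\<dots> \<le> M * A ^ Suc N * R" using R M0 A by (intro mult_left_mono) auto
      finally show ?thesis .
    qed
    have summand: "norm (?L (replicate k D) - (\<Sum>n\<le>N. degree_part P k ?L n)) \<le> ?c k * R" if k: "k \<le> N" for k
    proof -
      have Mb: "\<And>hs. length hs = k \<Longrightarrow> norm (?L hs) \<le> M * norms hs"
        using M[OF yK] k by simp
      have "norm (?L (replicate k D) - ?L (replicate k S)) \<le> M * k * B ^ k * norm (D - S)"
        by (rule multilinear_replicate_diff[OF smooth_linear[OF f] Mb M0 B(1) DB SB])
      also have "\<dots> \<le> M * k * B ^ k * R" using R M0 B by (intro mult_left_mono) auto
      finally have 1: "norm (?L (replicate k D) - ?L (replicate k S)) \<le> M * k * B ^ k * R" .
      have "norm (?L (replicate k S) - (\<Sum>n\<le>N. degree_part P k ?L n)) \<le> M * estimate_const A N k * q ^ Suc N"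
        unfolding S_def by (rule degree_part_estimate[OF smooth_linear[OF f] Mb M0 order_refl A q P])
      also have "\<dots> \<le> M * estimate_const A N k * R"
        using R M0 estimate_const_nonneg[OF A] by (intro mult_left_mono) auto
      finally have 2: "norm (?L (replicate k S) - (\<Sum>n\<le>N. degree_part P k ?L n)) \<le> M * estimate_const A N k * R" .
      have "norm (?L (replicate k D) - (\<Sum>n\<le>N. degree_part P k ?L n))
          \<le> norm (?L (replicate k D) - ?L (replicate k S)) + norm (?L (replicate k S) - (\<Sum>n\<le>N. degree_part P k ?L n))"
        by norm
      with 1 2 show ?thesis by (simp add: algebra_simps)
    qed
    have "norm ((\<Sum>k\<le>N. (1 / fact k) *\<^sub>R ?L (replicate k D)) - degree_expansion N P f y) \<le> (\<Sum>k\<le>N. ?c k * R)"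
      unfolding degree_expansion_def sum_subtractf[symmetric] scaleR_diff_right[symmetric]
    proof (rule sum_norm_le)
      fix k assume "k \<in> {..N}"
      then have k: "k \<le> N" by simp
      have "(1::real) \<le> fact k" by simp
      then have "1 / fact k \<le> (1::real)" by simp
      then have "1 / fact k * norm (?L (replicate k D) - (\<Sum>n\<le>N. degree_part P k ?L n))
          \<le> 1 * norm (?L (replicate k D) - (\<Sum>n\<le>N. degree_part P k ?L n))"
        by (rule mult_right_mono) simp
      with summand[OF k]
      show "norm ((1 / fact k) *\<^sub>R (?L (replicate k D) - (\<Sum>n\<le>N. degree_part P k ?L n))) \<le> ?c k * R"
        by simp
    qed
    from norm_diff_triangle_le[OF taylor this] have "norm (f (y + D) - degree_expansion N P f y)
        \<le> M * A ^ Suc N * R + (\<Sum>k\<le>N. ?c k * R)"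
      .
    also have "\<dots> = C * R" by (simp add: C_def distrib_right sum_distrib_right)
    finally show "norm (f (y + D) - degree_expansion N P f y)
        \<le> C * (norm (D - (\<Sum>i=1..N. P i)) + q ^ Suc N)"
      by (simp only: R_def S_def)
  qed
qed

text \<open>The assumption on \<open>\<theta>\<close> says nothing about \<open>\<theta> 0\<close>, so where \<open>\<omega>\<close> vanishes only boundedness of \<open>e\<close> matters.\<close>

lemma little_o_majorant:
  fixes e \<omega> :: "'z \<Rightarrow> real"
  assumes \<omega>: "\<And>z. z \<in> S \<Longrightarrow> \<omega> z \<ge> 0" and e: "\<And>z. z \<in> S \<Longrightarrow> e z \<ge> 0" and bnd: "\<And>z. z \<in> S \<Longrightarrow> e z \<le> M"
    and small: "\<And>\<epsilon>. \<epsilon> > 0 \<Longrightarrow> \<exists>\<delta>>0. \<forall>z\<in>S. 0 < \<omega> z \<longrightarrow> \<omega> z < \<delta> \<longrightarrow> e z \<le> \<epsilon> * \<omega> z"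
  shows "\<exists>\<theta>. ((\<lambda>h. \<theta> h / h) \<longlongrightarrow> 0) (at 0) \<and> (\<forall>z\<in>S. e z \<le> \<theta> (\<omega> z))"
proof -
  let ?Z = "\<lambda>h. {z \<in> S. \<omega> z = h}"
  \<comment> \<open>The least majorant that depends on \<open>z\<close> through
    \<open>\<omega> z\<close> only; the default 0 is for values that \<omega> does not take.\<close>
  define \<theta> where "\<theta> h = (if ?Z h = {} then 0 else Sup (e ` ?Z h))" for h
  have bdd: "bdd_above (e ` ?Z h)" for h using bnd by (intro bdd_aboveI[of _ M]) auto
  have "e z \<le> \<theta> (\<omega> z)" if "z \<in> S" for z
    using that cSup_upper[OF _ bdd, of "e z" "\<omega> z"] by (auto simp: \<theta>_def)
  moreover have "((\<lambda>h. \<theta> h / h) \<longlongrightarrow> 0) (at 0)"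
  proof (rule LIM_I)
    fix \<epsilon> :: real assume "\<epsilon> > 0"
    then obtain \<delta> where \<delta>: "\<delta> > 0" "\<And>z. z \<in> S \<Longrightarrow> 0 < \<omega> z \<Longrightarrow> \<omega> z < \<delta> \<Longrightarrow> e z \<le> \<epsilon> / 2 * \<omega> z"
      using small[of "\<epsilon> / 2"] by auto
    have "norm (\<theta> h / h - 0) < \<epsilon>" if h: "h \<noteq> 0" "norm (h - 0) < \<delta>" for h
    proof (cases "?Z h = {}")
      case True
      then show ?thesis using \<open>\<epsilon> > 0\<close> by (simp add: \<theta>_def)
    next
      case False
      then obtain z where z: "z \<in> S" "\<omega> z = h" by blast
      \<comment> \<open>Negative \<open>h\<close> are not values of \<omega>, so the smallness
        assumption is called for on the right of 0 only.\<close>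
      then have hp: "h > 0" using \<omega> h by force
      have "Sup (e ` ?Z h) \<le> \<epsilon> / 2 * h"
      proof (rule cSup_least)
        fix x assume "x \<in> e ` ?Z h"
        then obtain z' where "z' \<in> S" "\<omega> z' = h" "x = e z'" by blast
        then show "x \<le> \<epsilon> / 2 * h" using \<delta>(2)[of z'] h hp by simp
      qed (use False in simp)
      then have "\<theta> h \<le> \<epsilon> / 2 * h" unfolding \<theta>_def using False by (simp only: if_False)
      moreover have "0 \<le> \<theta> h"
        using False order_trans[OF e[OF z(1)] cSup_upper[OF _ bdd, of "e z" h]] z by (auto simp: \<theta>_def)
      moreover have "\<epsilon> / 2 * h < \<epsilon> * h" using hp \<open>\<epsilon> > 0\<close> by simp
      ultimately show ?thesis using hp by (simp add: field_simps)
    qed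
    with \<delta>(1) show "\<exists>s>0. \<forall>x. x \<noteq> 0 \<and> norm (x - 0) < s \<longrightarrow> norm (\<theta> x / x - 0) < \<epsilon>" by blast
  qed
  ultimately show ?thesis by blast
qed

text \<open>Joint continuity at \<open>(s0, 0)\<close> bounds all operators with \<open>s\<close>
  near \<open>s0\<close> by 1 on one small ball, compactness leaves finitely many such balls, and
  homogeneity turns the common radius into a common operator bound.\<close>

lemma uniform_operator_bound:
  fixes F :: "real \<Rightarrow> 'a::real_normed_vector \<Rightarrow> 'b::real_normed_vector"
  assumes S: "compact S" and C: "subspace C" and F: "\<And>s. s \<in> S \<Longrightarrow> linear (F s)"
    and cont: "continuous_on (S \<times> C) (\<lambda>(s, a). F s a)"
  shows "\<exists>K>0. \<forall>s\<in>S. \<forall>a\<in>C. norm (F s a) \<le> K * norm a"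
proof -
  have "\<exists>d>0. \<forall>s\<in>S. \<forall>a\<in>C. dist s0 s < d \<longrightarrow> norm a < d \<longrightarrow> norm (F s a) < 1" if s0: "s0 \<in> S" for s0
  proof -
    have "(s0, 0) \<in> S \<times> C" using s0 subspace_0[OF C] by simp
    then obtain d where d: "d > 0"
      "\<And>z. z \<in> S \<times> C \<Longrightarrow> dist z (s0, 0) < d \<Longrightarrow> dist ((\<lambda>(s, a). F s a) z) (F s0 0) < 1"
      using cont unfolding continuous_on_iff by (metis (mono_tags, lifting) case_prod_conv zero_less_one)
    have "norm (F s a) < 1" if "s \<in> S" "a \<in> C" "dist s0 s < d / 2" "norm a < d / 2" for s a
    proof -
      have "dist (s, a) (s0, 0) \<le> dist s s0 + dist a 0"
        unfolding dist_Pair_Pair by (rule sqrt_sum_squares_le_sum) auto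
      also have "\<dots> < d" using that by (simp add: dist_commute)
      finally show ?thesis using d(2)[of "(s, a)"] that linear_0[OF F[OF s0]] by simp
    qed
    then show ?thesis using d(1) by (intro exI[of _ "d / 2"]) auto
  qed
  then obtain d where d: "\<And>s0. s0 \<in> S \<Longrightarrow> d s0 > 0"
    "\<And>s0 s a. s0 \<in> S \<Longrightarrow> s \<in> S \<Longrightarrow> a \<in> C \<Longrightarrow> dist s0 s < d s0 \<Longrightarrow> norm a < d s0 \<Longrightarrow> norm (F s a) < 1"
    by metis
  obtain Y where Y: "Y \<subseteq> S" "finite Y" "S \<subseteq> (\<Union>y\<in>Y. ball y (d y))"
  proof (rule compactE_image[OF S, of S "\<lambda>y. ball y (d y)"])
    show "S \<subseteq> (\<Union>y\<in>S. ball y (d y))" using d(1) by auto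
  qed auto
  define \<delta> where "\<delta> = Min (insert 1 (d ` Y))"
  have \<delta>: "\<delta> > 0" "\<And>y. y \<in> Y \<Longrightarrow> \<delta> \<le> d y"
    unfolding \<delta>_def using Y d(1) by (auto simp: Min_gr_iff)
  have small: "norm (F s a) < 1" if s: "s \<in> S" and a: "a \<in> C" "norm a < \<delta>" for s a
  proof -
    obtain y where y: "y \<in> Y" "dist y s < d y" using Y(3) s by auto
    then show ?thesis using d(2)[of y s a] Y(1) s a \<delta>(2)[OF y(1)] by auto
  qed
  have "norm (F s a) \<le> 2 / \<delta> * norm a" if s: "s \<in> S" and a: "a \<in> C" for s a
  proof (cases "a = 0")
    case True
    then show ?thesis using linear_0[OF F[OF s]] by simp
  next
    case False
    \<comment> \<open>Rescales \<open>a\<close> to the norm \<open>\<delta> / 2\<close>, inside the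
      common ball.\<close>
    define c where "c = \<delta> / (2 * norm a)"
    have c: "c > 0" using \<delta>(1) False by (simp add: c_def)
    have "norm (c *\<^sub>R a) < \<delta>" using \<delta>(1) False by (simp add: c_def)
    then have "norm (F s (c *\<^sub>R a)) < 1" using small[OF s subspace_scale[OF C a]] by blast
    then have "c * norm (F s a) < 1" using c by (simp add: linear_scale[OF F[OF s]])
    then show ?thesis using c False \<delta>(1) by (simp add: c_def field_simps)
  qed
  then show ?thesis using \<delta>(1) by (intro exI[of _ "2 / \<delta>"]) auto
qed

section \<open>The expansion of \<Psi> on truncated group-like elements\<close>

context smooth_fields
begin

lemma Psi_trunc: "Psi N V f y (trunc N g) = (\<Sum>n\<le>N. \<Sum>t | deg t = n. Psi_tree V f y t (some_rep (g t)))"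
proof -
  have "Psi N V f y (trunc N g) = (\<Sum>t | deg t \<le> N. Psi_tree V f y t (some_rep (g t)))"
    unfolding Psi_def by (intro sum.cong) (auto simp: trunc_def)
  also have "{t. deg t \<le> N} = (\<Union>n\<in>{..N}. {t. deg t = n})" by auto
  also have "(\<Sum>t\<in>\<dots>. Psi_tree V f y t (some_rep (g t))) = (\<Sum>n\<le>N. \<Sum>t | deg t = n. Psi_tree V f y t (some_rep (g t)))"
    by (rule sum.UNION_disjoint) (auto simp: finite_trees)
  finally show ?thesis .
qed

text \<open>Sorting the trees by the number of root children loses none, as this number is at most
  the degree; \<open>tree_sum_expansion\<close> then evaluates each class.\<close>

lemma Psi_expansion:
  fixes f :: "'f \<Rightarrow> 'g::banach"
  assumes g: "group_like g" and f: "smooth f"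
    and extid: "Psi_defined N V id y" and ext: "Psi_defined N V f y"
  shows "Psi N V f y (trunc N g)
    = degree_expansion N (increment g) f y"
proof -
  have "(\<Sum>t | deg t = n. Psi_tree V f y t (some_rep (g t))) = (\<Sum>k\<le>N. tree_sum g f n k)" if n: "n \<le> N" for n
  proof -
    have "(\<Sum>k\<le>N. tree_sum g f n k) = (\<Sum>k\<le>N. \<Sum>t \<in> {t \<in> {t. deg t = n}. nchild t = k}. Psi_tree V f y t (some_rep (g t)))"
      by (simp add: tree_sum_def)
    also have "\<dots> = (\<Sum>t | deg t = n. Psi_tree V f y t (some_rep (g t)))"
      using nchild_le_deg n by (intro sum.group finite_trees finite_atMost) (auto intro: order_trans)
    finally show ?thesis ..
  qed
  then have "Psi N V f y (trunc N g) = (\<Sum>n\<le>N. \<Sum>k\<le>N. tree_sum g f n k)"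
    unfolding Psi_trunc by (intro sum.cong) auto
  also have "\<dots> = (\<Sum>k\<le>N. \<Sum>n\<le>N. tree_sum g f n k)" by (rule sum.swap)
  also have "\<dots> = degree_expansion N (increment g) f y"
    unfolding degree_expansion_def scaleR_sum_right
  proof (intro sum.cong refl)
    fix k n assume "n \<in> {..N}"
    then have "fact k *\<^sub>R tree_sum g f n k = degree_part (increment g) k (\<lambda>hs. hderiv f hs y) n"
      using extid ext by (intro tree_sum_expansion[OF g f]) (auto simp: Psi_defined_def)
    then show "tree_sum g f n k = (1 / fact k) *\<^sub>R degree_part (increment g) k (\<lambda>hs. hderiv f hs y) n"
      by (simp flip: \<open>fact k *\<^sub>R tree_sum g f n k = _\<close>)
  qed
  finally show ?thesis .
qed

lemma Psi_id_expansion: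
  assumes g: "group_like g" and extid: "Psi_defined N V id y"
  shows "Psi N V id y (trunc N g) = y + (\<Sum>i=1..N. increment g i)"
proof -
  have "{t. deg t = 0} = {t. deg t = 0 \<and> nchild t = 0}" using nchild_0_iff by auto
  then have "increment g 0 = tree_sum g id 0 0" by (simp add: increment_def tree_sum_def)
  also have "\<dots> = y"
    using tree_sum_expansion[OF g smooth_id, of 0 0] extid by (simp add: Psi_defined_def)
  finally have "increment g 0 = y" .
  moreover have "Psi N V id y (trunc N g) = (\<Sum>n\<le>N. increment g n)"
    unfolding Psi_trunc increment_def ..
  moreover have "{..N} = insert 0 {1..N}" by auto
  ultimately show ?thesis by simp
qed

text \<open>The chosen representative may have a norm far above that of its coset. Since the value
  is the same on the whole coset, the bound can be taken at every element and the infimum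
  formed.\<close>

lemma Psi_tree_quot_norm:
  assumes f: "smooth f" and ext: "\<exists>\<Phi>. Psi_extension V f y t \<Phi>" and C: "C \<in> E_tree t"
    and K: "K > 0" "\<And>a. a \<in> ctensor_power (deg t) \<Longrightarrow> norm (Psi_tree V f y t a) \<le> K * norm a"
  shows "norm (Psi_tree V f y t (some_rep C)) \<le> K * quot_norm C"
proof -
  let ?\<Phi> = "Psi_tree V f y t"
  note \<Phi> = Psi_tree[OF ext]
  have lin: "linear ?\<Phi>" using \<Phi> by (simp add: Psi_extension_def)
  obtain b where b: "C = coset (E_zero t) b" using C by (auto simp: E_tree_def)
  have eq: "?\<Phi> c = ?\<Phi> b" if "c \<in> C" for c
    using Psi_extension_E_zero[OF f \<Phi> E_tree_mem(2)[OF C that b]] by (simp add: linear_diff[OF lin])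
  have r: "some_rep C \<in> C" by (rule some_rep_mem[OF C])
  have "norm (?\<Phi> (some_rep C)) / K \<le> quot_norm C"
    unfolding quot_norm_def
  proof (rule cINF_greatest)
    fix c assume c: "c \<in> C"
    have "norm (?\<Phi> (some_rep C)) \<le> K * norm c"
      using K(2)[OF E_tree_mem(1)[OF C c]] eq[OF c] eq[OF r] by simp
    then show "norm (?\<Phi> (some_rep C)) / K \<le> norm c" using K(1) by (simp add: field_simps)
  qed (use r in blast)
  then show ?thesis using K(1) by (simp add: field_simps)
qed

lemma norm_increment:
  assumes g: "group_like g" and i: "i \<le> N" and ext: "Psi_defined N V id y"
    and K: "K > 0" "\<And>t a. deg t = i \<Longrightarrow> a \<in> ctensor_power (deg t) \<Longrightarrow> norm (Psi_tree V id y t a) \<le> K * norm a"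
  shows "norm (increment g i) \<le> card {t. deg t = i} * (K * degree_norm i (trunc N g))"
proof -
  have "norm (increment g i) \<le> (\<Sum>t | deg t = i. K * degree_norm i (trunc N g))"
    unfolding increment_def
  proof (rule sum_norm_le)
    fix t assume "t \<in> {t. deg t = i}"
    then have t: "deg t = i" by simp
    have "norm (Psi_tree V id y t (some_rep (g t))) \<le> K * quot_norm (g t)"
      using g ext t i K by (intro Psi_tree_quot_norm smooth_id) (auto simp: Psi_defined_def group_like_def Tr_def)
    also have "quot_norm (g t) \<le> degree_norm i (trunc N g)"
      unfolding degree_norm_def using t i finite_trees[of i] by (intro Max_ge) (auto simp: trunc_def intro!: image_eqI[of _ _ t])
    finally show "norm (Psi_tree V id y t (some_rep (g t))) \<le> K * degree_norm i (trunc N g)"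
      using K(1) by simp
  qed
  then show ?thesis by simp
qed

end

section \<open>From the identity to all smooth functions\<close>

lemma compact_time_simplex: "compact (time_simplex T)"
proof -
  have eq: "time_simplex T = ({0..T} \<times> {0..T}) \<inter> {z. fst z \<le> snd z}"
    by (auto simp: time_simplex_def)
  show ?thesis
    unfolding eq by (intro compact_Int_closed compact_Times compact_Icc closed_Collect_le continuous_intros)
qed

lemma powr_eq_powers:
  assumes "w > 0"
  shows "w powr (real i / p) = (w powr (1 / p)) ^ i"
  using assms by (simp add: powr_realpow[symmetric] powr_powr)

context labelled_trees
begin

lemma Psi_id_uniform_bound:
  fixes V :: "'e \<Rightarrow> 'f::banach \<Rightarrow> 'f" and T :: real and y :: "real \<Rightarrow> 'f"
  assumes def: "\<And>s. s \<in> {0..T} \<Longrightarrow> Psi_defined N V id (y s)"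
    and cont: "\<And>\<tau>. deg \<tau> \<le> N \<Longrightarrow> continuous_on ({0..T} \<times> ctensor_power (deg \<tau>)) (\<lambda>(s, a). Psi_tree V id (y s) \<tau> a)"
  obtains K where "K > 0" "\<And>s t a. s \<in> {0..T} \<Longrightarrow> deg t \<le> N \<Longrightarrow> a \<in> ctensor_power (deg t) \<Longrightarrow>
    norm (Psi_tree V id (y s) t a) \<le> K * norm a"
proof -
  have "\<exists>K>0. \<forall>s\<in>{0..T}. \<forall>a\<in>ctensor_power (deg t). norm (Psi_tree V id (y s) t a) \<le> K * norm a" if t: "deg t \<le> N" for t
  proof (rule uniform_operator_bound[OF compact_Icc subspace_ctensor _ cont[OF t]])
    show "linear (Psi_tree V id (y s) t)" if "s \<in> {0..T}" for s
    proof -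
      have "\<exists>\<Phi>. Psi_extension V id (y s) t \<Phi>" using def[OF that] t by (simp only: Psi_defined_def)
      then have "Psi_extension V id (y s) t (Psi_tree V id (y s) t)"
        unfolding Psi_tree_def by (rule someI_ex[of "Psi_extension V id (y s) t"])
      then show ?thesis by (simp add: Psi_extension_def)
    qed
  qed
  then obtain k where k: "\<And>t. deg t \<le> N \<Longrightarrow> k t > 0" "\<And>s t a. deg t \<le> N \<Longrightarrow> s \<in> {0..T} \<Longrightarrow> a \<in> ctensor_power (deg t) \<Longrightarrow>
    norm (Psi_tree V id (y s) t a) \<le> k t * norm a"
    by metis
  let ?S = "{t. deg t \<le> N}"
  have "?S = (\<Union>n\<le>N. {t. deg t = n})" by auto
  then have fin: "finite ?S" by (simp add: finite_trees)
  define K where "K = 1 + sum k ?S"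
  have sum0: "sum k ?S \<ge> 0" using k(1) by (intro sum_nonneg) (auto intro: less_imp_le)
  have kK: "k t \<le> K" if "deg t \<le> N" for t
  proof -
    have "k t \<le> sum k ?S"
      by (rule member_le_sum[OF _ _ fin]) (use that k(1) in \<open>auto intro: less_imp_le\<close>)
    then show ?thesis by (simp add: K_def)
  qed
  show ?thesis
  proof (rule that[of K])
    show "K > 0" using sum0 by (simp add: K_def)
    fix s t a assume *: "s \<in> {0..T}" "deg t \<le> N" "a \<in> ctensor_power (deg t)"
    show "norm (Psi_tree V id (y s) t a) \<le> K * norm a"
      using k(2)[OF *(2,1,3)] mult_right_mono[OF kK[OF *(2)] norm_ge_zero[of a]] by linarith
  qed
qed

text \<open>Where \<omega> is positive and small the estimate is used with
  \<open>q = \<omega> z powr (1 / p)\<close>; with \<open>q = 1\<close> it gives boundedness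
  everywhere. \<open>little_o_majorant\<close> combines the two.\<close>

lemma id_expansion_imp_smooth_expansion:
  fixes V :: "'e \<Rightarrow> 'f::banach \<Rightarrow> 'f" and f :: "'f \<Rightarrow> 'g::banach"
  assumes V: "\<And>e. smooth (V e)" and p: "p \<ge> 1" and \<omega>: "control T \<omega>"
    and x: "branched_rough_path T p \<omega> x" and y: "continuous_on {0..T} y"
    and def_id: "\<And>s. s \<in> {0..T} \<Longrightarrow> Psi_defined (nat \<lfloor>p\<rfloor>) V id (y s)"
    and cont_id: "\<And>\<tau>. deg \<tau> \<le> nat \<lfloor>p\<rfloor> \<Longrightarrow>
      continuous_on ({0..T} \<times> ctensor_power (deg \<tau>)) (\<lambda>(s, a). Psi_tree V id (y s) \<tau> a)"
    and \<theta>: "((\<lambda>h. \<theta> h / h) \<longlongrightarrow> 0) (at 0)" and id_bound: "\<And>s t. (s, t) \<in> time_simplex T \<Longrightarrow>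
      norm (y t - Psi (nat \<lfloor>p\<rfloor>) V id (y s) (x (s, t))) \<le> \<theta> (\<omega> (s, t))"
    and f: "smooth f" and def_f: "\<And>s. s \<in> {0..T} \<Longrightarrow> Psi_defined (nat \<lfloor>p\<rfloor>) V f (y s)"
  shows "\<exists>\<theta>'. ((\<lambda>h. \<theta>' h / h) \<longlongrightarrow> 0) (at 0) \<and> (\<forall>z \<in> time_simplex T.
    norm (f (y (snd z)) - Psi (nat \<lfloor>p\<rfloor>) V f (y (fst z)) (x z)) \<le> \<theta>' (\<omega> z))"
proof -
  define N where "N = nat \<lfloor>p\<rfloor>"
  \<comment> \<open>\<open>N \<le> p\<close> keeps the exponents \<open>i / p\<close> at most 1;
    \<open>p < N + 1\<close> makes the discarded terms negligible against \<omega>.\<close>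
  have N: "real N \<le> p" "p < real (Suc N)" using p by (auto simp: N_def) linarith+
  let ?S = "time_simplex T"
  have memS: "fst z \<in> {0..T}" "snd z \<in> {0..T}" if "z \<in> ?S" for z
    using that by (auto simp: time_simplex_def)
  have \<omega>0: "\<omega> z \<ge> 0" if "z \<in> ?S" for z using \<omega> that by (simp add: control_def)
  obtain K where K: "K > 0" "\<And>s t a. s \<in> {0..T} \<Longrightarrow> deg t \<le> N \<Longrightarrow> a \<in> ctensor_power (deg t) \<Longrightarrow>
    norm (Psi_tree V id (y s) t a) \<le> K * norm a"
    using Psi_id_uniform_bound[OF def_id cont_id] unfolding N_def by metis
  define A where "A = (\<Sum>i\<le>N. card {t. deg t = i} * K)"
  have A: "A \<ge> 0" unfolding A_def using K by (intro sum_nonneg) auto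
  have cardA: "card {t. deg t = i} * K \<le> A" if "i \<le> N" for i
    unfolding A_def using that K by (intro member_le_sum[where f = "\<lambda>i. card {t. deg t = i} * K"]) auto
  \<comment> \<open>The locale with base point \<open>y (fst z)\<close> has to be entered separately
    for each \<open>z\<close>; \<open>good\<close> collects what is needed of
    \<open>increment g\<close> outside of it.\<close>
  define good where "good z P \<longleftrightarrow> (\<forall>i\<in>{1..N}. norm (P i) \<le> A * \<omega> z powr (i / p))
      \<and> Psi N V id (y (fst z)) (x z) = y (fst z) + (\<Sum>i=1..N. P i)
      \<and> Psi N V f (y (fst z)) (x z) = degree_expansion N P f (y (fst z))" for z P
  have "\<exists>P. good z P" if z: "z \<in> ?S" for z
  proof -
    interpret smooth_fields \<iota> \<rho> V "y (fst z)" by unfold_locales (rule V)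
    obtain g where g: "group_like g" "x z = trunc N g"
      using x z unfolding branched_rough_path_def N_def by blast
    note di = def_id[OF memS(1)[OF z], folded N_def] and df = def_f[OF memS(1)[OF z], folded N_def]
    have "norm (increment g i) \<le> A * \<omega> z powr (i / p)" if i: "i \<in> {1..N}" for i
    proof -
      have "degree_norm i (x z) \<le> \<omega> z powr (i / p)"
        using x z i unfolding branched_rough_path_def N_def by blast
      moreover have "norm (increment g i) \<le> card {t. deg t = i} * (K * degree_norm i (trunc N g))"
        using i K memS(1)[OF z] by (intro norm_increment[OF g(1) _ di]) auto
      ultimately have "norm (increment g i) \<le> card {t. deg t = i} * K * \<omega> z powr (i / p)"
        using K(1) g(2) by (smt (verit) mult.assoc mult_left_mono of_nat_0_le_iff)
      also have "\<dots> \<le> A * \<omega> z powr (i / p)"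
        using cardA[of i] i by (intro mult_right_mono) auto
      finally show ?thesis .
    qed
    then show ?thesis
      using Psi_id_expansion[OF g(1) di] Psi_expansion[OF g(1) f di df] unfolding g(2) good_def
      by (intro exI[of _ "increment g"]) auto
  qed
  define P where "P z = (SOME P. good z P)" for z
  have "good z (P z)" if "z \<in> ?S" for z
    unfolding P_def using \<open>\<And>z. z \<in> ?S \<Longrightarrow> \<exists>P. good z P\<close>[OF that] by (rule someI_ex)
  then have P: "\<And>z i. z \<in> ?S \<Longrightarrow> i \<in> {1..N} \<Longrightarrow> norm (P z i) \<le> A * \<omega> z powr (real i / p)"
    and Psi_id: "\<And>z. z \<in> ?S \<Longrightarrow> Psi N V id (y (fst z)) (x z) = y (fst z) + (\<Sum>i=1..N. P z i)"
    and Psi_f: "\<And>z. z \<in> ?S \<Longrightarrow> Psi N V f (y (fst z)) (x z)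
      = degree_expansion N (P z) f (y (fst z))"
    unfolding good_def by blast+
  define D where "D z = y (snd z) - y (fst z)" for z
  \<comment> \<open>All segments between points of the path, on which the Taylor remainders have to
    be controlled.\<close>
  define seg where "seg = (\<lambda>(c, s, t). y s + c *\<^sub>R (y t - y s)) ` ({0..1::real} \<times> {0..T} \<times> {0..T})"
  have "compact seg"
    unfolding seg_def
  proof (rule compact_continuous_image)
    have "continuous_on ({0..1::real} \<times> {0..T} \<times> {0..T}) (\<lambda>z. y (fst (snd z)) + fst z *\<^sub>R (y (snd (snd z)) - y (fst (snd z))))"
      by (intro continuous_intros continuous_on_compose2[OF y]) auto
    then show "continuous_on ({0..1::real} \<times> {0..T} \<times> {0..T}) (\<lambda>(c, s, t). y s + c *\<^sub>R (y t - y s))"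
      by (simp add: case_prod_unfold)
  qed (intro compact_Times compact_Icc)
  have in_seg: "y (fst z) + c *\<^sub>R D z \<in> seg" if "z \<in> ?S" "c \<in> {0..1}" for z c
    using memS[OF that(1)] that(2) unfolding seg_def D_def by (intro image_eqI[of _ _ "(c, fst z, snd z)"]) (auto simp: case_prod_unfold mem_Times_iff)
  have "bounded (\<omega> ` ?S)"
    using \<omega> compact_time_simplex by (intro compact_imp_bounded compact_continuous_image) (auto simp: control_def)
  then obtain W where W: "\<And>z. z \<in> ?S \<Longrightarrow> norm (\<omega> z) \<le> W"
    unfolding bounded_iff by blast
  have "bounded (y ` {0..T})" by (intro compact_imp_bounded compact_continuous_image[OF y] compact_Icc)
  then obtain Y where Y: "\<And>s. s \<in> {0..T} \<Longrightarrow> norm (y s) \<le> Y"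
    unfolding bounded_iff by blast
  \<comment> \<open>\<open>A * (1 + \<bar>W\<bar>)\<close> and \<open>2 * \<bar>Y\<bar>\<close>
    bound the \<open>P z i\<close> and \<open>D z\<close> for \<open>q = 1\<close>, and
    \<open>N * A + 1\<close> is the factor for \<open>D z\<close> where \<omega> is small.\<close>
  define A' where "A' = A * (1 + \<bar>W\<bar>) + 2 * \<bar>Y\<bar> + N * A + 1"
  have A': "A' \<ge> 0" "A * (1 + \<bar>W\<bar>) \<le> A'" "2 * \<bar>Y\<bar> \<le> A'" "A \<le> A'" "N * A + 1 \<le> A'"
    using A by (simp_all add: A'_def algebra_simps add_nonneg_nonneg)
  obtain C where C: "C \<ge> 0" "\<forall>y D P q. (\<forall>s\<in>{0..1}. y + s *\<^sub>R D \<in> seg) \<longrightarrow> 0 \<le> q \<longrightarrow> q \<le> 1 \<longrightarrow>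
    (\<forall>i\<in>{1..N}. norm (P i) \<le> A' * q ^ i) \<longrightarrow> norm D \<le> A' * q \<longrightarrow>
    norm (f (y + D) - degree_expansion N P f y)
      \<le> C * (norm (D - (\<Sum>i=1..N. P i)) + q ^ Suc N)"
    using smooth_increment_estimate[OF f \<open>compact seg\<close> A'(1), of N] by blast
  define e where "e z = norm (f (y (snd z)) - Psi N V f (y (fst z)) (x z))" for z
  define R where "R z = norm (D z - (\<Sum>i=1..N. P z i))" for z
  have est: "e z \<le> C * (R z + q ^ Suc N)"
    if "z \<in> ?S" "0 \<le> q" "q \<le> 1" "\<And>i. i \<in> {1..N} \<Longrightarrow> norm (P z i) \<le> A' * q ^ i" "norm (D z) \<le> A' * q" for z q
    using C(2)[rule_format, OF in_seg[OF that(1)] that(2-5)] by (simp add: e_def R_def Psi_f[OF that(1)] D_def)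
  have R\<theta>: "R z \<le> \<theta> (\<omega> z)" if "z \<in> ?S" for z
    using id_bound[of "fst z" "snd z"] that Psi_id[OF that] by (simp add: R_def D_def N_def diff_diff_eq)
  have "\<exists>\<theta>'. ((\<lambda>h. \<theta>' h / h) \<longlongrightarrow> 0) (at 0) \<and> (\<forall>z \<in> ?S. e z \<le> \<theta>' (\<omega> z))"
  proof (rule little_o_majorant[OF \<omega>0])
    show "e z \<ge> 0" for z by (simp add: e_def)
    show "e z \<le> C * (A' + N * A' + 1)" if z: "z \<in> ?S" for z
    proof -
      have P1: "norm (P z i) \<le> A' * 1 ^ i" if i: "i \<in> {1..N}" for i
      proof -
        \<comment> \<open>\<open>1 + \<bar>W\<bar>\<close> is at least 1, so the exponent
          \<open>i / p\<close> may be raised to 1.\<close>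
        have "\<omega> z powr (real i / p) \<le> (1 + \<bar>W\<bar>) powr (real i / p)"
          using W[OF z] \<omega>0[OF z] p by (intro powr_mono2) auto
        also have "\<dots> \<le> (1 + \<bar>W\<bar>) powr 1" using i N p by (intro powr_mono) auto
        finally have "A * \<omega> z powr (real i / p) \<le> A * (1 + \<bar>W\<bar>)" using A by (intro mult_left_mono) auto
        then show ?thesis using P[OF z i] A' by simp
      qed
      have D1: "norm (D z) \<le> A' * 1"
      proof -
        have "norm (D z) \<le> norm (y (snd z)) + norm (y (fst z))" unfolding D_def by (rule norm_triangle_ineq4)
        also have "\<dots> \<le> 2 * \<bar>Y\<bar>" using Y[OF memS(1)[OF z]] Y[OF memS(2)[OF z]] by linarith
        finally show ?thesis using A' by simp
      qed
      have "norm (\<Sum>i=1..N. P z i) \<le> N * A'" by (rule norm_sum_powers[OF P1]) (use A' in auto)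
      then have "R z \<le> A' + N * A'" using D1 norm_triangle_ineq4[of "D z"] unfolding R_def by (smt (verit))
      then have "C * (R z + 1 ^ Suc N) \<le> C * (A' + N * A' + 1)" using C(1) by (intro mult_left_mono) auto
      with est[OF z _ _ P1 D1] show ?thesis by simp
    qed
    fix \<epsilon> :: real assume \<epsilon>: "\<epsilon> > 0"
    \<comment> \<open>Each of the two error terms will be at most
      \<open>\<epsilon>' * \<omega> z\<close>, whence the \<open>2\<close>; \<open>C + 1\<close>
      avoids a division by zero, and \<open>\<epsilon>' \<le> 1\<close> helps to bound
      \<open>D z\<close>.\<close>
    define \<epsilon>' where "\<epsilon>' = min 1 (\<epsilon> / (2 * (C + 1)))"
    have \<epsilon>': "\<epsilon>' > 0" "\<epsilon>' \<le> 1" "C * \<epsilon>' \<le> \<epsilon> / 2"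
    proof -
      show "\<epsilon>' > 0" "\<epsilon>' \<le> 1" using \<epsilon> C(1) by (auto simp: \<epsilon>'_def)
      have "C * \<epsilon>' \<le> C * (\<epsilon> / (2 * (C + 1)))" using C(1) by (intro mult_left_mono) (auto simp: \<epsilon>'_def)
      also have "\<dots> \<le> \<epsilon> / 2" using C(1) \<epsilon> by (simp add: field_simps)
      finally show "C * \<epsilon>' \<le> \<epsilon> / 2" .
    qed
    obtain \<delta>1 where \<delta>1: "\<delta>1 > 0" "\<And>h. h \<noteq> 0 \<Longrightarrow> norm h < \<delta>1 \<Longrightarrow> norm (\<theta> h / h) < \<epsilon>'"
      using LIM_D[OF \<theta> \<epsilon>'(1)] by auto
    \<comment> \<open>The surplus exponent: \<open>q ^ Suc N\<close> will be
      \<open>\<omega> z powr (c + 1)\<close>.\<close>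
    define c where "c = real (Suc N) / p - 1"
    have c: "c > 0" using N p by (simp add: c_def field_simps)
    \<comment> \<open>Chosen such that \<open>\<delta>2 powr c = \<epsilon>'\<close>.\<close>
    define \<delta>2 where "\<delta>2 = \<epsilon>' powr (1 / c)"
    have \<delta>2: "\<delta>2 > 0" using \<epsilon>' by (simp add: \<delta>2_def)
    have "e z \<le> \<epsilon> * \<omega> z" if z: "z \<in> ?S" and w: "0 < \<omega> z" "\<omega> z < min 1 (min \<delta>1 \<delta>2)" for z
    proof -
      define q where "q = \<omega> z powr (1 / p)"
      have w1: "\<omega> z < 1" "\<omega> z < \<delta>1" "\<omega> z < \<delta>2" using w by auto
      have q: "0 \<le> q" "q \<le> 1" using w w1 p by (auto simp: q_def intro: powr_le1)
      have wq: "\<omega> z \<le> q"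
        using powr_mono'[of "1 / p" 1 "\<omega> z"] w w1 p by (simp add: q_def)
      have Pq0: "norm (P z i) \<le> A * q ^ i" if "i \<in> {1..N}" for i
        using P[OF z that] powr_eq_powers[OF w(1), of i p] by (simp add: q_def)
      have Pq: "norm (P z i) \<le> A' * q ^ i" if "i \<in> {1..N}" for i
        using Pq0[OF that] mult_right_mono[OF A'(4) zero_le_power[OF q(1), of i]] by linarith
      have "norm (\<theta> (\<omega> z) / \<omega> z) < \<epsilon>'" using \<delta>1(2)[of "\<omega> z"] w w1 by simp
      then have "\<theta> (\<omega> z) < \<epsilon>' * \<omega> z" using w(1) by (simp add: field_simps abs_less_iff)
      then have Rw: "R z \<le> \<epsilon>' * \<omega> z" using R\<theta>[OF z] by linarith
      have "norm (P z i) \<le> A * q" if i: "i \<in> {1..N}" for i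
      proof -
        have "q ^ i \<le> q ^ 1" using i q by (intro power_decreasing) auto
        then show ?thesis using Pq0[OF i] mult_left_mono[OF _ A, of "q ^ i" q] by simp
      qed
      then have "norm (\<Sum>i=1..N. P z i) \<le> (\<Sum>i=1..N. A * q)" by (rule sum_norm_le)
      \<comment> \<open>No modulus of continuity of the path is given. The size of
        \<open>D z\<close> follows from the hypothesis for the identity: the prediction is of order
        \<open>q\<close>, and the error is at most \<open>\<omega> z\<close>, hence at most
        \<open>q\<close>.\<close>
      moreover have "norm (D z) \<le> norm (\<Sum>i=1..N. P z i) + R z"
        using norm_triangle_ineq[of "\<Sum>i=1..N. P z i" "D z - (\<Sum>i=1..N. P z i)"] by (simp add: R_def)
      moreover have "R z \<le> q" using Rw wq mult_right_mono[OF \<epsilon>'(2) \<omega>0[OF z]] by linarith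
      ultimately have "norm (D z) \<le> (N * A + 1) * q" by (simp add: algebra_simps)
      also have "\<dots> \<le> A' * q" using A'(5) q by (intro mult_right_mono) auto
      finally have Dq: "norm (D z) \<le> A' * q" .
      have "q ^ Suc N = \<omega> z powr (real (Suc N) / p)" unfolding q_def by (rule powr_eq_powers[OF w(1), symmetric])
      also have "\<dots> = \<omega> z powr (c + 1)" by (simp add: c_def)
      also have "\<dots> = \<omega> z powr c * \<omega> z" using w(1) by (simp add: powr_add)
      also have "\<omega> z powr c \<le> \<delta>2 powr c" using w w1 c by (intro powr_mono2) auto
      also have "\<delta>2 powr c = \<epsilon>'" using c \<epsilon>' by (simp add: \<delta>2_def powr_powr)
      finally have qw: "q ^ Suc N \<le> \<epsilon>' * \<omega> z" using w(1) by (simp add: mult_right_mono)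
      have "e z \<le> C * (R z + q ^ Suc N)" by (rule est[OF z q Pq Dq])
      also have "\<dots> \<le> C * (\<epsilon>' * \<omega> z + \<epsilon>' * \<omega> z)" using Rw qw C(1) by (intro mult_left_mono add_mono)
      also have "\<dots> = 2 * (C * \<epsilon>') * \<omega> z" by (simp add: algebra_simps)
      also have "\<dots> \<le> \<epsilon> * \<omega> z" using \<epsilon>'(3) w(1) by (intro mult_right_mono) auto
      finally show ?thesis .
    qed
    then show "\<exists>\<delta>>0. \<forall>z\<in>?S. 0 < \<omega> z \<longrightarrow> \<omega> z < \<delta> \<longrightarrow> e z \<le> \<epsilon> * \<omega> z"
      using \<delta>1(1) \<delta>2 by (intro exI[of _ "min 1 (min \<delta>1 \<delta>2)"]) auto
  qed
  then show ?thesis by (simp add: e_def N_def)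
qed

end

theorem theorem5p3:
  fixes \<iota> :: "'e::banach \<Rightarrow> 'a::{real_normed_algebra_1, banach}"
    and \<rho> :: "tree \<Rightarrow> nat \<Rightarrow> nat"
    and V :: "'e \<Rightarrow> 'f::banach \<Rightarrow> 'f"
    and T p :: real
    and \<omega> :: "real \<times> real \<Rightarrow> real"
    and x :: "real \<times> real \<Rightarrow> tree \<Rightarrow> 'a set"
    and y :: "real \<Rightarrow> 'f"
  assumes "labelled_trees \<iota> \<rho>"
    and "continuous_on UNIV (\<lambda>(e, z). V e z)"
    and "\<And>z. linear (\<lambda>e. V e z)"
    and "\<And>e. smooth (V e)"
    and "T > 0" and "p \<ge> 1"
    and "control T \<omega>"
    and "labelled_trees.branched_rough_path \<iota> \<rho> T p \<omega> x"
    and "continuous_on {0..T} y"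
    and Psi_id_defined: "\<And>s. s \<in> {0..T} \<Longrightarrow> labelled_trees.Psi_defined \<iota> \<rho> (nat \<lfloor>p\<rfloor>) V id (y s)"
    and Psi_id_continuous: "\<And>\<tau>. deg \<tau> \<le> nat \<lfloor>p\<rfloor> \<Longrightarrow>
          continuous_on ({0..T} \<times> tensor_powers.ctensor_power \<iota> (deg \<tau>))
            (\<lambda>(s, a). labelled_trees.Psi_tree \<iota> \<rho> V id (y s) \<tau> a)"
  shows
    "((\<exists>\<theta> :: real \<Rightarrow> real. ((\<lambda>h. \<theta> h / h) \<longlongrightarrow> 0) (at 0) \<and>
         (\<forall>(s, t) \<in> time_simplex T.
            norm (y t - labelled_trees.Psi \<iota> \<rho> (nat \<lfloor>p\<rfloor>) V id (y s) (x (s, t))) \<le> \<theta> (\<omega> (s, t))))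
      \<longrightarrow>
      (\<forall>f :: 'f \<Rightarrow> 'g::banach. smooth f \<longrightarrow>
         (\<forall>s \<in> {0..T}. labelled_trees.Psi_defined \<iota> \<rho> (nat \<lfloor>p\<rfloor>) V f (y s)) \<longrightarrow>
         (\<exists>\<theta> :: real \<Rightarrow> real. ((\<lambda>h. \<theta> h / h) \<longlongrightarrow> 0) (at 0) \<and>
            (\<forall>(s, t) \<in> time_simplex T.
               norm (f (y t) - labelled_trees.Psi \<iota> \<rho> (nat \<lfloor>p\<rfloor>) V f (y s) (x (s, t))) \<le> \<theta> (\<omega> (s, t))))))
     \<and>
     ((\<forall>f :: 'f \<Rightarrow> 'f. smooth f \<longrightarrow>
         (\<forall>s \<in> {0..T}. labelled_trees.Psi_defined \<iota> \<rho> (nat \<lfloor>p\<rfloor>) V f (y s)) \<longrightarrow>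
         (\<exists>\<theta> :: real \<Rightarrow> real. ((\<lambda>h. \<theta> h / h) \<longlongrightarrow> 0) (at 0) \<and>
            (\<forall>(s, t) \<in> time_simplex T.
               norm (f (y t) - labelled_trees.Psi \<iota> \<rho> (nat \<lfloor>p\<rfloor>) V f (y s) (x (s, t))) \<le> \<theta> (\<omega> (s, t)))))
      \<longrightarrow>
      (\<exists>\<theta> :: real \<Rightarrow> real. ((\<lambda>h. \<theta> h / h) \<longlongrightarrow> 0) (at 0) \<and>
         (\<forall>(s, t) \<in> time_simplex T.
            norm (y t - labelled_trees.Psi \<iota> \<rho> (nat \<lfloor>p\<rfloor>) V id (y s) (x (s, t))) \<le> \<theta> (\<omega> (s, t)))))"
proof (intro conjI impI allI)
  interpret labelled_trees \<iota> \<rho> by (rule assms(1))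
  {
    fix f :: "'f \<Rightarrow> 'g"
    assume id: "\<exists>\<theta> :: real \<Rightarrow> real. ((\<lambda>h. \<theta> h / h) \<longlongrightarrow> 0) (at 0) \<and>
         (\<forall>(s, t) \<in> time_simplex T. norm (y t - Psi (nat \<lfloor>p\<rfloor>) V id (y s) (x (s, t))) \<le> \<theta> (\<omega> (s, t)))"
      and f: "smooth f" and def: "\<forall>s \<in> {0..T}. Psi_defined (nat \<lfloor>p\<rfloor>) V f (y s)"
    from id obtain \<theta> :: "real \<Rightarrow> real" where \<theta>: "((\<lambda>h. \<theta> h / h) \<longlongrightarrow> 0) (at 0)"
      "\<And>s t. (s, t) \<in> time_simplex T \<Longrightarrow> norm (y t - Psi (nat \<lfloor>p\<rfloor>) V id (y s) (x (s, t))) \<le> \<theta> (\<omega> (s, t))"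
      by blast
    have "\<exists>\<theta>'. ((\<lambda>h. \<theta>' h / h) \<longlongrightarrow> 0) (at 0) \<and> (\<forall>z \<in> time_simplex T.
        norm (f (y (snd z)) - Psi (nat \<lfloor>p\<rfloor>) V f (y (fst z)) (x z)) \<le> \<theta>' (\<omega> z))"
      by (rule id_expansion_imp_smooth_expansion[OF assms(4,6-11) \<theta> f bspec[OF def]])
    then show "\<exists>\<theta> :: real \<Rightarrow> real. ((\<lambda>h. \<theta> h / h) \<longlongrightarrow> 0) (at 0) \<and>
      (\<forall>(s, t) \<in> time_simplex T. norm (f (y t) - Psi (nat \<lfloor>p\<rfloor>) V f (y s) (x (s, t))) \<le> \<theta> (\<omega> (s, t)))"
      by (simp add: case_prod_unfold)
  }
  assume "\<forall>f :: 'f \<Rightarrow> 'f. smooth f \<longrightarrow> (\<forall>s \<in> {0..T}. Psi_defined (nat \<lfloor>p\<rfloor>) V f (y s)) \<longrightarrow>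
      (\<exists>\<theta> :: real \<Rightarrow> real. ((\<lambda>h. \<theta> h / h) \<longlongrightarrow> 0) (at 0) \<and>
        (\<forall>(s, t) \<in> time_simplex T. norm (f (y t) - Psi (nat \<lfloor>p\<rfloor>) V f (y s) (x (s, t))) \<le> \<theta> (\<omega> (s, t))))"
  \<comment> \<open>The identity is itself one of the functions over which the assumption
    quantifies, and its \<Psi> is defined along the path.\<close>
  from this[rule_format, OF smooth_id Psi_id_defined]
  show "\<exists>\<theta> :: real \<Rightarrow> real. ((\<lambda>h. \<theta> h / h) \<longlongrightarrow> 0) (at 0) \<and>
      (\<forall>(s, t) \<in> time_simplex T. norm (y t - Psi (nat \<lfloor>p\<rfloor>) V id (y s) (x (s, t))) \<le> \<theta> (\<omega> (s, t)))"
    by simp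
qed

end
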